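(* Let $\mathsf{NQ.L}$ be any properly closed nested calculus. The following rules of left and right contraction are height-preserving admissible in $\mathsf{NQ.L}$ (for every one-hole context $\mathcal S\{\cdot\}$, signature $X$, multisets of formulas $\Gamma,\Delta$ and formula $A$): $$\dfrac{\mathcal S\{X;\Gamma,A,A\Rightarrow\Delta\}}{\mathcal S\{X;\Gamma,A\Rightarrow\Delta\}}\;(CL)\qquad\dfrac{\mathcal S\{X;\Gamma\Rightarrow\Delta,A,A\}}{\mathcal S\{X;\Gamma\Rightarrow\Delta,A\}}\;(CR)$$
   Context: **Language.** Fix, for each $n$, an at most countable set of $n$-ary predicates $R^n_i$, and a denumerable set of variables. Formulas of $\mathcal L$: $A::=R_i^n(x_1,\dots,x_n)\mid x_1=x_2\mid\bot\mid A\supset A\mid\forall xA\mid\Box A$. Atomic formulas are those of shape $R_i^n(x_1,\dots,x_n)$ or $x_1=x_2$. $A(y/x)$ is capture-avoiding substitution (renaming bound variables if needed). **Axiom sets.** A frame is $\langle\mathcal W,\mathcal R,\mathcal D\rangle$ with $\mathcal W\neq\varnothing$, $\mathcal R\subseteq\mathcal W^2$, and $\mathcal D$ assigning to each $w\in\mathcal W$ a possibly empty set $\mathcal D_w$, with $\mathcal D_v\ne\varnothing$ for some $v$. Axiom names correspond to frame properties: $\mathbf D$: $\mathcal R$ serial; $\mathbf T$: reflexive; $\mathbf B$: symmetric; $\mathbf 4$: transitive; $\mathbf 5$: Euclidean ($w\mathcal Rv$ and $w\mathcal Ru$ imply $v\mathcal Ru$); $\mathbf{CBF}$: $w\mathcal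 Rv$ implies $\mathcal D_w\subseteq\mathcal D_v$; $\mathbf{BF}$: $w\mathcal Rv$ implies $\mathcal D_w\supseteq\mathcal D_v$; $\mathbf{UI}$: $\mathcal D_w=\mathcal D_v$ for all $w,v$. For $\mathsf L\subseteq\{\mathbf D,\mathbf T,\mathbf B,\mathbf 4,\mathbf 5,\mathbf{CBF},\mathbf{BF},\mathbf{UI}\}$, a $\mathsf{Q.L}$-frame is a frame with the properties of all members of $\mathsf L$. $\mathsf L$ is properly closed iff for every $Z\in\{\mathbf 4,\mathbf 5,\mathbf{CBF},\mathbf{BF}\}$, if all $\mathsf{Q.L}$-frames have the property of $Z$, then $Z\in\mathsf L$. **Nested sequents.** A sequent is $X;\Gamma\Rightarrow\Delta$ with $X$ (the signature) a finite multiset of variables and $\Gamma,\Delta$ finite multisets of formulas (an omitted signature is empty). A nested sequent is $X;\Gamma\Rightarrow\Delta,[\mathcal S_1],\dots,[\mathcal S_n]$ with $\mathcal S_i$ nested sequents: a finite tree of sequents with root $X;\Gamma\Rightarrow\Delta$ and the $\mathcal S_i$ as immediate subtrees (order irrelevant). A context $\mathcal S\{\cdot\}\cdots\{\cdot\}$ is a nested sequent with finitely many holes, each located at some node, in arbitrary relative positions (several holes may be at one node). Plugging $Y;\Pi\Rightarrow\Sigma,[\mathcal S'_1],\dots,[\mathcal S_k']$ into a hole at a node adds $Y,\Pi,\Sigma$ to the signature, antecedent, succedent of that node (multiset union) and adds the $\mathcal S'_j$ as further children; plugging $\emptyset$ removes the hole. The depth of a hole is the distance of its node from the root. When a bracketed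 component $[Y;\Pi\Rightarrow\Sigma]$ is displayed in both premiss and conclusion of a rule, that node may have further children, which stay attached to it; components displayed as newly created are leaves. **Rules** (premisses / conclusion). $\mathsf{NQ.K}$ consists of: - Initial sequents $\mathcal S\{X;P,\Gamma\Rightarrow\Delta,P\}$, $P$ atomic; and $L\bot$: $\mathcal S\{X;\bot,\Gamma\Rightarrow\Delta\}$ (no premisses). - $L{\supset}$: $\mathcal S\{X;\Gamma\Rightarrow\Delta,A\}$ and $\mathcal S\{X;B,\Gamma\Rightarrow\Delta\}$ / $\mathcal S\{X;A\supset B,\Gamma\Rightarrow\Delta\}$. $R{\supset}$: $\mathcal S\{X;A,\Gamma\Rightarrow\Delta,B\}$ / $\mathcal S\{X;\Gamma\Rightarrow\Delta,A\supset B\}$. - $L\forall$: $\mathcal S\{X,z;A(z/x),\forall xA,\Gamma\Rightarrow\Delta\}$ / $\mathcal S\{X,z;\forall xA,\Gamma\Rightarrow\Delta\}$. $R\forall$: $\mathcal S\{X,y;\Gamma\Rightarrow\Delta,A(y/x)\}$ / $\mathcal S\{X;\Gamma\Rightarrow\Delta,\forall xA\}$, $y$ (the eigenvariable) fresh, i.e. not occurring in the conclusion. - $L\Box$: $\mathcal S\{X;\Box A,\Gamma\Rightarrow\Delta,[Y;A,\Pi\Rightarrow\Sigma]\}$ / $\mathcal S\{X;\Box A,\Gamma\Rightarrow\Delta,[Y;\Pi\Rightarrow\Sigma]\}$. $R\Box$: $\mathcal S\{X;\Gamma\Rightarrow\Delta,[\emptyset;\Rightarrow A]\}$ / $\mathcal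 S\{X;\Gamma\Rightarrow\Delta,\Box A\}$. - $Ref$: $\mathcal S\{X;x=x,\Gamma\Rightarrow\Delta\}$ / $\mathcal S\{X;\Gamma\Rightarrow\Delta\}$. $Repl$ ($P$ atomic): $\mathcal S\{X;P(y/z),x=y,P(x/z),\Gamma\Rightarrow\Delta\}$ / $\mathcal S\{X;x=y,P(x/z),\Gamma\Rightarrow\Delta\}$. $Repl_X$: $\mathcal S\{X,x,y;x=y,\Gamma\Rightarrow\Delta\}$ / $\mathcal S\{X,x;x=y,\Gamma\Rightarrow\Delta\}$. $Rig$: $\mathcal S\{X;x=y,\Gamma\Rightarrow\Delta\}\{Y;x=y,\Pi\Rightarrow\Sigma\}$ / $\mathcal S\{X;x=y,\Gamma\Rightarrow\Delta\}\{Y;\Pi\Rightarrow\Sigma\}$. $\mathsf{NQ.L}$ adds the rule of each member of $\mathsf L$: - $R_D$ ($\mathbf D$): $\mathcal S\{X;\Gamma\Rightarrow\Delta,[\emptyset;\Rightarrow]\}$ / $\mathcal S\{X;\Gamma\Rightarrow\Delta\}$. $R_T$ ($\mathbf T$): $\mathcal S\{X;A,\Box A,\Gamma\Rightarrow\Delta\}$ / $\mathcal S\{X;\Box A,\Gamma\Rightarrow\Delta\}$. $R_B$ ($\mathbf B$): $\mathcal S\{X;A,\Gamma\Rightarrow\Delta,[Y;\Box A,\Pi\Rightarrow\Sigma]\}$ / $\mathcal S\{X;\Gamma\Rightarrow\Delta,[Y;\Box A,\Pi\Rightarrow\Sigma]\}$. $R_4$ ($\mathbf 4$): $\mathcal S\{X;\Box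 A,\Gamma\Rightarrow\Delta,[Y;\Box A,\Pi\Rightarrow\Sigma]\}$ / $\mathcal S\{X;\Box A,\Gamma\Rightarrow\Delta,[Y;\Pi\Rightarrow\Sigma]\}$. $R_5$ ($\mathbf 5$): $\mathcal S\{X;\Box A,\Gamma\Rightarrow\Delta\}\{Y;\Box A,\Pi\Rightarrow\Sigma\}$ / $\mathcal S\{X;\Box A,\Gamma\Rightarrow\Delta\}\{Y;\Pi\Rightarrow\Sigma\}$, first hole of depth $\ge1$. - $R_{cbf}$ ($\mathbf{CBF}$): $\mathcal S\{X,x;\Gamma\Rightarrow\Delta,[Y,x;\Pi\Rightarrow\Sigma]\}$ / $\mathcal S\{X,x;\Gamma\Rightarrow\Delta,[Y;\Pi\Rightarrow\Sigma]\}$. $R_{bf}$ ($\mathbf{BF}$): $\mathcal S\{X,x;\Gamma\Rightarrow\Delta,[Y,x;\Pi\Rightarrow\Sigma]\}$ / $\mathcal S\{X;\Gamma\Rightarrow\Delta,[Y,x;\Pi\Rightarrow\Sigma]\}$. $R_{ui}$ ($\mathbf{UI}$): $\mathcal S\{X,x;\Gamma\Rightarrow\Delta\}$ / $\mathcal S\{X;\Gamma\Rightarrow\Delta\}$. - $R_{5dom}$: $\mathcal S\{X,x;\Gamma\Rightarrow\Delta\}\{Y,x;\Pi\Rightarrow\Sigma\}$ / $\mathcal S\{X,x;\Gamma\Rightarrow\Delta\}\{Y;\Pi\Rightarrow\Sigma\}$, both holes of depth $\ge1$; it is a rule of $\mathsf{NQ.L}$ iff $\mathbf 5\in\mathsf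 L$ and $\{\mathbf{CBF},\mathbf{BF}\}\cap\mathsf L\ne\emptyset$. $\mathsf{NQ.L}$ is properly closed iff $\mathsf L$ is properly closed and $R_{5dom}$ is included exactly as just stated. **Derivations.** An $\mathsf{NQ.L}$-derivation of $\mathcal S$ is a finite tree of nested sequents with root $\mathcal S$, built by the rules, with leaves initial sequents (or instances of $L\bot$). Only derivations of pure sequents are considered: no variable occurs both free and bound, and eigenvariables are pairwise distinct. Height is the number of nodes on a longest branch. $\mathcal S$ is derivable iff $\mathcal S$ or an alphabetical variant (bound renaming) of it has a derivation. A rule is height-preserving admissible if whenever its premisses are derivable with height at most $n$, so is its conclusion. *)

theory Defs
  imports "HOL-Library.Multiset" "HOL-Library.Countable_Set"
begin

section \<open>Formulas\<close>

type_synonym var = nat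

text \<open>\<open>Rel i [x\<^sub>1, \<dots>, x\<^sub>n]\<close> is \<open>R\<^sub>i\<^sup>n(x\<^sub>1, \<dots>, x\<^sub>n)\<close>; the arity is the length of the argument list.\<close>

datatype fm =
    Rel nat "var list"
  | Eq var var
  | Bot
  | Imp fm fm
  | Forall var fm
  | Box fm

text \<open>An arbitrary family \<open>Pr\<close> of sets of indices, one for each arity, fixes the language:
  there is an \<open>n\<close>-ary predicate \<open>R\<^sub>i\<^sup>n\<close> for each \<open>i \<in> Pr n\<close>.\<close>

primrec in_lang :: "(nat \<Rightarrow> nat set) \<Rightarrow> fm \<Rightarrow> bool" where
  "in_lang Pr (Rel i xs) \<longleftrightarrow> i \<in> Pr (length xs)"
| "in_lang Pr (Eq x y) \<longleftrightarrow> True"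
| "in_lang Pr Bot \<longleftrightarrow> True"
| "in_lang Pr (Imp A B) \<longleftrightarrow> in_lang Pr A \<and> in_lang Pr B"
| "in_lang Pr (Forall x A) \<longleftrightarrow> in_lang Pr A"
| "in_lang Pr (Box A) \<longleftrightarrow> in_lang Pr A"

fun atomic :: "fm \<Rightarrow> bool" where
  "atomic (Rel i xs) = True"
| "atomic (Eq x y) = True"
| "atomic _ = False"

primrec fv :: "fm \<Rightarrow> var set" where
  "fv (Rel i xs) = set xs"
| "fv (Eq x y) = {x, y}"
| "fv Bot = {}"
| "fv (Imp A B) = fv A \<union> fv B"
| "fv (Forall x A) = fv A - {x}"
| "fv (Box A) = fv A"

primrec bv :: "fm \<Rightarrow> var set" where
  "bv (Rel i xs) = {}"
| "bv (Eq x y) = {}"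
| "bv Bot = {}"
| "bv (Imp A B) = bv A \<union> bv B"
| "bv (Forall x A) = insert x (bv A)"
| "bv (Box A) = bv A"

text \<open>Simultaneous capture-avoiding substitution of variables for variables. A bound variable is
  renamed only if it would capture a substituted variable.\<close>

primrec ren :: "(var \<Rightarrow> var) \<Rightarrow> fm \<Rightarrow> fm" where
  "ren s (Rel i xs) = Rel i (map s xs)"
| "ren s (Eq x y) = Eq (s x) (s y)"
| "ren s Bot = Bot"
| "ren s (Imp A B) = Imp (ren s A) (ren s B)"
| "ren s (Forall x A) =
    (let V = s ` (fv A - {x}); x' = (if x \<in> V then LEAST v. v \<notin> V else x)
     in Forall x' (ren (s(x := x')) A))"
| "ren s (Box A) = Box (ren s A)"

text \<open>\<open>subst A y x\<close> is \<open>A(y/x)\<close>, the result of replacing the free occurrences of \<open>x\<close> by \<open>y\<close>.\<close>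

definition subst :: "fm \<Rightarrow> var \<Rightarrow> var \<Rightarrow> fm" where
  "subst A y x = ren (id(x := y)) A"

inductive alpha :: "fm \<Rightarrow> fm \<Rightarrow> bool" where
  "alpha (Rel i xs) (Rel i xs)"
| "alpha (Eq x y) (Eq x y)"
| "alpha Bot Bot"
| "alpha A A' \<Longrightarrow> alpha B B' \<Longrightarrow> alpha (Imp A B) (Imp A' B')"
| "z \<notin> {x, x'} \<union> fv A \<union> bv A \<union> fv A' \<union> bv A' \<Longrightarrow> alpha (subst A z x) (subst A' z x')
    \<Longrightarrow> alpha (Forall x A) (Forall x' A')"
| "alpha A A' \<Longrightarrow> alpha (Box A) (Box A')"


section \<open>Frames\<close>

datatype ax = AxD | AxT | AxB | Ax4 | Ax5 | AxCBF | AxBF | AxUI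

definition frame :: "'w set \<Rightarrow> ('w \<times> 'w) set \<Rightarrow> ('w \<Rightarrow> 'd set) \<Rightarrow> bool" where
  "frame W R D \<longleftrightarrow> W \<noteq> {} \<and> R \<subseteq> W \<times> W \<and> (\<exists>v\<in>W. D v \<noteq> {})"

primrec has_prop :: "ax \<Rightarrow> 'w set \<Rightarrow> ('w \<times> 'w) set \<Rightarrow> ('w \<Rightarrow> 'd set) \<Rightarrow> bool" where
  "has_prop AxD W R D \<longleftrightarrow> (\<forall>w\<in>W. \<exists>v\<in>W. (w, v) \<in> R)"
| "has_prop AxT W R D \<longleftrightarrow> refl_on W R"
| "has_prop AxB W R D \<longleftrightarrow> sym R"
| "has_prop Ax4 W R D \<longleftrightarrow> trans R"
| "has_prop Ax5 W R D \<longleftrightarrow> (\<forall>w v u. (w, v) \<in> R \<longrightarrow> (w, u) \<in> R \<longrightarrow> (v, u) \<in> R)"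
| "has_prop AxCBF W R D \<longleftrightarrow> (\<forall>w v. (w, v) \<in> R \<longrightarrow> D w \<subseteq> D v)"
| "has_prop AxBF W R D \<longleftrightarrow> (\<forall>w v. (w, v) \<in> R \<longrightarrow> D v \<subseteq> D w)"
| "has_prop AxUI W R D \<longleftrightarrow> (\<forall>w\<in>W. \<forall>v\<in>W. D w = D v)"

definition QL_frame :: "ax set \<Rightarrow> 'w set \<Rightarrow> ('w \<times> 'w) set \<Rightarrow> ('w \<Rightarrow> 'd set) \<Rightarrow> bool" where
  "QL_frame L W R D \<longleftrightarrow> frame W R D \<and> (\<forall>Z\<in>L. has_prop Z W R D)"

text \<open>A definition cannot quantify over the types of worlds and objects. Frames whose worlds
  and objects are natural numbers suffice: by \<open>QL_frames_nat\<close> below, a property that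
  holds of all of these holds of all frames over arbitrary types.\<close>

definition properly_closed :: "ax set \<Rightarrow> bool" where
  "properly_closed L \<longleftrightarrow>
    (\<forall>Z\<in>{Ax4, Ax5, AxCBF, AxBF}.
      (\<forall>(W :: nat set) R (D :: nat \<Rightarrow> nat set). QL_frame L W R D \<longrightarrow> has_prop Z W R D) \<longrightarrow> Z \<in> L)"

lemma QL_frames_nat:
  fixes W :: "'w set" and D :: "'w \<Rightarrow> 'd set"
  assumes nat: "\<And>(W :: nat set) R (D :: nat \<Rightarrow> nat set). QL_frame L W R D \<Longrightarrow> has_prop Z W R D"
    and Z: "Z \<in> {Ax4, Ax5, AxCBF, AxBF}"
    and QL: "QL_frame L W R D"
  shows "has_prop Z W R D"
proof (rule ccontr)
  assume neg: "\<not> has_prop Z W R D"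
  from QL have WR: "R \<subseteq> W \<times> W" and "\<exists>v\<in>W. D v \<noteq> {}" and props: "\<And>A. A \<in> L \<Longrightarrow> has_prop A W R D"
    by (auto simp: QL_frame_def frame_def)
  then obtain v0 d0 where v0: "v0 \<in> W" "d0 \<in> D v0" by auto
  define bad where "bad = (\<lambda>S d. case Z of
      Ax4 \<Rightarrow> \<exists>a\<in>S. \<exists>b\<in>S. \<exists>c\<in>S. (a, b) \<in> R \<and> (b, c) \<in> R \<and> (a, c) \<notin> R
    | Ax5 \<Rightarrow> \<exists>a\<in>S. \<exists>b\<in>S. \<exists>c\<in>S. (a, b) \<in> R \<and> (a, c) \<in> R \<and> (b, c) \<notin> R
    | AxCBF \<Rightarrow> \<exists>a\<in>S. \<exists>b\<in>S. (a, b) \<in> R \<and> d \<in> D a \<and> d \<notin> D b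
    | AxBF \<Rightarrow> \<exists>a\<in>S. \<exists>b\<in>S. (a, b) \<in> R \<and> d \<in> D b \<and> d \<notin> D a
    | _ \<Rightarrow> False)"
  have "\<exists>S d v. finite S \<and> S \<subseteq> W \<and> v \<in> S \<and> d \<in> D v \<and> bad S d"
  proof -
    consider (4) a b c where "Z = Ax4" "(a, b) \<in> R" "(b, c) \<in> R" "(a, c) \<notin> R"
      | (5) a b c where "Z = Ax5" "(a, b) \<in> R" "(a, c) \<in> R" "(b, c) \<notin> R"
      | (C) a b d where "Z = AxCBF" "(a, b) \<in> R" "d \<in> D a" "d \<notin> D b"
      | (B) a b d where "Z = AxBF" "(a, b) \<in> R" "d \<in> D b" "d \<notin> D a"
      using Z neg by (auto simp: trans_def subset_iff)
    then show ?thesis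
    proof cases
      case 4
      then show ?thesis using v0 WR
        by (intro exI[of _ "{v0, a, b, c}"] exI[of _ d0] exI[of _ v0]) (auto simp: bad_def)
    next
      case 5
      then show ?thesis using v0 WR
        by (intro exI[of _ "{v0, a, b, c}"] exI[of _ d0] exI[of _ v0]) (auto simp: bad_def)
    next
      case C
      then show ?thesis using WR
        by (intro exI[of _ "{a, b}"] exI[of _ d] exI[of _ a]) (auto simp: bad_def)
    next
      case B
      then show ?thesis using WR
        by (intro exI[of _ "{a, b}"] exI[of _ d] exI[of _ b]) (auto simp: bad_def)
    qed
  qed
  then obtain S d v where S: "finite S" "S \<subseteq> W" "v \<in> S" "d \<in> D v" "bad S d" by blast
  define f where "f w = (if \<exists>u\<in>W. (w, u) \<in> R then SOME u. u \<in> W \<and> (w, u) \<in> R else w)" for w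
  have f: "f w \<in> W \<and> (w, f w) \<in> R" if "\<exists>u\<in>W. (w, u) \<in> R" for w
    using that someI_ex[of "\<lambda>u. u \<in> W \<and> (w, u) \<in> R"] by (auto simp: f_def)
  have fW: "f w \<in> W" if "w \<in> W" for w
    using f[of w] that by (cases "\<exists>u\<in>W. (w, u) \<in> R") (auto simp: f_def)
  define U where "U = (\<Union>n. (f ^^ n) ` S)"
  have SU: "S \<subseteq> U" unfolding U_def by (rule subsetI, rule UN_I[of 0]) auto
  have fU: "f w \<in> U" if "w \<in> U" for w
  proof -
    from that obtain n s where "s \<in> S" "w = (f ^^ n) s" by (auto simp: U_def)
    then have "f w \<in> (f ^^ Suc n) ` S" by auto
    then show ?thesis unfolding U_def by blast
  qed
  have "(f ^^ n) s \<in> W" if "s \<in> S" for n s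
    by (induction n) (use that S fW in auto)
  then have UW: "U \<subseteq> W" by (auto simp: U_def)
  have "countable U" unfolding U_def using S(1) by (auto intro: countable_finite)
  then obtain g :: "'w \<Rightarrow> nat" where g: "inj_on g U" by (auto simp: countable_def)
  define h where "h = inv_into U g"
  have hg: "h (g w) = w" if "w \<in> U" for w using g that by (simp add: h_def)
  define W' where "W' = g ` U"
  define R' where "R' = {(i, j). i \<in> W' \<and> j \<in> W' \<and> (h i, h j) \<in> R}"
  define D' :: "nat \<Rightarrow> nat set" where "D' i = (if d \<in> D (h i) then {0} else {})" for i
  have hU: "h i \<in> U" if "i \<in> W'" for i using that hg by (auto simp: W'_def)
  have "has_prop A W' R' D'" if "A \<in> L" for A
  proof (cases A)
    case AxD
    show ?thesis unfolding AxD has_prop.simps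
    proof
      fix i assume i: "i \<in> W'"
      then have "\<exists>u\<in>W. (h i, u) \<in> R" using props[OF that] hU UW AxD by auto
      then have "(h i, f (h i)) \<in> R" using f by blast
      then show "\<exists>j\<in>W'. (i, j) \<in> R'" using i fU[OF hU[OF i]]
        by (intro bexI[of _ "g (f (h i))"]) (auto simp: R'_def hg W'_def)
    qed
  next
    case AxT
    then show ?thesis using props[OF that] hU UW by (auto simp: refl_on_def R'_def)
  next
    case AxB
    then show ?thesis using props[OF that] by (auto simp: sym_def R'_def)
  next
    case Ax4
    then have "trans R" using props[OF that] by simp
    then have "trans R'" unfolding trans_def R'_def by blast
    then show ?thesis using Ax4 by simp
  next
    case Ax5
    then have "\<forall>w v u. (w, v) \<in> R \<longrightarrow> (w, u) \<in> R \<longrightarrow> (v, u) \<in> R"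
      using props[OF that] by (simp only: has_prop.simps)
    then show ?thesis unfolding Ax5 has_prop.simps R'_def by blast
  next
    case AxCBF
    then show ?thesis using props[OF that] by (auto simp: R'_def D'_def)
  next
    case AxBF
    then show ?thesis using props[OF that] by (auto simp: R'_def D'_def)
  next
    case AxUI
    then show ?thesis using props[OF that] hU UW by (auto simp: D'_def subset_iff)
  qed
  moreover have "g v \<in> W'" "D' (g v) \<noteq> {}" using S SU by (auto simp: W'_def D'_def hg subset_iff)
  ultimately have "QL_frame L W' R' D'" by (auto simp: QL_frame_def frame_def R'_def)
  then have Z': "has_prop Z W' R' D'" by (rule nat)
  have R'g: "(g a, g b) \<in> R' \<longleftrightarrow> (a, b) \<in> R" if "a \<in> S" "b \<in> S" for a b
    using that SU by (auto simp: R'_def W'_def hg subset_iff)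
  have D'g: "D' (g a) = (if d \<in> D a then {0} else {})" if "a \<in> S" for a
    using that SU by (auto simp: D'_def hg subset_iff)
  from Z consider "Z = Ax4" | "Z = Ax5" | "Z = AxCBF" | "Z = AxBF" by auto
  then show False
  proof cases
    case 1
    then obtain a b c where "a \<in> S" "b \<in> S" "c \<in> S" "(a, b) \<in> R" "(b, c) \<in> R" "(a, c) \<notin> R"
      using S(5) by (auto simp: bad_def)
    then have "(g a, g b) \<in> R'" "(g b, g c) \<in> R'" "(g a, g c) \<notin> R'" using R'g by blast+
    with Z' 1 show False by (auto dest: transD)
  next
    case 2
    then obtain a b c where "a \<in> S" "b \<in> S" "c \<in> S" "(a, b) \<in> R" "(a, c) \<in> R" "(b, c) \<notin> R"
      using S(5) by (auto simp: bad_def)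
    then have "(g a, g b) \<in> R'" "(g a, g c) \<in> R'" "(g b, g c) \<notin> R'" using R'g by blast+
    with Z'[unfolded 2 has_prop.simps] show False by blast
  next
    case 3
    then obtain a b where ab: "a \<in> S" "b \<in> S" "(a, b) \<in> R" "d \<in> D a" "d \<notin> D b"
      using S(5) by (auto simp: bad_def)
    then have "D' (g a) \<subseteq> D' (g b)" using Z' 3 R'g by simp
    with ab show False by (simp add: D'g)
  next
    case 4
    then obtain a b where ab: "a \<in> S" "b \<in> S" "(a, b) \<in> R" "d \<in> D b" "d \<notin> D a"
      using S(5) by (auto simp: bad_def)
    then have "D' (g b) \<subseteq> D' (g a)" using Z' 4 R'g by simp
    with ab show False by (simp add: D'g)
  qed
qed


section \<open>Nested sequents and contexts\<close>

text \<open>\<open>Seq X \<Gamma> \<Delta> C\<close> is the nested sequent with root \<open>X; \<Gamma> \<Rightarrow> \<Delta>\<close> and immediate subtrees \<open>C\<close>.\<close>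

datatype (sig_vars: 'v, fms: 'f) nested =
  Seq "'v multiset" "'f multiset" "'f multiset" "('v, 'f) nested multiset"

type_synonym nseq = "(var, fm) nested"

text \<open>Addition fuses two nested sequents at their roots.\<close>

instantiation nested :: (type, type) comm_monoid_add
begin

definition "0 = Seq {#} {#} {#} {#}"

fun plus_nested :: "('a, 'b) nested \<Rightarrow> ('a, 'b) nested \<Rightarrow> ('a, 'b) nested" where
  "Seq X \<Gamma> \<Delta> C + Seq Y \<Pi> \<Sigma> C' = Seq (X + Y) (\<Gamma> + \<Pi>) (\<Delta> + \<Sigma>) (C + C')"

instance
proof
  fix a b c :: "('a, 'b) nested"
  show "a + b + c = a + (b + c)" by (cases a; cases b; cases c) (simp add: add.assoc)
  show "a + b = b + a" by (cases a; cases b) (simp add: add.commute)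
  show "0 + a = a" by (cases a) (simp add: zero_nested_def)
qed

end

text \<open>A context is a nested sequent whose nodes also carry a multiset of labels of holes.
  Hole \<open>i\<close> is filled with the \<open>i\<close>th element of a list of nested sequents.\<close>

datatype ctx = Ctx "nat multiset" "var multiset" "fm multiset" "fm multiset" "ctx multiset"

primrec fill :: "nseq list \<Rightarrow> ctx \<Rightarrow> nseq" where
  "fill Ss (Ctx H X \<Gamma> \<Delta> C) = Seq X \<Gamma> \<Delta> (image_mset (fill Ss) C) + (\<Sum>i\<in>#H. Ss ! i)"

primrec holes :: "ctx \<Rightarrow> nat multiset" where
  "holes (Ctx H X \<Gamma> \<Delta> C) = H + \<Sum>\<^sub># (image_mset holes C)"

definition is_ctx :: "nat \<Rightarrow> ctx \<Rightarrow> bool" where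
  "is_ctx n c \<longleftrightarrow> holes c = mset [0..<n]"

text \<open>\<open>hole_depth c i d\<close>: hole \<open>i\<close> of \<open>c\<close> is located at a node at distance \<open>d\<close> from the root.\<close>

inductive hole_depth :: "ctx \<Rightarrow> nat \<Rightarrow> nat \<Rightarrow> bool" where
  "i \<in># H \<Longrightarrow> hole_depth (Ctx H X \<Gamma> \<Delta> C) i 0"
| "c \<in># C \<Longrightarrow> hole_depth c i d \<Longrightarrow> hole_depth (Ctx H X \<Gamma> \<Delta> C) i (Suc d)"

text \<open>Variables in signatures count as free.\<close>

definition fvs :: "nseq \<Rightarrow> var set" where
  "fvs S = sig_vars S \<union> (\<Union>A\<in>fms S. fv A)"

definition bvs :: "nseq \<Rightarrow> var set" where
  "bvs S = (\<Union>A\<in>fms S. bv A)"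

definition pure :: "nseq \<Rightarrow> bool" where
  "pure S \<longleftrightarrow> fvs S \<inter> bvs S = {}"

definition variant :: "nseq \<Rightarrow> nseq \<Rightarrow> bool" where
  "variant = rel_nested (=) alpha"


section \<open>The nested calculi\<close>

text \<open>\<open>rule L e Ps S\<close>: there is an inference of the calculus for \<open>L\<close> with premisses \<open>Ps\<close> and
  conclusion \<open>S\<close>; \<open>e\<close> is its eigenvariable, if it has one. In the rules that display a
  component in both premiss and conclusion, \<open>C\<close> consists of the further children of that
  component.\<close>

inductive rule :: "ax set \<Rightarrow> var option \<Rightarrow> nseq list \<Rightarrow> nseq \<Rightarrow> bool" for L where
  Init: "is_ctx 1 c \<Longrightarrow> atomic P \<Longrightarrow>
    rule L None [] (fill [Seq X (add_mset P \<Gamma>) (add_mset P \<Delta>) {#}] c)"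
| LBot: "is_ctx 1 c \<Longrightarrow>
    rule L None [] (fill [Seq X (add_mset Bot \<Gamma>) \<Delta> {#}] c)"
| LImp: "is_ctx 1 c \<Longrightarrow>
    rule L None
      [fill [Seq X \<Gamma> (add_mset A \<Delta>) {#}] c, fill [Seq X (add_mset B \<Gamma>) \<Delta> {#}] c]
      (fill [Seq X (add_mset (Imp A B) \<Gamma>) \<Delta> {#}] c)"
| RImp: "is_ctx 1 c \<Longrightarrow>
    rule L None
      [fill [Seq X (add_mset A \<Gamma>) (add_mset B \<Delta>) {#}] c]
      (fill [Seq X \<Gamma> (add_mset (Imp A B) \<Delta>) {#}] c)"
| LAll: "is_ctx 1 c \<Longrightarrow>
    rule L None
      [fill [Seq (add_mset z X) (add_mset (subst A z x) (add_mset (Forall x A) \<Gamma>)) \<Delta> {#}] c]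
      (fill [Seq (add_mset z X) (add_mset (Forall x A) \<Gamma>) \<Delta> {#}] c)"
| RAll: "is_ctx 1 c \<Longrightarrow>
    S = fill [Seq X \<Gamma> (add_mset (Forall x A) \<Delta>) {#}] c \<Longrightarrow>
    y \<notin> fvs S \<union> bvs S \<Longrightarrow>
    rule L (Some y) [fill [Seq (add_mset y X) \<Gamma> (add_mset (subst A y x) \<Delta>) {#}] c] S"
| LBox: "is_ctx 1 c \<Longrightarrow>
    rule L None
      [fill [Seq X (add_mset (Box A) \<Gamma>) \<Delta> {#Seq Y (add_mset A \<Pi>) \<Sigma> C#}] c]
      (fill [Seq X (add_mset (Box A) \<Gamma>) \<Delta> {#Seq Y \<Pi> \<Sigma> C#}] c)"
| RBox: "is_ctx 1 c \<Longrightarrow>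
    rule L None
      [fill [Seq X \<Gamma> \<Delta> {#Seq {#} {#} {#A#} {#}#}] c]
      (fill [Seq X \<Gamma> (add_mset (Box A) \<Delta>) {#}] c)"
| Ref: "is_ctx 1 c \<Longrightarrow>
    rule L None
      [fill [Seq X (add_mset (Eq x x) \<Gamma>) \<Delta> {#}] c]
      (fill [Seq X \<Gamma> \<Delta> {#}] c)"
| Repl: "is_ctx 1 c \<Longrightarrow> atomic P \<Longrightarrow>
    rule L None
      [fill [Seq X (add_mset (subst P y z) (add_mset (Eq x y) (add_mset (subst P x z) \<Gamma>))) \<Delta> {#}] c]
      (fill [Seq X (add_mset (Eq x y) (add_mset (subst P x z) \<Gamma>)) \<Delta> {#}] c)"
| ReplX: "is_ctx 1 c \<Longrightarrow>
    rule L None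
      [fill [Seq (add_mset x (add_mset y X)) (add_mset (Eq x y) \<Gamma>) \<Delta> {#}] c]
      (fill [Seq (add_mset x X) (add_mset (Eq x y) \<Gamma>) \<Delta> {#}] c)"
| Rig: "is_ctx 2 c \<Longrightarrow>
    rule L None
      [fill [Seq X (add_mset (Eq x y) \<Gamma>) \<Delta> {#}, Seq Y (add_mset (Eq x y) \<Pi>) \<Sigma> {#}] c]
      (fill [Seq X (add_mset (Eq x y) \<Gamma>) \<Delta> {#}, Seq Y \<Pi> \<Sigma> {#}] c)"
| RD: "AxD \<in> L \<Longrightarrow> is_ctx 1 c \<Longrightarrow>
    rule L None
      [fill [Seq X \<Gamma> \<Delta> {#Seq {#} {#} {#} {#}#}] c]
      (fill [Seq X \<Gamma> \<Delta> {#}] c)"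
| RT: "AxT \<in> L \<Longrightarrow> is_ctx 1 c \<Longrightarrow>
    rule L None
      [fill [Seq X (add_mset A (add_mset (Box A) \<Gamma>)) \<Delta> {#}] c]
      (fill [Seq X (add_mset (Box A) \<Gamma>) \<Delta> {#}] c)"
| RB: "AxB \<in> L \<Longrightarrow> is_ctx 1 c \<Longrightarrow>
    rule L None
      [fill [Seq X (add_mset A \<Gamma>) \<Delta> {#Seq Y (add_mset (Box A) \<Pi>) \<Sigma> C#}] c]
      (fill [Seq X \<Gamma> \<Delta> {#Seq Y (add_mset (Box A) \<Pi>) \<Sigma> C#}] c)"
| R4: "Ax4 \<in> L \<Longrightarrow> is_ctx 1 c \<Longrightarrow>
    rule L None
      [fill [Seq X (add_mset (Box A) \<Gamma>) \<Delta> {#Seq Y (add_mset (Box A) \<Pi>) \<Sigma> C#}] c]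
      (fill [Seq X (add_mset (Box A) \<Gamma>) \<Delta> {#Seq Y \<Pi> \<Sigma> C#}] c)"
| R5: "Ax5 \<in> L \<Longrightarrow> is_ctx 2 c \<Longrightarrow> hole_depth c 0 d \<Longrightarrow> d \<ge> 1 \<Longrightarrow>
    rule L None
      [fill [Seq X (add_mset (Box A) \<Gamma>) \<Delta> {#}, Seq Y (add_mset (Box A) \<Pi>) \<Sigma> {#}] c]
      (fill [Seq X (add_mset (Box A) \<Gamma>) \<Delta> {#}, Seq Y \<Pi> \<Sigma> {#}] c)"
| RCBF: "AxCBF \<in> L \<Longrightarrow> is_ctx 1 c \<Longrightarrow>
    rule L None
      [fill [Seq (add_mset x X) \<Gamma> \<Delta> {#Seq (add_mset x Y) \<Pi> \<Sigma> C#}] c]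
      (fill [Seq (add_mset x X) \<Gamma> \<Delta> {#Seq Y \<Pi> \<Sigma> C#}] c)"
| RBF: "AxBF \<in> L \<Longrightarrow> is_ctx 1 c \<Longrightarrow>
    rule L None
      [fill [Seq (add_mset x X) \<Gamma> \<Delta> {#Seq (add_mset x Y) \<Pi> \<Sigma> C#}] c]
      (fill [Seq X \<Gamma> \<Delta> {#Seq (add_mset x Y) \<Pi> \<Sigma> C#}] c)"
| RUI: "AxUI \<in> L \<Longrightarrow> is_ctx 1 c \<Longrightarrow>
    rule L None
      [fill [Seq (add_mset x X) \<Gamma> \<Delta> {#}] c]
      (fill [Seq X \<Gamma> \<Delta> {#}] c)"
| R5dom: "Ax5 \<in> L \<Longrightarrow> {AxCBF, AxBF} \<inter> L \<noteq> {} \<Longrightarrow> is_ctx 2 c \<Longrightarrow>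
    hole_depth c 0 d \<Longrightarrow> d \<ge> 1 \<Longrightarrow> hole_depth c 1 e \<Longrightarrow> e \<ge> 1 \<Longrightarrow>
    rule L None
      [fill [Seq (add_mset x X) \<Gamma> \<Delta> {#}, Seq (add_mset x Y) \<Pi> \<Sigma> {#}] c]
      (fill [Seq (add_mset x X) \<Gamma> \<Delta> {#}, Seq Y \<Pi> \<Sigma> {#}] c)"


section \<open>Derivations\<close>

text \<open>Each node of a derivation records its nested sequent and the eigenvariable, if any, of the
  inference of which it is the conclusion.\<close>

datatype deriv = Infer (concl: nseq) "var option" "deriv list"

fun correct :: "ax set \<Rightarrow> deriv \<Rightarrow> bool" where
  "correct L (Infer S e ds) \<longleftrightarrow> rule L e (map concl ds) S \<and> (\<forall>d\<in>set ds. correct L d)"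

primrec sequents :: "deriv \<Rightarrow> nseq set" where
  "sequents (Infer S e ds) = insert S (\<Union> (set (map sequents ds)))"

primrec eigenvars :: "deriv \<Rightarrow> var list" where
  "eigenvars (Infer S e ds) = (case e of None \<Rightarrow> [] | Some y \<Rightarrow> [y]) @ concat (map eigenvars ds)"

primrec height :: "deriv \<Rightarrow> nat" where
  "height (Infer S e ds) = Suc (Max (insert 0 (set (map height ds))))"

definition is_derivation :: "(nat \<Rightarrow> nat set) \<Rightarrow> ax set \<Rightarrow> deriv \<Rightarrow> nseq \<Rightarrow> bool" where
  "is_derivation Pr L d S \<longleftrightarrow>
    concl d = S \<and> correct L d \<and> distinct (eigenvars d) \<and>
    (\<forall>T\<in>sequents d. pure T \<and> (\<forall>A\<in>fms T. in_lang Pr A))"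

definition derivable_within :: "(nat \<Rightarrow> nat set) \<Rightarrow> ax set \<Rightarrow> nat \<Rightarrow> nseq \<Rightarrow> bool" where
  "derivable_within Pr L n S \<longleftrightarrow>
    (\<exists>S' d. (S' = S \<or> variant S S') \<and> is_derivation Pr L d S' \<and> height d \<le> n)"

text \<open>A rule is given by its instances, each relating a list of premisses to a conclusion.\<close>

definition hp_admissible ::
  "(nat \<Rightarrow> nat set) \<Rightarrow> ax set \<Rightarrow> (nseq list \<Rightarrow> nseq \<Rightarrow> bool) \<Rightarrow> bool" where
  "hp_admissible Pr L r \<longleftrightarrow>
    (\<forall>n Ps S. r Ps S \<longrightarrow> (\<forall>P\<in>set Ps. derivable_within Pr L n P) \<longrightarrow> derivable_within Pr L n S)"

inductive CL :: "nseq list \<Rightarrow> nseq \<Rightarrow> bool" where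
  "is_ctx 1 c \<Longrightarrow>
    CL [fill [Seq X (add_mset A (add_mset A \<Gamma>)) \<Delta> {#}] c] (fill [Seq X (add_mset A \<Gamma>) \<Delta> {#}] c)"

inductive CR :: "nseq list \<Rightarrow> nseq \<Rightarrow> bool" where
  "is_ctx 1 c \<Longrightarrow>
    CR [fill [Seq X \<Gamma> (add_mset A (add_mset A \<Delta>)) {#}] c] (fill [Seq X \<Gamma> (add_mset A \<Delta>) {#}] c)"

end

theory Submission
  imports Defs
begin

text \<open>
  Height-preserving contraction, merging of nodes, substitution of variables and invertibility of the
  rules are proved by one induction. Call a formula accounted for in a nested sequent if it occurs there
  or has already been decomposed there by its invertible rule; for instance, \<open>A \<supset> B\<close> is accounted for on
  the right of a node if \<open>A\<close> is on its left and \<open>B\<close> on its right. If \<open>T\<close> is derivable and maps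
  homomorphically into \<open>S\<close>, up to a renaming of free variables, so that all its formulas are accounted
  for, then \<open>S\<close> is derivable with the same height bound: for each last inference of \<open>T\<close>, either the
  principal formula occurs in \<open>S\<close> and the same rule applies to \<open>S\<close>, or a premiss already maps into \<open>S\<close>.
  The one exception is \<open>Repl\<close> when both principal formulas are mapped to one occurrence of \<open>x = y\<close>; then
  the new formula is \<open>x = y\<close> or \<open>y = y\<close>, and \<open>Ref\<close> does the work. Contraction is the case in which
  \<open>S\<close> is the contracted sequent and the homomorphism is the identity.

  To keep derivations pure, all formulas of the derivation of \<open>S\<close> get bound variables from a set of
  names reserved for them, and eigenvariables are chosen outside that set.
\<close>


section \<open>Canonical bound variables\<close>

text \<open>Contraction by itself does not go through by induction. If one of two copies of
  \<open>Box A\<close> on the right is principal, the premiss has a new child for it and still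
  contains the other copy. Inverting that copy yields a second child, and the two children must be
  merged, which calls for contraction inside them. For \<open>Forall x A\<close> on the right,
  inversion yields two signature variables that have to be identified by a substitution.
  Homomorphisms that need not be injective on nodes, variables or formula occurrences cover all of
  these at once. Heights do not grow, because each inference of the given derivation is traded for
  at most one inference below the new premisses. Reserved binder names are available because
  derivability is defined up to alphabetical variants: it is enough to derive the canonical variant
  of the contracted sequent.\<close>

primrec qdepth :: "fm \<Rightarrow> nat" where
  "qdepth (Rel i xs) = 0"
| "qdepth (Eq x y) = 0"
| "qdepth Bot = 0"
| "qdepth (Imp A B) = max (qdepth A) (qdepth B)"
| "qdepth (Forall x A) = Suc (qdepth A)"
| "qdepth (Box A) = qdepth A"

text \<open>\<open>canon b s A\<close> applies \<open>s\<close> to the free variables and names each binder \<open>b h\<close>, where \<open>h\<close> is the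
  quantifier depth of its scope. The name survives instantiation of the scope and differs from all
  binders inside it; so, for \<open>s\<close> avoiding the range of \<open>b\<close>, \<open>canon\<close> commutes with \<open>subst\<close> exactly and not
  only up to renaming.\<close>

primrec canon :: "(nat \<Rightarrow> var) \<Rightarrow> (var \<Rightarrow> var) \<Rightarrow> fm \<Rightarrow> fm" where
  "canon b s (Rel i xs) = Rel i (map s xs)"
| "canon b s (Eq x y) = Eq (s x) (s y)"
| "canon b s Bot = Bot"
| "canon b s (Imp A B) = Imp (canon b s A) (canon b s B)"
| "canon b s (Forall x A) = Forall (b (qdepth A)) (canon b (s(x := b (qdepth A))) A)"
| "canon b s (Box A) = Box (canon b s A)"

lemma finite_fv: "finite (fv A)"
  by (induction A) auto

lemma finite_bv: "finite (bv A)"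
  by (induction A) auto

lemma qdepth_ren [simp]: "qdepth (ren s A) = qdepth A"
  by (induction A arbitrary: s) (auto simp: Let_def)

lemma qdepth_subst [simp]: "qdepth (subst A y x) = qdepth A"
  by (simp add: subst_def)

lemma size_ren [simp]: "size (ren s A) = size A"
  by (induction A arbitrary: s) (auto simp: Let_def)

lemma size_subst [simp]: "size (subst A y x) = size A"
  by (simp add: subst_def)

lemma canon_cong: "(\<And>v. v \<in> fv A \<Longrightarrow> s v = s' v) \<Longrightarrow> canon b s A = canon b s' A"
proof (induction A arbitrary: s s')
  case (Forall x A)
  show ?case using Forall.prems by (auto intro!: Forall.IH)
next
  case (Imp A B)
  have "canon b s A = canon b s' A" "canon b s B = canon b s' B"
    by (rule Imp.IH; simp add: Imp.prems)+
  then show ?case by simp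
next
  case (Box A)
  have "canon b s A = canon b s' A" by (rule Box.IH) (simp add: Box.prems)
  then show ?case by simp
qed auto

lemma fresh_least:
  assumes "finite V" shows "(LEAST v::var. v \<notin> V) \<notin> V"
proof -
  from assms obtain v where "v \<notin> V" using ex_new_if_finite[OF infinite_UNIV_nat] by blast
  then show ?thesis by (rule LeastI)
qed

lemma fv_ren: "fv (ren s A) = s ` fv A"
proof (induction A arbitrary: s)
  case (Forall x A)
  define V where "V = s ` (fv A - {x})"
  define x' where "x' = (if x \<in> V then LEAST v. v \<notin> V else x)"
  have x': "x' \<notin> V" using fresh_least[of V] finite_fv[of A] by (auto simp: x'_def V_def)
  have "fv (ren s (Forall x A)) = (s(x := x')) ` fv A - {x'}"
    using Forall.IH by (simp add: Let_def V_def x'_def)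
  also have "\<dots> = V" using x' by (auto simp: V_def)
  finally show ?case by (simp add: V_def)
qed auto

text \<open>Whatever name \<open>ren\<close> chooses for a binder is overwritten by
  \<open>canon\<close>. All that matters is that the chosen \<open>x'\<close> lies outside the image
  of the other free variables.\<close>

lemma canon_ren: "canon b s (ren r A) = canon b (s \<circ> r) A"
proof (induction A arbitrary: s r)
  case (Forall x A)
  define V where "V = r ` (fv A - {x})"
  define x' where "x' = (if x \<in> V then LEAST v. v \<notin> V else x)"
  have x': "x' \<notin> V" using fresh_least[of V] finite_fv[of A] by (auto simp: x'_def V_def)
  have "canon b s (ren r (Forall x A)) =
      Forall (b (qdepth A)) (canon b (s(x' := b (qdepth A))) (ren (r(x := x')) A))"
    by (simp add: Let_def V_def x'_def)
  also have "\<dots> = Forall (b (qdepth A)) (canon b (s(x' := b (qdepth A)) \<circ> r(x := x')) A)"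
    by (simp only: Forall.IH)
  also have "\<dots> = canon b (s \<circ> r) (Forall x A)"
    unfolding canon.simps
    by (rule arg_cong[where f = "Forall (b (qdepth A))"], rule canon_cong) (use x' in \<open>auto simp: V_def\<close>)
  finally show ?case .
qed auto

lemma canon_subst: "canon b s (subst A y x) = canon b (s(x := s y)) A"
  unfolding subst_def canon_ren by (rule canon_cong) simp

text \<open>Only an inclusion, since an arbitrary \<open>s\<close> may send a free variable to a
  binder name, where it is captured.\<close>

lemma fv_canon: "fv (canon b s A) \<subseteq> s ` fv A"
proof (induction A arbitrary: s)
  case (Forall x A)
  have "fv (canon b s (Forall x A)) \<subseteq> (s(x := b (qdepth A))) ` fv A - {b (qdepth A)}"
    using Forall.IH[of "s(x := b (qdepth A))"] by (auto simp del: fun_upd_apply)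
  also have "\<dots> \<subseteq> s ` (fv A - {x})" by auto
  finally show ?case by simp
next
  case (Imp A B)
  then show ?case by (simp add: image_Un le_supI1 le_supI2)
qed auto

lemma bv_canon: "bv (canon b s A) \<subseteq> range b"
  by (induction A arbitrary: s) auto

lemma in_lang_canon [simp]: "in_lang Pr (canon b s A) \<longleftrightarrow> in_lang Pr A"
  by (induction A arbitrary: s) auto

lemma in_lang_ren [simp]: "in_lang Pr (ren s A) \<longleftrightarrow> in_lang Pr A"
  by (induction A arbitrary: s) (auto simp: Let_def)

lemma in_lang_subst [simp]: "in_lang Pr (subst A y x) \<longleftrightarrow> in_lang Pr A"
  by (simp add: subst_def)

lemma atomic_canon [simp]: "atomic (canon b s A) \<longleftrightarrow> atomic A"
  by (cases A) auto

lemma alpha_qdepth: "alpha A A' \<Longrightarrow> qdepth A = qdepth A'"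
  by (induction rule: alpha.induct) auto

lemma alpha_in_lang: "alpha A A' \<Longrightarrow> in_lang Pr A \<longleftrightarrow> in_lang Pr A'"
  by (induction rule: alpha.induct) auto

lemma alpha_canon: "alpha A A' \<Longrightarrow> canon b s A = canon b s A'"
proof (induction arbitrary: s rule: alpha.induct)
  case (5 z x x' A A')
  have q: "qdepth A = qdepth A'" using alpha_qdepth[OF 5(2)] by simp
  \<comment> \<open>The name that \<open>canon\<close> gives to both binders. Sending the witness
    \<open>z\<close> of \<open>alpha\<close> to it turns the two instances into the two canonical
    scopes.\<close>
  define u where "u = b (qdepth A)"
  from 5(3)[of "s(z := u)"] have "canon b (s(z := u, x := u)) A = canon b (s(z := u, x' := u)) A'"
    by (simp add: canon_subst del: fun_upd_apply) (simp only: fun_upd_same)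
  moreover have "canon b (s(z := u, x := u)) A = canon b (s(x := u)) A"
    using 5(1) by (intro canon_cong) auto
  moreover have "canon b (s(z := u, x' := u)) A' = canon b (s(x' := u)) A'"
    using 5(1) by (intro canon_cong) auto
  ultimately show ?case using q by (simp add: u_def)
qed auto

text \<open>Here the renaming acts after \<open>canon\<close>, so it must neither be captured nor
  make \<open>ren\<close> rename a binder; hence binder names are avoided both before and after
  \<open>r\<close>. The bound \<open>h < qdepth A\<close> is strict because
  \<open>b (qdepth A)\<close>, the name of a quantifier with scope \<open>A\<close>, is free in that
  scope and has to remain substitutable.\<close>

lemma ren_canon:
  assumes "inj b"
    and "\<And>v h. v \<in> fv A \<Longrightarrow> h < qdepth A \<Longrightarrow> s v \<noteq> b h \<and> r (s v) \<noteq> b h"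
  shows "ren r (canon b s A) = canon b (r \<circ> s) A"
  using assms(2)
proof (induction A arbitrary: s r)
  case (Imp A B)
  then show ?case by simp
next
  case (Forall x A)
  define y where "y = b (qdepth A)"
  have sv: "s v \<noteq> b h \<and> r (s v) \<noteq> b h" if "v \<in> fv A" "v \<noteq> x" "h < Suc (qdepth A)" for v h
    using Forall.prems[of v h] that by auto
  have fv: "fv (canon b (s(x := y)) A) - {y} \<subseteq> s ` (fv A - {x})"
    using fv_canon[of b "s(x := y)" A] by auto
  have "y \<notin> r ` (fv (canon b (s(x := y)) A) - {y})"
  proof
    assume "y \<in> r ` (fv (canon b (s(x := y)) A) - {y})"
    then obtain v where "v \<in> fv A" "v \<noteq> x" "y = r (s v)" using fv by blast
    then show False using sv[of v "qdepth A"] by (simp add: y_def)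
  qed
  then have "ren r (canon b s (Forall x A)) = Forall y (ren (r(y := y)) (canon b (s(x := y)) A))"
    by (simp add: Let_def y_def[symmetric])
  also have "ren (r(y := y)) (canon b (s(x := y)) A) = canon b (r(y := y) \<circ> s(x := y)) A"
  proof (rule Forall.IH)
    fix v h assume v: "v \<in> fv A" and h: "h < qdepth A"
    have "y \<noteq> b h" using h assms(1) by (auto simp: y_def inj_eq)
    moreover have "s v \<noteq> b h \<and> r (s v) \<noteq> b h" if "v \<noteq> x" using sv[OF v that, of h] h by auto
    ultimately show "(s(x := y)) v \<noteq> b h \<and> (r(y := y)) ((s(x := y)) v) \<noteq> b h"
      by (auto)
  qed
  also have "\<dots> = canon b ((r \<circ> s)(x := y)) A"
    using sv[where h = "qdepth A"] by (intro canon_cong) (auto simp: y_def)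
  finally show ?case by (simp only: canon.simps y_def)
qed simp_all


section \<open>Labelled trees and contexts\<close>

text \<open>The children of a node of a nested sequent form a multiset, so equal children cannot be told
  apart. A \<open>shape\<close> gives the nodes labels, and the sequent at a node is a function of its label.\<close>

datatype shape = Sh nat "shape multiset"

primrec root :: "shape \<Rightarrow> nat" where
  "root (Sh i ss) = i"

primrec labels :: "shape \<Rightarrow> nat multiset" where
  "labels (Sh i ss) = add_mset i (\<Sum>\<^sub># (image_mset labels ss))"

primrec edges :: "shape \<Rightarrow> (nat \<times> nat) set" where
  "edges (Sh i ss) = Pair i ` root ` set_mset ss \<union> \<Union> (set_mset (image_mset edges ss))"

text \<open>Reading \<open>RBox\<close> or \<open>RD\<close> from conclusion to premiss changes the
  tree in this way; the other rules keep the tree and change only contents.\<close>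

primrec grow :: "nat \<Rightarrow> nat \<Rightarrow> shape \<Rightarrow> shape" where
  "grow w n (Sh i ss) = Sh i ((if i = w then {#Sh n {#}#} else {#}) + image_mset (grow w n) ss)"

text \<open>Separating contents from the tree turns an inference at a node into a function update at
  its label.\<close>

primrec den :: "(nat \<Rightarrow> 'v multiset) \<Rightarrow> (nat \<Rightarrow> 'f multiset) \<Rightarrow> (nat \<Rightarrow> 'f multiset) \<Rightarrow>
    shape \<Rightarrow> ('v, 'f) nested" where
  "den X G D (Sh i ss) = Seq (X i) (G i) (D i) (image_mset (den X G D) ss)"

definition separate :: "shape \<Rightarrow> bool" where
  "separate t \<longleftrightarrow> (\<forall>i. count (labels t) i \<le> 1)"

lemma root_in_labels [simp]: "root t \<in># labels t"
  by (cases t) simp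

lemma edges_labels: "(w, v) \<in> edges t \<Longrightarrow> w \<in># labels t \<and> v \<in># labels t"
  by (induction t) (fastforce simp: image_iff)

lemma root_grow [simp]: "root (grow w n t) = root t"
  by (cases t) simp

lemma labels_grow: "labels (grow w n t) = labels t + replicate_mset (count (labels t) w) n"
proof (induction t)
  case (Sh i ss)
  have "\<Sum>\<^sub># (image_mset labels (image_mset (grow w n) ss)) =
      \<Sum>\<^sub># (image_mset labels ss) + replicate_mset (count (\<Sum>\<^sub># (image_mset labels ss)) w) n"
    using Sh
  proof (induction ss)
    case (add s ss)
    then show ?case by (auto intro!: multiset_eqI)
  qed simp
  then show ?case by simp
qed

lemma edges_grow:
  "edges (grow w n t) = edges t \<union> (if w \<in># labels t then {(w, n)} else {})"
proof (induction t)
  case (Sh i ss)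
  have "\<Union> (edges ` grow w n ` set_mset ss) =
      (\<Union>s\<in>set_mset ss. edges s \<union> (if w \<in># labels s then {(w, n)} else {}))"
    unfolding image_image by (rule SUP_cong) (simp_all add: Sh)
  also have "\<dots> = \<Union> (edges ` set_mset ss) \<union>
      (if \<exists>s\<in>#ss. w \<in># labels s then {(w, n)} else {})"
    by (auto split: if_splits)
  finally show ?case by (auto simp: image_image)
qed

lemma grow_fresh: "w \<notin># labels t \<Longrightarrow> grow w n t = t"
proof (induction t)
  case (Sh i ss)
  then have "image_mset (grow w n) ss = image_mset id ss" by (intro image_mset_cong) auto
  then show ?case using Sh.prems by simp
qed

lemma den_cong:
  assumes "\<And>i. i \<in># labels t \<Longrightarrow> X i = X' i \<and> G i = G' i \<and> D i = D' i"
  shows "den X G D t = den X' G' D' t"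
  using assms
proof (induction t)
  case (Sh i ss)
  then have "image_mset (den X G D) ss = image_mset (den X' G' D') ss"
    by (intro image_mset_cong) auto
  then show ?case using Sh.prems by simp
qed

lemma separate_child:
  assumes "separate (Sh i (add_mset s ss))"
  shows "separate s" "separate (Sh i ss)" "i \<notin># labels s"
    "\<And>j s'. j \<in># labels s \<Longrightarrow> s' \<in># ss \<Longrightarrow> j \<notin># labels s'"
proof -
  have le: "count (labels s) j + count (labels (Sh i ss)) j \<le> 1" for j
    using assms unfolding separate_def by (metis (no_types, lifting) labels.simps add_mset_commute
        image_mset_add_mset sum_mset.add_mset union_mset_add_mset_right count_union)
  show "separate s" "separate (Sh i ss)"
    unfolding separate_def using le by (meson add_leD1 add_leD2)+
  show "i \<notin># labels s" using le[of i] by (auto simp: count_eq_zero_iff[symmetric] simp del: count_eq_zero_iff)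
  fix j s' assume "j \<in># labels s" "s' \<in># ss"
  then have "count (labels s) j > 0" by simp
  with le[of j] have "count (labels (Sh i ss)) j = 0" by linarith
  then have "j \<notin># labels (Sh i ss)" by (simp only: not_in_iff)
  then show "j \<notin># labels s'" using \<open>s' \<in># ss\<close> by auto
qed

section \<open>Contexts with a hole at a given node or above a given edge\<close>

primrec konst :: "nseq \<Rightarrow> ctx" where
  "konst (Seq X G D C) = Ctx {#} X G D (image_mset konst C)"

lemma add_zero_nested: "S + Seq {#} {#} {#} {#} = S"
  by (metis add.right_neutral zero_nested_def)

lemma fill_konst: "fill Ss (konst N) = N"
proof (induction N)
  case (Seq X G D C)
  then have "image_mset (fill Ss \<circ> konst) C = image_mset id C" by (intro image_mset_cong) auto
  then show ?case by (simp add: multiset.map_comp)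
qed

lemma holes_konst: "holes (konst N) = {#}"
proof (induction N)
  case (Seq X G D C)
  then have "image_mset (holes \<circ> konst) C = image_mset (\<lambda>_. {#}) C" by (intro image_mset_cong) auto
  then show ?case by (simp add: multiset.map_comp)
qed

lemma is_ctx_1: "is_ctx (Suc 0) c \<longleftrightarrow> holes c = {#0#}"
  by (simp add: is_ctx_def)

lemma is_ctx_2: "is_ctx 2 c \<longleftrightarrow> holes c = {#0, 1#}"
proof -
  have "[0..<2] = [0, 1]" by (simp add: numeral_2_eq_2)
  then show ?thesis by (simp add: is_ctx_def)
qed

text \<open>The hole takes the whole content of \<open>w\<close>, so that principal and side
  formulas can be displayed at will. The same context serves both equations; the one with a new leaf
  \<open>n\<close> describes premisses of the rules that create a component.\<close>

lemma node_ctx: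
  assumes "separate t" "w \<in># labels t"
  obtains c where "is_ctx 1 c"
    "\<And>x g d. fill [Seq x g d {#}] c = den (X(w := x)) (G(w := g)) (D(w := d)) t"
    "\<And>x g d n x' g' d'. n \<notin># labels t \<Longrightarrow> fill [Seq x g d {#Seq x' g' d' {#}#}] c =
      den (X(w := x, n := x')) (G(w := g, n := g')) (D(w := d, n := d')) (grow w n t)"
proof -
  have "\<exists>c. is_ctx 1 c \<and>
    (\<forall>x g d. fill [Seq x g d {#}] c = den (X(w := x)) (G(w := g)) (D(w := d)) t) \<and>
    (\<forall>x g d n x' g' d'. n \<notin># labels t \<longrightarrow> fill [Seq x g d {#Seq x' g' d' {#}#}] c =
      den (X(w := x, n := x')) (G(w := g, n := g')) (D(w := d, n := d')) (grow w n t))"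
    using assms
  proof (induction t)
    case (Sh i ss)
    show ?case
    proof (cases "i = w")
      case True
      have w: "w \<notin># labels s" if "s \<in># ss" for s
        using separate_child(3)[of i s "ss - {#s#}"] Sh.prems(1) that True by simp
      let ?c = "Ctx {#0#} {#} {#} {#} (image_mset (\<lambda>s. konst (den X G D s)) ss)"
      have eq: "image_mset (den X G D) ss =
          image_mset (den (X(w := x)) (G(w := g)) (D(w := d))) ss" for x g d
        by (intro image_mset_cong den_cong) (use w in auto)
      have eq': "image_mset (den X G D) ss =
          image_mset (den (X(w := x, n := x')) (G(w := g, n := g')) (D(w := d, n := d')))
            (image_mset (grow w n) ss)"
        if n: "n \<notin># labels (Sh i ss)" for x g d x' g' d' n
        unfolding multiset.map_comp
        by (intro image_mset_cong)
           (use w n in \<open>auto simp: grow_fresh intro!: den_cong\<close>)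
      have "holes ?c = {#0#}"
        by (simp add: multiset.map_comp comp_def holes_konst)
      moreover have "fill [Seq x g d {#}] ?c = den (X(w := x)) (G(w := g)) (D(w := d)) (Sh i ss)"
        for x g d
        using True by (simp add: eq[of x g d, symmetric] multiset.map_comp comp_def fill_konst)
      moreover have "fill [Seq x g d {#Seq x' g' d' {#}#}] ?c =
          den (X(w := x, n := x')) (G(w := g, n := g')) (D(w := d, n := d')) (grow w n (Sh i ss))"
        if "n \<notin># labels (Sh i ss)" for x g d n x' g' d'
        using True that eq'[OF that, of x x' g g' d d']
        by (simp add: multiset.map_comp comp_def fill_konst)
      ultimately show ?thesis by (intro exI[of _ ?c] conjI allI impI) (simp_all only: is_ctx_1 One_nat_def)
    next
      case False
      then obtain s where s: "s \<in># ss" "w \<in># labels s" using Sh.prems(2) by auto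
      then obtain ss' where ss: "ss = add_mset s ss'" by (meson multi_member_split)
      note sep = separate_child[OF Sh.prems(1)[unfolded ss]]
      obtain c where c: "is_ctx 1 c"
        "\<And>x g d. fill [Seq x g d {#}] c = den (X(w := x)) (G(w := g)) (D(w := d)) s"
        "\<And>x g d n x' g' d'. n \<notin># labels s \<Longrightarrow> fill [Seq x g d {#Seq x' g' d' {#}#}] c =
          den (X(w := x, n := x')) (G(w := g, n := g')) (D(w := d, n := d')) (grow w n s)"
        using Sh.IH[OF s(1) sep(1) s(2)] by blast
      let ?c = "Ctx {#} (X i) (G i) (D i) (add_mset c (image_mset (\<lambda>s. konst (den X G D s)) ss'))"
      have eq: "image_mset (den X G D) ss' =
          image_mset (den (X(w := x)) (G(w := g)) (D(w := d))) ss'" for x g d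
        by (intro image_mset_cong den_cong) (use sep(4)[OF s(2)] in auto)
      have eq': "image_mset (den X G D) ss' =
          image_mset (den (X(w := x, n := x')) (G(w := g, n := g')) (D(w := d, n := d')))
            (image_mset (grow w n) ss')"
        if n: "n \<notin># labels (Sh i ss)" for x g d x' g' d' n
        unfolding multiset.map_comp
        by (intro image_mset_cong)
           (use sep(4)[OF s(2)] n ss in \<open>auto simp: grow_fresh intro!: den_cong\<close>)
      have "holes ?c = {#0#}"
        using c(1) by (simp add: multiset.map_comp comp_def holes_konst is_ctx_1)
      moreover have "fill [Seq x g d {#}] ?c = den (X(w := x)) (G(w := g)) (D(w := d)) (Sh i ss)"
        for x g d
        using False by (simp add: ss c(2) eq[of x g d, symmetric] multiset.map_comp comp_def fill_konst)
      moreover have "fill [Seq x g d {#Seq x' g' d' {#}#}] ?c =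
          den (X(w := x, n := x')) (G(w := g, n := g')) (D(w := d, n := d')) (grow w n (Sh i ss))"
        if "n \<notin># labels (Sh i ss)" for x g d n x' g' d'
        using False that c(3)[of n x g d x' g' d'] eq'[OF that, of x x' g g' d d']
        by (simp add: ss  multiset.map_comp comp_def fill_konst)
      ultimately show ?thesis by (intro exI[of _ ?c] conjI allI impI) (simp_all only: is_ctx_1 One_nat_def)
    qed
  qed
  then show ?thesis using that by blast
qed

text \<open>The further children \<open>C\<close> of \<open>v\<close> belong to the plugged sequent
  and not to the context, as in the rules that display a component. They are the same for all
  contents given to \<open>w\<close> and \<open>v\<close>.\<close>

lemma edge_ctx:
  assumes "separate t" "(w, v) \<in> edges t"
  obtains c C where "is_ctx 1 c"
    "\<And>x g d x' g' d'. fill [Seq x g d {#Seq x' g' d' C#}] c =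
      den (X(w := x, v := x')) (G(w := g, v := g')) (D(w := d, v := d')) t"
proof -
  have "\<exists>c C. is_ctx 1 c \<and> (\<forall>x g d x' g' d'. fill [Seq x g d {#Seq x' g' d' C#}] c =
      den (X(w := x, v := x')) (G(w := g, v := g')) (D(w := d, v := d')) t)"
    using assms
  proof (induction t)
    case (Sh i ss)
    show ?case
    proof (cases "\<exists>s\<in>#ss. (w, v) \<in> edges s")
      case True
      then obtain s where s: "s \<in># ss" "(w, v) \<in> edges s" by blast
      then have ls: "w \<in># labels s" "v \<in># labels s" using edges_labels by auto
      obtain ss' where ss: "ss = add_mset s ss'" using s(1) by (meson multi_member_split)
      note sep = separate_child[OF Sh.prems(1)[unfolded ss]]
      obtain c C where c: "is_ctx 1 c"
        "\<And>x g d x' g' d'. fill [Seq x g d {#Seq x' g' d' C#}] c =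
          den (X(w := x, v := x')) (G(w := g, v := g')) (D(w := d, v := d')) s"
        using Sh.IH[OF s(1) sep(1) s(2)] by blast
      let ?c = "Ctx {#} (X i) (G i) (D i) (add_mset c (image_mset (\<lambda>s. konst (den X G D s)) ss'))"
      have eq: "image_mset (den X G D) ss' =
          image_mset (den (X(w := x, v := x')) (G(w := g, v := g')) (D(w := d, v := d'))) ss'"
        for x g d x' g' d'
        by (intro image_mset_cong den_cong) (use sep(4)[OF ls(1)] sep(4)[OF ls(2)] in auto)
      have "holes ?c = {#0#}"
        using c(1) by (simp add: multiset.map_comp comp_def holes_konst is_ctx_1)
      moreover have "i \<noteq> w" "i \<noteq> v" using sep(3) ls by auto
      then have "fill [Seq x g d {#Seq x' g' d' C#}] ?c =
          den (X(w := x, v := x')) (G(w := g, v := g')) (D(w := d, v := d')) (Sh i ss)"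
        for x g d x' g' d'
        by (simp add: ss c(2) eq[of x x' g g' d d', symmetric] multiset.map_comp comp_def fill_konst)
      ultimately show ?thesis
        by (intro exI[of _ ?c] exI[of _ C] conjI allI impI) (simp_all only: is_ctx_1 One_nat_def)
    next
      case False
      then obtain s where s: "s \<in># ss" "w = i" "v = root s" using Sh.prems(2) by auto
      obtain ss' where ss: "ss = add_mset s ss'" using s(1) by (meson multi_member_split)
      note sep = separate_child[OF Sh.prems(1)[unfolded ss]]
      obtain us where us: "s = Sh v us" using s(3) by (cases s) auto
      have wss: "w \<notin># labels s'" if "s' \<in># ss" for s'
        using separate_child(3)[of i s' "ss - {#s'#}"] Sh.prems(1) that s(2) by simp
      then have w: "w \<noteq> v" "\<And>s'. s' \<in># ss' \<Longrightarrow> w \<notin># labels s'" "\<And>u. u \<in># us \<Longrightarrow> w \<notin># labels u"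
        using wss[OF s(1)] wss ss us by auto
      have v: "v \<notin># labels u" if "u \<in># us" for u
        using separate_child(3)[of v u "us - {#u#}"] sep(1) that us by simp
      have v': "v \<notin># labels s'" if "s' \<in># ss'" for s'
        using sep(4)[of v s'] that us by simp
      let ?c = "Ctx {#0#} {#} {#} {#} (image_mset (\<lambda>s. konst (den X G D s)) ss')"
      let ?C = "image_mset (den X G D) us"
      have eq: "image_mset (den X G D) ss' =
          image_mset (den (X(w := x, v := x')) (G(w := g, v := g')) (D(w := d, v := d'))) ss'"
        for x g d x' g' d'
        by (intro image_mset_cong den_cong) (use w v' in auto)
      have eq': "image_mset (den X G D) us =
          image_mset (den (X(w := x, v := x')) (G(w := g, v := g')) (D(w := d, v := d'))) us"
        for x g d x' g' d'
        by (intro image_mset_cong den_cong) (use w v in auto)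
      have "holes ?c = {#0#}"
        by (simp add: multiset.map_comp comp_def holes_konst)
      moreover have "fill [Seq x g d {#Seq x' g' d' ?C#}] ?c =
          den (X(w := x, v := x')) (G(w := g, v := g')) (D(w := d, v := d')) (Sh i ss)"
        for x g d x' g' d'
        using w(1) s(2) eq[of x x' g g' d d'] eq'[of x x' g g' d d']
        by (simp add: ss us multiset.map_comp comp_def fill_konst)
      ultimately show ?thesis
        by (intro exI[of _ ?c] exI[of _ ?C] conjI allI impI) (simp_all only: is_ctx_1 One_nat_def)
    qed
  qed
  then show ?thesis using that by blast
qed

section \<open>Contexts with two holes in arbitrary relative position\<close>

primrec mark :: "(nat \<Rightarrow> nat multiset) \<Rightarrow> (nat \<Rightarrow> var multiset) \<Rightarrow> (nat \<Rightarrow> fm multiset) \<Rightarrow>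
    (nat \<Rightarrow> fm multiset) \<Rightarrow> shape \<Rightarrow> ctx" where
  "mark H X G D (Sh i ss) = Ctx (H i) (X i) (G i) (D i) (image_mset (mark H X G D) ss)"

lemma holes_mark: "holes (mark H X G D t) = \<Sum>\<^sub># (image_mset H (labels t))"
proof (induction t)
  case (Sh i ss)
  have "\<Sum>\<^sub># (image_mset holes (image_mset (mark H X G D) ss)) =
      \<Sum>\<^sub># (image_mset H (\<Sum>\<^sub># (image_mset labels ss)))"
    using Sh by (induction ss) auto
  then show ?case by simp
qed

lemma hole_depth_mark:
  "k \<in># H j \<Longrightarrow> j \<in># labels t \<Longrightarrow> \<exists>d. hole_depth (mark H X G D t) k d"
proof (induction t)
  case (Sh i ss)
  show ?case
  proof (cases "i = j")
    case True
    then show ?thesis using Sh.prems by (auto intro: hole_depth.intros(1))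
  next
    case False
    then obtain s where s: "s \<in># ss" "j \<in># labels s" using Sh.prems by auto
    then obtain d where "hole_depth (mark H X G D s) k d" using Sh.IH Sh.prems(1) by blast
    then have "hole_depth (mark H X G D (Sh i ss)) k (Suc d)"
      using s by (auto intro!: hole_depth.intros(2)[of "mark H X G D s"])
    then show ?thesis by blast
  qed
qed

text \<open>On labelled trees, an incoming edge expresses depth at least 1, the side condition of
  \<open>R5\<close> and \<open>R5dom\<close>.\<close>

lemma hole_depth_mark_edge:
  "k \<in># H j \<Longrightarrow> (u, j) \<in> edges t \<Longrightarrow> \<exists>d\<ge>1. hole_depth (mark H X G D t) k d"
proof (induction t)
  case (Sh i ss)
  then obtain s where s: "s \<in># ss" "j \<in># labels s" by (auto dest: edges_labels)
  then obtain d where "hole_depth (mark H X G D s) k d"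
    using hole_depth_mark[of k H j s] Sh.prems(1) by blast
  then have "hole_depth (mark H X G D (Sh i ss)) k (Suc d)"
    using s by (auto intro!: hole_depth.intros(2)[of "mark H X G D s"])
  then show ?case by (intro exI[of _ "Suc d"]) simp
qed

text \<open>The plugged contents are added to those of the nodes instead of replacing them; this
  admits \<open>w = v\<close>, with both holes at one node.\<close>

lemma two_node_ctx:
  assumes sep: "separate t" and "w \<in># labels t" "v \<in># labels t"
  obtains c where "is_ctx 2 c"
    "\<And>x g d x' g' d'. fill [Seq x g d {#}, Seq x' g' d' {#}] c =
      den (\<lambda>i. X i + (if i = w then x else {#}) + (if i = v then x' else {#}))
        (\<lambda>i. G i + (if i = w then g else {#}) + (if i = v then g' else {#}))
        (\<lambda>i. D i + (if i = w then d else {#}) + (if i = v then d' else {#})) t"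
    "\<And>u. (u, w) \<in> edges t \<Longrightarrow> \<exists>e\<ge>1. hole_depth c 0 e"
    "\<And>u. (u, v) \<in> edges t \<Longrightarrow> \<exists>e\<ge>1. hole_depth c 1 e"
proof
  define H where "H i = (if i = w then {#0#} else {#}) + (if i = v then {#1#} else {#} :: nat multiset)" for i :: nat
  let ?c = "mark H X G D t"
  have sum: "(\<Sum>i\<in>#M. if i = u then {#k#} else {#}) = replicate_mset (count M u) k"
    for M and u k :: nat by (induction M) auto
  have one: "count (labels t) w = 1" "count (labels t) v = 1"
    using assms by (simp_all add: separate_def order_antisym Suc_leI)
  have "holes ?c = {#0, 1#}"
    unfolding holes_mark H_def by (simp add: sum_mset.distrib sum one)
  then show "is_ctx 2 ?c" by (simp add: is_ctx_2)
  show "fill [Seq x g d {#}, Seq x' g' d' {#}] ?c =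
      den (\<lambda>i. X i + (if i = w then x else {#}) + (if i = v then x' else {#}))
        (\<lambda>i. G i + (if i = w then g else {#}) + (if i = v then g' else {#}))
        (\<lambda>i. D i + (if i = w then d else {#}) + (if i = v then d' else {#})) t"
    for x g d x' g' d'
  proof (induction t)
    case (Sh i ss)
    then have "image_mset (fill [Seq x g d {#}, Seq x' g' d' {#}] \<circ> mark H X G D) ss =
      image_mset (den (\<lambda>i. X i + (if i = w then x else {#}) + (if i = v then x' else {#}))
        (\<lambda>i. G i + (if i = w then g else {#}) + (if i = v then g' else {#}))
        (\<lambda>i. D i + (if i = w then d else {#}) + (if i = v then d' else {#}))) ss"
      by (intro image_mset_cong) auto
    moreover have "(\<Sum>k\<in>#H i. [Seq x g d {#}, Seq x' g' d' {#}] ! k) =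
        Seq ((if i = w then x else {#}) + (if i = v then x' else {#}))
          ((if i = w then g else {#}) + (if i = v then g' else {#}))
          ((if i = w then d else {#}) + (if i = v then d' else {#})) {#}"
      by (auto simp: H_def zero_nested_def add_zero_nested)
    ultimately show ?case by (simp add: multiset.map_comp add.assoc)
  qed
  show "\<exists>e\<ge>1. hole_depth ?c 0 e" if "(u, w) \<in> edges t" for u
    by (rule hole_depth_mark_edge[OF _ that]) (simp add: H_def)
  show "\<exists>e\<ge>1. hole_depth ?c 1 e" if "(u, v) \<in> edges t" for u
    by (rule hole_depth_mark_edge[OF _ that]) (simp add: H_def)
qed


section \<open>The rules on labelled trees\<close>

locale canonical_names =
  fixes b :: "nat \<Rightarrow> var" and Pr :: "nat \<Rightarrow> nat set" and L :: "ax set"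
  assumes inj_b: "inj b" and infinite_free: "infinite (- range b)"
begin

abbreviation "E \<equiv> - range b"

definition fm_ok :: "fm \<Rightarrow> bool" where
  "fm_ok A \<longleftrightarrow> fv A \<subseteq> E \<and> bv A \<subseteq> range b \<and> in_lang Pr A"

text \<open>By the last clause a new leaf starts empty, and a label with any content is a node of
  \<open>t\<close>.\<close>

definition ok :: "(nat \<Rightarrow> var multiset) \<Rightarrow> (nat \<Rightarrow> fm multiset) \<Rightarrow> (nat \<Rightarrow> fm multiset) \<Rightarrow>
    shape \<Rightarrow> bool" where
  "ok X G D t \<longleftrightarrow> separate t \<and>
    (\<forall>w. set_mset (X w) \<subseteq> E \<and> (\<forall>A\<in>#G w. fm_ok A) \<and> (\<forall>A\<in>#D w. fm_ok A)) \<and>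
    (\<forall>w. w \<notin># labels t \<longrightarrow> X w = {#} \<and> G w = {#} \<and> D w = {#})"

text \<open>The quantification over \<open>F\<close> allows the premisses of an inference to be given derivations with
  disjoint eigenvariables.\<close>

definition prov :: "nat \<Rightarrow> nseq \<Rightarrow> bool" where
  "prov n S \<longleftrightarrow> (\<forall>F. finite F \<longrightarrow>
    (\<exists>d. is_derivation Pr L d S \<and> height d \<le> n \<and> set (eigenvars d) \<inter> F = {}))"

lemma prov_mono: "prov m S \<Longrightarrow> m \<le> n \<Longrightarrow> prov n S"
  unfolding prov_def by (meson order_trans)

text \<open>Inside the scope, the variable \<open>b (qdepth A)\<close> differs from all inner binder
  names and from every value of \<open>s\<close>, so substituting for it amounts to changing
  \<open>s\<close> at \<open>x\<close>. This keeps the instances produced by the quantifier rules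
  canonical.\<close>

lemma canon_subst_bound:
  assumes "range s \<subseteq> E" "z \<in> E"
  shows "subst (canon b (s(x := b (qdepth A))) A) z (b (qdepth A)) = canon b (s(x := z)) A"
proof -
  have "subst (canon b (s(x := b (qdepth A))) A) z (b (qdepth A)) =
      canon b (id(b (qdepth A) := z) \<circ> s(x := b (qdepth A))) A"
    unfolding subst_def
  proof (rule ren_canon[OF inj_b])
    fix v h assume "h < qdepth A"
    then have "b h \<noteq> b (qdepth A)" using inj_b by (auto simp: inj_eq)
    moreover have "s v \<noteq> b h" "z \<noteq> b h" "s v \<noteq> b (qdepth A)" using assms by auto
    ultimately show "(s(x := b (qdepth A))) v \<noteq> b h \<and>
        (id(b (qdepth A) := z)) ((s(x := b (qdepth A))) v) \<noteq> b h"
      by auto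
  qed
  also have "\<dots> = canon b (s(x := z)) A"
    by (rule canon_cong) (use assms(1) in auto)
  finally show ?thesis .
qed

lemma fm_ok_canon:
  assumes "range s \<subseteq> E" "in_lang Pr A"
  shows "fm_ok (canon b s A)"
proof -
  have "fv (canon b s A) \<subseteq> range s" using fv_canon[of b s A] by (auto dest!: subsetD)
  with assms show ?thesis using bv_canon[of b s A] by (simp add: fm_ok_def)
qed

lemma fms_den: "fms (den X G D t) \<subseteq> (\<Union>w. set_mset (G w) \<union> set_mset (D w))"
  by (induction t) auto

lemma sig_vars_den: "sig_vars (den X G D t) \<subseteq> (\<Union>w. set_mset (X w))"
  by (induction t) auto

lemma finite_nested: "finite (sig_vars S)" "finite (fms S)"
  by (induction S) auto

lemma ok_den:
  assumes "ok X G D t"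
  shows "pure (den X G D t)" "\<And>A. A \<in> fms (den X G D t) \<Longrightarrow> in_lang Pr A"
    "bvs (den X G D t) \<subseteq> range b"
proof -
  have fms: "fm_ok A" if "A \<in> fms (den X G D t)" for A
    using fms_den[of X G D t] that assms unfolding ok_def by fast
  have sig: "sig_vars (den X G D t) \<subseteq> E"
    using sig_vars_den[of X G D t] assms unfolding ok_def by fast
  show "in_lang Pr A" if "A \<in> fms (den X G D t)" for A using fms[OF that] by (simp add: fm_ok_def)
  have "fvs (den X G D t) \<subseteq> E" using fms sig by (auto simp: fvs_def fm_ok_def)
  moreover show "bvs (den X G D t) \<subseteq> range b"
    using fms by (auto simp: bvs_def fm_ok_def)
  ultimately show "pure (den X G D t)" by (auto simp: pure_def)
qed

section \<open>Assembling derivations with disjoint eigenvariables\<close>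

lemma height_Infer: "(\<And>d. d \<in> set ds \<Longrightarrow> height d \<le> n) \<Longrightarrow> height (Infer S e ds) \<le> Suc n"
  by auto

text \<open>The derivations are chosen one at a time; the eigenvariables of each join the set that
  the later ones have to avoid.\<close>

lemma prov_list:
  assumes "\<And>P. P \<in> set Ps \<Longrightarrow> prov n P" "finite F"
  shows "\<exists>ds. map concl ds = Ps \<and> (\<forall>d\<in>set ds. is_derivation Pr L d (concl d) \<and> height d \<le> n) \<and>
    distinct (concat (map eigenvars ds)) \<and> set (concat (map eigenvars ds)) \<inter> F = {}"
  using assms
proof (induction Ps arbitrary: F)
  case (Cons P Ps)
  then obtain d where d: "is_derivation Pr L d P" "height d \<le> n" "set (eigenvars d) \<inter> F = {}"
    unfolding prov_def by (meson list.set_intros(1))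
  have "finite (F \<union> set (eigenvars d))" using Cons.prems(2) by simp
  with Cons.IH Cons.prems(1) obtain ds where ds: "map concl ds = Ps"
    "\<forall>d\<in>set ds. is_derivation Pr L d (concl d) \<and> height d \<le> n"
    "distinct (concat (map eigenvars ds))"
    "set (concat (map eigenvars ds)) \<inter> (F \<union> set (eigenvars d)) = {}"
    by (meson list.set_intros(2))
  have "concl d = P" "distinct (eigenvars d)" using d(1) by (auto simp: is_derivation_def)
  then show ?case using d ds by (intro exI[of _ "d # ds"]) auto
qed simp

lemma prov_infer:
  assumes "\<And>P. P \<in> set Ps \<Longrightarrow> prov n P" and "rule L None Ps (den X G D t)" and "ok X G D t"
  shows "prov (Suc n) (den X G D t)"
  unfolding prov_def
proof (intro allI impI)
  fix F :: "var set" assume "finite F"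
  from prov_list[OF assms(1) this] obtain ds where ds: "map concl ds = Ps"
    "\<forall>d\<in>set ds. is_derivation Pr L d (concl d) \<and> height d \<le> n"
    "distinct (concat (map eigenvars ds))" "set (concat (map eigenvars ds)) \<inter> F = {}"
    by blast
  have "is_derivation Pr L (Infer (den X G D t) None ds) (den X G D t)"
    using ds assms(2) ok_den[OF assms(3)] by (auto simp: is_derivation_def)
  moreover have "height (Infer (den X G D t) None ds) \<le> Suc n"
    using ds(2) by (intro height_Infer) auto
  ultimately show "\<exists>d. is_derivation Pr L d (den X G D t) \<and> height d \<le> Suc n \<and>
      set (eigenvars d) \<inter> F = {}"
    using ds(4) by (intro exI[of _ "Infer (den X G D t) None ds"]) auto
qed

lemma ok_labels:
  "ok X G D t \<Longrightarrow> A \<in># G w \<Longrightarrow> w \<in># labels t"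
  "ok X G D t \<Longrightarrow> A \<in># D w \<Longrightarrow> w \<in># labels t"
  "ok X G D t \<Longrightarrow> x \<in># X w \<Longrightarrow> w \<in># labels t"
  by (auto simp: ok_def)

lemma node_rule:
  assumes ok: "ok X G D t" "w \<in># labels t"
    and rule: "\<And>c. is_ctx 1 c \<Longrightarrow>
      rule L None (map (\<lambda>(x, g, d). fill [Seq x g d {#}] c) Ps) (fill [Seq (X w) (G w) (D w) {#}] c)"
    and prov: "\<And>x g d. (x, g, d) \<in> set Ps \<Longrightarrow> prov n (den (X(w := x)) (G(w := g)) (D(w := d)) t)"
  shows "prov (Suc n) (den X G D t)"
proof -
  have "separate t" using ok(1) by (simp add: ok_def)
  from node_ctx[OF this ok(2), of X G D] obtain c where c: "is_ctx 1 c"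
    "\<And>x g d. fill [Seq x g d {#}] c = den (X(w := x)) (G(w := g)) (D(w := d)) t" by metis
  show ?thesis
    by (rule prov_infer[OF _ rule[OF c(1), unfolded c(2) fun_upd_triv] ok(1)]) (use prov in auto)
qed

lemma edge_rule:
  assumes ok: "ok X G D t" "(w, v) \<in> edges t"
    and rule: "\<And>c C. is_ctx 1 c \<Longrightarrow>
      rule L None [fill [Seq x g (D w) {#Seq x' g' (D v) C#}] c]
        (fill [Seq (X w) (G w) (D w) {#Seq (X v) (G v) (D v) C#}] c)"
    and prov: "prov n (den (X(w := x, v := x')) (G(w := g, v := g')) D t)"
  shows "prov (Suc n) (den X G D t)"
proof -
  have "separate t" using ok(1) by (simp add: ok_def)
  from edge_ctx[OF this ok(2), of X G D] obtain c C where c: "is_ctx 1 c"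
    "\<And>x g d x' g' d'. fill [Seq x g d {#Seq x' g' d' C#}] c =
      den (X(w := x, v := x')) (G(w := g, v := g')) (D(w := d, v := d')) t" by metis
  show ?thesis
    by (rule prov_infer[OF _ rule[OF c(1), of C, unfolded c(2) fun_upd_triv] ok(1)]) (use prov in auto)
qed

text \<open>Only the displayed parts \<open>x\<close> and \<open>g\<close> are taken out of
  \<open>w\<close>; the rest of \<open>w\<close> and the content of \<open>v\<close> stay in the
  context. So an instance of the rule with otherwise empty displayed sequents suffices, also when
  \<open>w = v\<close>.\<close>

lemma two_node_rule:
  assumes ok: "ok X G D t" "w \<in># labels t" "v \<in># labels t"
    and sub: "x \<subseteq># X w" "g \<subseteq># G w"
    and rule: "\<And>c. is_ctx 2 c \<Longrightarrow>
      (\<And>u. (u, w) \<in> edges t \<Longrightarrow> \<exists>e\<ge>1. hole_depth c 0 e) \<Longrightarrow>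
      (\<And>u. (u, v) \<in> edges t \<Longrightarrow> \<exists>e\<ge>1. hole_depth c 1 e) \<Longrightarrow>
      rule L None [fill [Seq x g {#} {#}, Seq x' g' {#} {#}] c]
        (fill [Seq x g {#} {#}, Seq {#} {#} {#} {#}] c)"
    and prov: "prov n (den (X(v := x' + X v)) (G(v := g' + G v)) D t)"
  shows "prov (Suc n) (den X G D t)"
proof -
  have "separate t" using ok(1) by (simp add: ok_def)
  then show ?thesis
  proof (rule two_node_ctx[of _ _ _ "X(w := X w - x)" "G(w := G w - g)" D, OF _ ok(2,3)])
    fix c
    assume c: "is_ctx 2 c"
      "\<And>u. (u, w) \<in> edges t \<Longrightarrow> \<exists>e\<ge>1. hole_depth c 0 e"
      "\<And>u. (u, v) \<in> edges t \<Longrightarrow> \<exists>e\<ge>1. hole_depth c 1 e"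
      and fill: "\<And>p q d p' q' d'. fill [Seq p q d {#}, Seq p' q' d' {#}] c =
        den (\<lambda>i. (X(w := X w - x)) i + (if i = w then p else {#}) + (if i = v then p' else {#}))
          (\<lambda>i. (G(w := G w - g)) i + (if i = w then q else {#}) + (if i = v then q' else {#}))
          (\<lambda>i. D i + (if i = w then d else {#}) + (if i = v then d' else {#})) t"
    have "fill [Seq x g {#} {#}, Seq {#} {#} {#} {#}] c = den X G D t"
      unfolding fill using sub by (intro den_cong) auto
    moreover have "fill [Seq x g {#} {#}, Seq x' g' {#} {#}] c =
        den (X(v := x' + X v)) (G(v := g' + G v)) D t"
      unfolding fill using sub by (intro den_cong) (auto simp: add.commute)
    ultimately show ?thesis
      using prov_infer[OF _ _ ok(1), of "[fill [Seq x g {#} {#}, Seq x' g' {#} {#}] c]"]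
        rule[OF c] prov by auto
  qed
qed

section \<open>The rules of the calculus on labelled trees, one by one\<close>

lemma prov_Init:
  assumes "ok X G D t" "atomic P" "P \<in># G w" "P \<in># D w"
  shows "prov (Suc n) (den X G D t)"
  by (rule node_rule[OF assms(1) ok_labels(1)[OF assms(1,3)], where Ps = "[]"])
    (use assms(2-4) in \<open>auto dest!: multi_member_split intro: rule.Init simp del: One_nat_def\<close>)

lemma prov_LBot:
  assumes "ok X G D t" "Bot \<in># G w"
  shows "prov (Suc n) (den X G D t)"
  by (rule node_rule[OF assms(1) ok_labels(1)[OF assms(1,2)], where Ps = "[]"])
    (use assms(2) in \<open>auto dest!: multi_member_split intro: rule.LBot simp del: One_nat_def\<close>)

lemma prov_LImp:
  assumes "ok X G D t" "G w = add_mset (Imp A B) \<Gamma>"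
    "prov n (den X (G(w := \<Gamma>)) (D(w := add_mset A (D w))) t)"
    "prov n (den X (G(w := add_mset B \<Gamma>)) D t)"
  shows "prov (Suc n) (den X G D t)"
  by (rule node_rule[where w = w and
        Ps = "[(X w, \<Gamma>, add_mset A (D w)), (X w, add_mset B \<Gamma>, D w)]"])
    (use assms ok_labels(1)[OF assms(1), of "Imp A B" w] in \<open>auto intro: rule.LImp simp del: One_nat_def\<close>)

lemma prov_RImp:
  assumes "ok X G D t" "D w = add_mset (Imp A B) \<Delta>"
    "prov n (den X (G(w := add_mset A (G w))) (D(w := add_mset B \<Delta>)) t)"
  shows "prov (Suc n) (den X G D t)"
  by (rule node_rule[where w = w and Ps = "[(X w, add_mset A (G w), add_mset B \<Delta>)]"])
    (use assms ok_labels(2)[OF assms(1), of "Imp A B" w] in \<open>auto intro: rule.RImp simp del: One_nat_def\<close>)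

lemma prov_LAll:
  assumes "ok X G D t" "Forall x A \<in># G w" "z \<in># X w"
    "prov n (den X (G(w := add_mset (subst A z x) (G w))) D t)"
  shows "prov (Suc n) (den X G D t)"
  by (rule node_rule[where w = w and Ps = "[(X w, add_mset (subst A z x) (G w), D w)]"])
    (use assms ok_labels(1)[OF assms(1,2)] in \<open>auto dest!: multi_member_split intro: rule.LAll simp del: One_nat_def\<close>)

text \<open>The premiss is assumed for every \<open>y\<close> in \<open>E\<close>, because the
  eigenvariable cannot be fixed beforehand: it must avoid the conclusion and also the set
  \<open>F\<close> over which \<open>prov\<close> quantifies. Such a \<open>y\<close> exists since
  \<open>E\<close> is infinite.\<close>

lemma prov_RAll:
  assumes "ok X G D t" "D w = add_mset (Forall x A) \<Delta>"
    "\<And>y. y \<in> E \<Longrightarrow> prov n (den (X(w := add_mset y (X w))) G (D(w := add_mset (subst A y x) \<Delta>)) t)"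
  shows "prov (Suc n) (den X G D t)"
  unfolding prov_def
proof (intro allI impI)
  fix F :: "var set" assume F: "finite F"
  let ?S = "den X G D t"
  have w: "w \<in># labels t" using ok_labels(2)[OF assms(1), of "Forall x A" w] assms(2) by simp
  have "separate t" using assms(1) by (simp add: ok_def)
  from node_ctx[OF this w, of X G D] obtain c where c: "is_ctx 1 c"
    "\<And>x g d. fill [Seq x g d {#}] c = den (X(w := x)) (G(w := g)) (D(w := d)) t" by metis
  have "finite (F \<union> fvs ?S)" using F by (auto simp: fvs_def finite_nested finite_fv)
  then have "\<exists>y\<in>E. y \<notin> F \<union> fvs ?S" using infinite_free by (meson finite_subset subsetI)
  then obtain y where y: "y \<in> E" "y \<notin> F" "y \<notin> fvs ?S" by blast
  have ny: "y \<notin> fvs ?S \<union> bvs ?S" using y ok_den(3)[OF assms(1)] by auto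
  let ?P = "den (X(w := add_mset y (X w))) G (D(w := add_mset (subst A y x) \<Delta>)) t"
  have "rule L (Some y) [fill [Seq (add_mset y (X w)) (G w) (add_mset (subst A y x) \<Delta>) {#}] c] ?S"
    by (rule rule.RAll[OF c(1) _ ny]) (simp add: c(2) assms(2)[symmetric] fun_upd_triv)
  then have rule: "rule L (Some y) [?P] ?S" by (simp add: c(2) fun_upd_triv)
  \<comment> \<open>Putting \<open>y\<close> into the set to be avoided keeps it different from the
    eigenvariables of the derivation of the premiss.\<close>
  from F obtain d where d: "is_derivation Pr L d ?P" "height d \<le> n"
    "set (eigenvars d) \<inter> insert y F = {}"
    using assms(3)[OF y(1)] unfolding prov_def by (meson finite_insert)
  have "is_derivation Pr L (Infer ?S (Some y) [d]) ?S"
    using d(1,3) rule ok_den[OF assms(1)] by (auto simp: is_derivation_def)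
  moreover have "height (Infer ?S (Some y) [d]) \<le> Suc n" using d(2) by simp
  ultimately show "\<exists>d. is_derivation Pr L d ?S \<and> height d \<le> Suc n \<and> set (eigenvars d) \<inter> F = {}"
    using d(3) y(2) by (intro exI[of _ "Infer ?S (Some y) [d]"]) auto
qed

lemma prov_grow:
  assumes "ok X G D t" "w \<in># labels t" "k \<notin># labels t"
    and rule: "\<And>c. is_ctx 1 c \<Longrightarrow> rule L None [fill [Seq (X w) (G w) d {#Seq {#} {#} d' {#}#}] c]
        (fill [Seq (X w) (G w) (D w) {#}] c)"
    and prov: "prov n (den X G (D(w := d, k := d')) (grow w k t))"
  shows "prov (Suc n) (den X G D t)"
proof -
  have "separate t" using assms(1) by (simp add: ok_def)
  from node_ctx[OF this assms(2), of X G D] obtain c where c: "is_ctx 1 c"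
    "\<And>x g d. fill [Seq x g d {#}] c = den (X(w := x)) (G(w := g)) (D(w := d)) t"
    "\<And>x g d x' g' d'. fill [Seq x g d {#Seq x' g' d' {#}#}] c =
      den (X(w := x, k := x')) (G(w := g, k := g')) (D(w := d, k := d')) (grow w k t)"
    using assms(3) by metis
  have "X k = {#}" "G k = {#}" using assms(1,3) by (auto simp: ok_def)
  then have "X(k := {#}) = X" "G(k := {#}) = G" by auto
  then show ?thesis
    using prov_infer[OF _ rule[OF c(1), unfolded c(2,3) fun_upd_triv] assms(1)] prov by simp
qed

lemma prov_RBox:
  assumes "ok X G D t" "D w = add_mset (Box A) \<Delta>" "k \<notin># labels t"
    "prov n (den X G (D(w := \<Delta>, k := {#A#})) (grow w k t))"
  shows "prov (Suc n) (den X G D t)"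
  by (rule prov_grow[OF assms(1) _ assms(3) _ assms(4)])
    (use assms(2) ok_labels(2)[OF assms(1), of "Box A" w] in \<open>auto intro: rule.RBox simp del: One_nat_def\<close>)

lemma prov_RD:
  assumes "ok X G D t" "AxD \<in> L" "w \<in># labels t" "k \<notin># labels t"
    "prov n (den X G D (grow w k t))"
  shows "prov (Suc n) (den X G D t)"
proof (rule prov_grow[OF assms(1,3,4)])
  have "D k = {#}" using assms(1,4) by (auto simp: ok_def)
  then have "D(w := D w, k := {#}) = D" by auto
  with assms(5) show "prov n (den X G (D(w := D w, k := {#})) (grow w k t))" by simp
qed (simp add: rule.RD assms(2))

lemma prov_LBox:
  assumes "ok X G D t" "(w, v) \<in> edges t" "Box A \<in># G w"
    "prov n (den X (G(v := add_mset A (G v))) D t)"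
  shows "prov (Suc n) (den X G D t)"
  by (rule edge_rule[OF assms(1,2), where x = "X w" and g = "G w" and x' = "X v" and
      g' = "add_mset A (G v)"])
    (use assms(3,4) in \<open>auto dest!: multi_member_split intro: rule.LBox simp del: One_nat_def\<close>)

lemma prov_R4:
  assumes "ok X G D t" "Ax4 \<in> L" "(w, v) \<in> edges t" "Box A \<in># G w"
    "prov n (den X (G(v := add_mset (Box A) (G v))) D t)"
  shows "prov (Suc n) (den X G D t)"
  by (rule edge_rule[OF assms(1,3), where x = "X w" and g = "G w" and x' = "X v" and
      g' = "add_mset (Box A) (G v)"])
    (use assms(2,4,5) in \<open>auto dest!: multi_member_split intro: rule.R4 simp del: One_nat_def\<close>)

text \<open>In \<open>edge_rule\<close> the update at \<open>v\<close> comes after the one at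
  \<open>w\<close>; \<open>w \<noteq> v\<close> ensures that restoring \<open>G v\<close> does not
  undo the change at \<open>w\<close>.\<close>

lemma prov_RB:
  assumes "ok X G D t" "AxB \<in> L" "(w, v) \<in> edges t" "Box A \<in># G v"
    "prov n (den X (G(w := add_mset A (G w))) D t)" "w \<noteq> v"
  shows "prov (Suc n) (den X G D t)"
  by (rule edge_rule[OF assms(1,3), where x = "X w" and g = "add_mset A (G w)" and x' = "X v" and
      g' = "G v"])
    (use assms(2,4,5,6) in \<open>auto dest!: multi_member_split intro: rule.RB simp: fun_upd_idem simp del: One_nat_def\<close>)

lemma prov_RCBF:
  assumes "ok X G D t" "AxCBF \<in> L" "(w, v) \<in> edges t" "x \<in># X w"
    "prov n (den (X(v := add_mset x (X v))) G D t)"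
  shows "prov (Suc n) (den X G D t)"
  by (rule edge_rule[OF assms(1,3), where x = "X w" and g = "G w" and x' = "add_mset x (X v)" and
      g' = "G v"])
    (use assms(2,4,5) in \<open>auto dest!: multi_member_split intro: rule.RCBF simp del: One_nat_def\<close>)

lemma prov_RBF:
  assumes "ok X G D t" "AxBF \<in> L" "(w, v) \<in> edges t" "x \<in># X v"
    "prov n (den (X(w := add_mset x (X w))) G D t)" "w \<noteq> v"
  shows "prov (Suc n) (den X G D t)"
  by (rule edge_rule[OF assms(1,3), where x = "add_mset x (X w)" and g = "G w" and x' = "X v" and
      g' = "G v"])
    (use assms(2,4,5,6) in \<open>auto dest!: multi_member_split intro: rule.RBF simp: fun_upd_idem simp del: One_nat_def\<close>)

lemma prov_Ref:
  assumes "ok X G D t" "w \<in># labels t" "prov n (den X (G(w := add_mset (Eq x x) (G w))) D t)"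
  shows "prov (Suc n) (den X G D t)"
  by (rule node_rule[OF assms(1,2), where Ps = "[(X w, add_mset (Eq x x) (G w), D w)]"])
    (use assms(3) in \<open>auto intro: rule.Ref simp del: One_nat_def\<close>)

text \<open>The rule displays two occurrences in one antecedent. Membership supplies them only when
  the two formulas differ; \<open>absorb\<close> deals with the case of equality by other
  means.\<close>

lemma prov_Repl:
  assumes "ok X G D t" "Eq x y \<in># G w" "subst P x z \<in># G w" "subst P x z \<noteq> Eq x y" "atomic P"
    "prov n (den X (G(w := add_mset (subst P y z) (G w))) D t)"
  shows "prov (Suc n) (den X G D t)"
proof -
  obtain \<Gamma> where "G w = add_mset (Eq x y) (add_mset (subst P x z) \<Gamma>)"
    using assms(2-4) by (metis insert_noteq_member multi_member_split)
  then show ?thesis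
    by (intro node_rule[OF assms(1) ok_labels(1)[OF assms(1,2)],
          where Ps = "[(X w, add_mset (subst P y z) (G w), D w)]"])
      (use assms(5,6) in \<open>auto intro: rule.Repl simp del: One_nat_def\<close>)
qed

lemma prov_ReplX:
  assumes "ok X G D t" "Eq x y \<in># G w" "x \<in># X w"
    "prov n (den (X(w := add_mset y (X w))) G D t)"
  shows "prov (Suc n) (den X G D t)"
proof (rule node_rule[OF assms(1) ok_labels(1)[OF assms(1,2)],
    where Ps = "[(add_mset y (X w), G w, D w)]"])
  fix c assume c: "is_ctx 1 c"
  obtain Y \<Gamma> where "X w = add_mset x Y" "G w = add_mset (Eq x y) \<Gamma>"
    using assms(2,3) by (meson multi_member_split)
  then show "rule L None (map (\<lambda>(x, g, d). fill [Seq x g d {#}] c) [(add_mset y (X w), G w, D w)])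
      (fill [Seq (X w) (G w) (D w) {#}] c)"
    using rule.ReplX[OF c, of L x y Y \<Gamma> "D w"] by (simp add: add_mset_commute)
qed (use assms(4) in auto)

lemma prov_RT:
  assumes "ok X G D t" "AxT \<in> L" "Box A \<in># G w" "prov n (den X (G(w := add_mset A (G w))) D t)"
  shows "prov (Suc n) (den X G D t)"
  by (rule node_rule[OF assms(1) ok_labels(1)[OF assms(1,3)],
      where Ps = "[(X w, add_mset A (G w), D w)]"])
    (use assms(2-4) in \<open>auto dest!: multi_member_split intro: rule.RT simp del: One_nat_def\<close>)

lemma prov_RUI:
  assumes "ok X G D t" "AxUI \<in> L" "w \<in># labels t" "prov n (den (X(w := add_mset x (X w))) G D t)"
  shows "prov (Suc n) (den X G D t)"
  by (rule node_rule[OF assms(1,3), where Ps = "[(add_mset x (X w), G w, D w)]"])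
    (use assms(2,4) in \<open>auto intro: rule.RUI simp del: One_nat_def\<close>)

lemma prov_Rig:
  assumes "ok X G D t" "Eq x y \<in># G w" "v \<in># labels t"
    "prov n (den X (G(v := add_mset (Eq x y) (G v))) D t)"
  shows "prov (Suc n) (den X G D t)"
  by (rule two_node_rule[OF assms(1) ok_labels(1)[OF assms(1,2)] assms(3),
      where x = "{#}" and g = "{#Eq x y#}" and x' = "{#}" and g' = "{#Eq x y#}"])
    (use assms(2,4) rule.Rig[where ?L = L and X = "{#}" and \<Gamma> = "{#}" and \<Delta> = "{#}" and Y = "{#}" and
      \<Pi> = "{#}" and \<Sigma> = "{#}" and x = x and y = y] in auto)

lemma prov_R5:
  assumes "ok X G D t" "Ax5 \<in> L" "Box A \<in># G w" "(u, w) \<in> edges t" "v \<in># labels t"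
    "prov n (den X (G(v := add_mset (Box A) (G v))) D t)"
  shows "prov (Suc n) (den X G D t)"
proof (rule two_node_rule[OF assms(1) ok_labels(1)[OF assms(1,3)] assms(5),
      where x = "{#}" and g = "{#Box A#}" and x' = "{#}" and g' = "{#Box A#}"])
  fix c assume c: "is_ctx 2 c" and d: "\<And>u. (u, w) \<in> edges t \<Longrightarrow> \<exists>e\<ge>1. hole_depth c 0 e"
  from d[OF assms(4)] obtain e where "e \<ge> 1" "hole_depth c 0 e" by blast
  then show "rule L None [fill [Seq {#} {#Box A#} {#} {#}, Seq {#} {#Box A#} {#} {#}] c]
      (fill [Seq {#} {#Box A#} {#} {#}, Seq {#} {#} {#} {#}] c)"
    using rule.R5[OF assms(2) c] by blast
qed (use assms in auto)

lemma prov_R5dom: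
  assumes "ok X G D t" "Ax5 \<in> L" "{AxCBF, AxBF} \<inter> L \<noteq> {}" "x \<in># X w"
    "(u, w) \<in> edges t" "(u', v) \<in> edges t"
    "prov n (den (X(v := add_mset x (X v))) G D t)"
  shows "prov (Suc n) (den X G D t)"
proof (rule two_node_rule[OF assms(1) ok_labels(3)[OF assms(1,4)],
      where x = "{#x#}" and g = "{#}" and x' = "{#x#}" and g' = "{#}" and v = v])
  fix c assume c: "is_ctx 2 c" and d: "\<And>u. (u, w) \<in> edges t \<Longrightarrow> \<exists>e\<ge>1. hole_depth c 0 e"
    "\<And>u. (u, v) \<in> edges t \<Longrightarrow> \<exists>e\<ge>1. hole_depth c 1 e"
  from d(1)[OF assms(5)] d(2)[OF assms(6)] obtain e e'
    where "e \<ge> 1" "hole_depth c 0 e" "e' \<ge> 1" "hole_depth c 1 e'" by blast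
  then show "rule L None [fill [Seq {#x#} {#} {#} {#}, Seq {#x#} {#} {#} {#}] c]
      (fill [Seq {#x#} {#} {#} {#}, Seq {#} {#} {#} {#}] c)"
    using rule.R5dom[OF assms(2,3) c] by blast
qed (use assms edges_labels in auto)

end


section \<open>Accounted formulas and embeddings\<close>

text \<open>A formula is accounted for at a node if it occurs there, or if what its invertible rule would
  put into some premiss is accounted for. \<open>L\<forall>\<close> and \<open>L\<box>\<close> keep their principal formula, so they need no
  clause.\<close>

inductive lacc and racc for R :: "(nat \<times> nat) set" and X :: "nat \<Rightarrow> var multiset" and G D :: "nat \<Rightarrow> fm multiset" where
  lacc_mem: "A \<in># G w \<Longrightarrow> lacc R X G D w A"
| lacc_Imp1: "racc R X G D w A \<Longrightarrow> lacc R X G D w (Imp A B)"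
| lacc_Imp2: "lacc R X G D w B \<Longrightarrow> lacc R X G D w (Imp A B)"
| racc_mem: "A \<in># D w \<Longrightarrow> racc R X G D w A"
| racc_Imp: "lacc R X G D w A \<Longrightarrow> racc R X G D w B \<Longrightarrow> racc R X G D w (Imp A B)"
| racc_Forall: "z \<in># X w \<Longrightarrow> racc R X G D w (subst A z x) \<Longrightarrow> racc R X G D w (Forall x A)"
| racc_Box: "(w, v) \<in> R \<Longrightarrow> racc R X G D v A \<Longrightarrow> racc R X G D w (Box A)"

inductive_cases lacc_ImpE: "lacc R X G D w (Imp A B)"
inductive_cases racc_ImpE: "racc R X G D w (Imp A B)"
inductive_cases racc_ForallE: "racc R X G D w (Forall x A)"
inductive_cases racc_BoxE: "racc R X G D w (Box A)"

lemma lacc_other: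
  "lacc R X G D w (Rel i xs) \<longleftrightarrow> Rel i xs \<in># G w"
  "lacc R X G D w (Eq x y) \<longleftrightarrow> Eq x y \<in># G w"
  "lacc R X G D w Bot \<longleftrightarrow> Bot \<in># G w"
  "lacc R X G D w (Forall x A) \<longleftrightarrow> Forall x A \<in># G w"
  "lacc R X G D w (Box A) \<longleftrightarrow> Box A \<in># G w"
  by (auto elim: lacc.cases intro: lacc_mem)

lemma acc_atomic:
  "atomic P \<Longrightarrow> lacc R X G D w P \<longleftrightarrow> P \<in># G w"
  "atomic P \<Longrightarrow> racc R X G D w P \<longleftrightarrow> P \<in># D w"
  by (cases P; auto elim: lacc.cases racc.cases intro: lacc_mem racc_mem)+

text \<open>Weaker than inclusion of contents: an inference read upwards may delete its principal
  formula, as long as that formula stays accounted for.\<close>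

definition le where
  "le X G D t X' G' D' t' \<longleftrightarrow> edges t \<subseteq> edges t' \<and> set_mset (labels t) \<subseteq> set_mset (labels t') \<and>
    (\<forall>w. set_mset (X w) \<subseteq> set_mset (X' w) \<and>
      (\<forall>A\<in>#G w. lacc (edges t') X' G' D' w A) \<and> (\<forall>A\<in>#D w. racc (edges t') X' G' D' w A))"

lemma le_sig: "le X G D t X' G' D' t' \<Longrightarrow> x \<in># X w \<Longrightarrow> x \<in># X' w"
  unfolding le_def by blast

text \<open>Accounts compose: wherever an account in the old tree ends in a member,
  \<open>le\<close> supplies an account of that member in the new tree.\<close>

lemma le_acc:
  assumes "le X G D t X' G' D' t'"
  shows "lacc (edges t) X G D w A \<Longrightarrow> lacc (edges t') X' G' D' w A"
    and "racc (edges t) X G D w A \<Longrightarrow> racc (edges t') X' G' D' w A"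
proof (induction rule: lacc_racc.inducts)
  case (racc_Forall z w A x)
  show ?case
    by (rule lacc_racc.racc_Forall[of z]) (use racc_Forall assms in \<open>auto simp: le_def\<close>)
next
  case (racc_Box w v A)
  show ?case
    by (rule lacc_racc.racc_Box[of w v]) (use racc_Box assms in \<open>auto simp: le_def\<close>)
qed (use assms in \<open>auto simp: le_def intro: lacc_racc.intros\<close>)

context canonical_names
begin

text \<open>A map of nodes that preserves the child relation. It need be neither injective nor root-preserving,
  and equal children may have different images.\<close>

primrec emb where
  "emb X G D t s (Seq Y \<Pi> \<Sigma> C) w \<longleftrightarrow> w \<in># labels t \<and> (\<forall>x\<in>#Y. s x \<in># X w) \<and>
    (\<forall>A\<in>#\<Pi>. lacc (edges t) X G D w (canon b s A)) \<and>
    (\<forall>A\<in>#\<Sigma>. racc (edges t) X G D w (canon b s A)) \<and>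
    (\<forall>f\<in>#image_mset (emb X G D t s) C. \<exists>v. (w, v) \<in> edges t \<and> f v)"

text \<open>\<open>r\<close> records the node to which each hole is mapped.\<close>

primrec emb_ctx where
  "emb_ctx X G D t s r (Ctx H Y \<Pi> \<Sigma> C) w \<longleftrightarrow> w \<in># labels t \<and> (\<forall>i\<in>#H. r i = w) \<and>
    (\<forall>x\<in>#Y. s x \<in># X w) \<and>
    (\<forall>A\<in>#\<Pi>. lacc (edges t) X G D w (canon b s A)) \<and>
    (\<forall>A\<in>#\<Sigma>. racc (edges t) X G D w (canon b s A)) \<and>
    (\<forall>f\<in>#image_mset (emb_ctx X G D t s r) C. \<exists>v. (w, v) \<in> edges t \<and> f v)"

lemma emb_label: "emb X G D t s T w \<Longrightarrow> w \<in># labels t"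
  by (cases T) simp

text \<open>Hence whatever is embedded in the conclusion of an inference remains embedded in its
  premisses, once these are above it in the sense of \<open>le\<close>.\<close>

lemma emb_le: "le X G D t X' G' D' t' \<Longrightarrow> emb X G D t s T w \<Longrightarrow> emb X' G' D' t' s T w"
proof (induction T arbitrary: w)
  case (Seq Y \<Pi> \<Sigma> C)
  have "\<exists>v. (w, v) \<in> edges t' \<and> emb X' G' D' t' s T v" if T: "T \<in># C" for T
  proof -
    from Seq.prems(2) T obtain v where "(w, v) \<in> edges t" "emb X G D t s T v" by auto
    then show ?thesis using Seq.IH[OF T Seq.prems(1)] Seq.prems(1) by (auto simp: le_def)
  qed
  moreover have "w \<in># labels t'" using Seq.prems by (auto simp: le_def)
  moreover have "\<forall>x\<in>#Y. s x \<in># X' w" using Seq.prems(2) le_sig[OF Seq.prems(1)] by simp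
  ultimately show ?case using Seq.prems(2) le_acc[OF Seq.prems(1)] by simp
qed

lemma emb_ctx_le:
  "le X G D t X' G' D' t' \<Longrightarrow> emb_ctx X G D t s r c w \<Longrightarrow> emb_ctx X' G' D' t' s r c w"
proof (induction c arbitrary: w)
  case (Ctx H Y \<Pi> \<Sigma> C)
  have "\<exists>v. (w, v) \<in> edges t' \<and> emb_ctx X' G' D' t' s r c v" if c: "c \<in># C" for c
  proof -
    from Ctx.prems(2) c obtain v where "(w, v) \<in> edges t" "emb_ctx X G D t s r c v" by auto
    then show ?thesis using Ctx.IH[OF c Ctx.prems(1)] Ctx.prems(1) by (auto simp: le_def)
  qed
  moreover have "w \<in># labels t'" using Ctx.prems by (auto simp: le_def)
  moreover have "\<forall>x\<in>#Y. s x \<in># X' w" using Ctx.prems(2) le_sig[OF Ctx.prems(1)] by simp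
  ultimately show ?case using Ctx.prems(2) le_acc[OF Ctx.prems(1)] by simp
qed

text \<open>All clauses of \<open>emb\<close> concern members and never multiplicities, so two
  sequents fused at the root may share their images.\<close>

lemma emb_plus: "emb X G D t s (S + T) w \<longleftrightarrow> emb X G D t s S w \<and> emb X G D t s T w"
  by (cases S; cases T) auto

lemma emb_sum:
  "w \<in># labels t \<Longrightarrow> emb X G D t s (\<Sum>i\<in>#H. Ss ! i) w \<longleftrightarrow> (\<forall>i\<in>#H. emb X G D t s (Ss ! i) w)"
  by (induction H) (auto simp: emb_plus zero_nested_def)

lemma emb_ctx_cong_holes:
  "(\<And>i. i \<in># holes c \<Longrightarrow> r i = r' i) \<Longrightarrow> emb_ctx X G D t s r c w \<Longrightarrow> emb_ctx X G D t s r' c w"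
proof (induction c arbitrary: w)
  case (Ctx H Y \<Pi> \<Sigma> C)
  have "\<exists>v. (w, v) \<in> edges t \<and> emb_ctx X G D t s r' c v" if c: "c \<in># C" for c
  proof -
    from Ctx.prems(2) c obtain v where v: "(w, v) \<in> edges t" "emb_ctx X G D t s r c v" by auto
    have "emb_ctx X G D t s r' c v" by (rule Ctx.IH[OF c _ v(2)]) (use Ctx.prems(1) c in auto)
    with v(1) show ?thesis by blast
  qed
  moreover have "\<forall>i\<in>#H. r' i = w" using Ctx.prems by auto
  ultimately show ?case using Ctx.prems(2) by simp
qed

lemma fvs_plus: "fvs (S + T) = fvs S \<union> fvs T"
  by (cases S; cases T) (auto simp: fvs_def)

lemma emb_ctx_cong_vars:
  "(\<And>v. v \<in> fvs (fill Ss c) \<Longrightarrow> s v = s' v) \<Longrightarrow> emb_ctx X G D t s r c w \<Longrightarrow>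
    emb_ctx X G D t s' r c w"
proof (induction c arbitrary: w)
  case (Ctx H Y \<Pi> \<Sigma> C)
  have eq: "s v = s' v"
    if "v \<in># Y \<or> (\<exists>A. A \<in># \<Pi> + \<Sigma> \<and> v \<in> fv A) \<or> (\<exists>c. c \<in># C \<and> v \<in> fvs (fill Ss c))" for v
    by (rule Ctx.prems(1)) (use that in \<open>auto simp: fvs_plus, auto simp: fvs_def\<close>)
  have "\<exists>v. (w, v) \<in> edges t \<and> emb_ctx X G D t s' r c v" if c: "c \<in># C" for c
  proof -
    from Ctx.prems(2) c obtain v where v: "(w, v) \<in> edges t" "emb_ctx X G D t s r c v" by auto
    have "emb_ctx X G D t s' r c v" by (rule Ctx.IH[OF c _ v(2)]) (use eq c in blast)
    with v(1) show ?thesis by blast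
  qed
  moreover have "\<forall>x\<in>#Y. s' x \<in># X w" using Ctx.prems(2) eq by auto
  moreover have "canon b s' A = canon b s A" if "A \<in># \<Pi> + \<Sigma>" for A
    by (rule canon_cong) (use eq that in metis)
  ultimately show ?case using Ctx.prems(2) by simp
qed

lemma emb_fillI:
  "emb_ctx X G D t s r c w \<Longrightarrow> (\<And>i. i \<in># holes c \<Longrightarrow> emb X G D t s (Ss ! i) (r i)) \<Longrightarrow>
    emb X G D t s (fill Ss c) w"
proof (induction c arbitrary: w)
  case (Ctx H Y \<Pi> \<Sigma> C)
  have "\<exists>v. (w, v) \<in> edges t \<and> emb X G D t s (fill Ss c) v" if c: "c \<in># C" for c
  proof -
    from Ctx.prems(1) c obtain v where v: "(w, v) \<in> edges t" "emb_ctx X G D t s r c v" by auto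
    have "emb X G D t s (fill Ss c) v" by (rule Ctx.IH[OF c v(2)]) (use Ctx.prems(2) c in auto)
    with v(1) show ?thesis by blast
  qed
  moreover have "\<forall>i\<in>#H. emb X G D t s (Ss ! i) w" using Ctx.prems by auto
  ultimately show ?case using Ctx.prems(1) by (simp add: emb_plus emb_sum)
qed

text \<open>Since every hole occurs at most once, the placements of holes obtained separately for
  the children can be glued into one function \<open>r\<close>.\<close>

lemma emb_fillE:
  assumes "\<And>i. count (holes c) i \<le> 1" "emb X G D t s (fill Ss c) w"
  shows "\<exists>r. emb_ctx X G D t s r c w \<and> (\<forall>i\<in>#holes c. emb X G D t s (Ss ! i) (r i))"
  using assms
proof (induction c arbitrary: w)
  case (Ctx H Y \<Pi> \<Sigma> C)
  have w: "w \<in># labels t" using emb_label[OF Ctx.prems(2)] .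
  have root: "emb X G D t s (Seq Y \<Pi> \<Sigma> (image_mset (fill Ss) C)) w"
    "\<forall>i\<in>#H. emb X G D t s (Ss ! i) w"
    using Ctx.prems(2) unfolding fill.simps emb_plus emb_sum[OF w] by blast+
  have split: "count H i + count (holes c) i \<le> 1 \<and>
      (\<forall>c'. c' \<in># C - {#c#} \<longrightarrow> count (holes c) i + count (holes c') i \<le> 1)"
    if "c \<in># C" for c i
  proof -
    from that obtain C' where C: "C = add_mset c C'" by (meson multi_member_split)
    have le: "count H i + (count (holes c) i + count (\<Sum>\<^sub># (image_mset holes C')) i) \<le> 1"
      using Ctx.prems(1)[of i] C by simp
    have "count (holes c') i \<le> count (\<Sum>\<^sub># (image_mset holes C')) i" if "c' \<in># C'" for c'
      using that by (auto dest!: multi_member_split)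
    with le show ?thesis using C by fastforce
  qed
  have "\<exists>v r. (w, v) \<in> edges t \<and> emb_ctx X G D t s r c v \<and>
      (\<forall>i\<in>#holes c. emb X G D t s (Ss ! i) (r i))" if c: "c \<in># C" for c
  proof -
    from root(1) c obtain v where v: "(w, v) \<in> edges t" "emb X G D t s (fill Ss c) v" by auto
    have "count (holes c) i \<le> 1" for i using split[OF c, of i] by auto
    with Ctx.IH[OF c _ v(2)] v(1) show ?thesis by blast
  qed
  then obtain V P where VP: "\<And>c. c \<in># C \<Longrightarrow> (w, V c) \<in> edges t \<and> emb_ctx X G D t s (P c) c (V c) \<and>
      (\<forall>i\<in>#holes c. emb X G D t s (Ss ! i) (P c i))" by metis
  \<comment> \<open>By \<open>split\<close>, a hole of the context lies either at the root or in
    exactly one child, so the choice agrees with the placement \<open>P c\<close> of that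
    child.\<close>
  define r where "r i = (if i \<in># H then w else P (SOME c. c \<in># C \<and> i \<in># holes c) i)" for i
  have r: "r i = P c i" if "c \<in># C" "i \<in># holes c" for c i
  proof -
    have notH: "i \<notin># H"
    proof
      assume "i \<in># H"
      then have "count H i \<ge> 1" by simp
      moreover have "count (holes c) i \<ge> 1" using that(2) by simp
      moreover have "count H i + count (holes c) i \<le> 1" using split[OF that(1), of i] by blast
      ultimately show False by linarith
    qed
    have "c' = c" if c': "c' \<in># C" "i \<in># holes c'" for c'
    proof (rule ccontr)
      assume "c' \<noteq> c"
      then have "c' \<in># C - {#c#}" using c'(1) by (simp add: in_diff_count)
      then have "count (holes c) i + count (holes c') i \<le> 1" using split[OF \<open>c \<in># C\<close>, of i] by blast
      moreover have "count (holes c) i \<ge> 1" "count (holes c') i \<ge> 1"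
        using \<open>i \<in># holes c\<close> c'(2) by simp_all
      ultimately show False by linarith
    qed
    then have "(SOME c. c \<in># C \<and> i \<in># holes c) = c"
      by (intro some_equality) (use that in blast)+
    then show ?thesis using notH by (simp add: r_def)
  qed
  have "\<exists>v. (w, v) \<in> edges t \<and> emb_ctx X G D t s r c v" if c: "c \<in># C" for c
  proof -
    have "emb_ctx X G D t s r c (V c)"
      by (rule emb_ctx_cong_holes[of c "P c" r]) (use VP[OF c] r[OF c] in auto)
    with VP[OF c] show ?thesis by blast
  qed
  moreover have "\<forall>i\<in>#H. r i = w" by (simp add: r_def)
  ultimately have "emb_ctx X G D t s r (Ctx H Y \<Pi> \<Sigma> C) w" using root(1) by simp
  moreover have "emb X G D t s (Ss ! i) (r i)" if "i \<in># holes (Ctx H Y \<Pi> \<Sigma> C)" for i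
  proof (cases "i \<in># H")
    case True
    then show ?thesis using root(2) by (simp add: r_def)
  next
    case False
    then obtain c where c: "c \<in># C" "i \<in># holes c" using \<open>i \<in># holes _\<close> by auto
    then show ?thesis using VP[OF c(1)] r[OF c] by simp
  qed
  ultimately show ?case by blast
qed

text \<open>An embedding need not preserve depths, but a node with a parent goes to a node with a
  parent. The depth conditions of \<open>R5\<close> and \<open>R5dom\<close> are therefore inherited
  by the images of the holes.\<close>

lemma emb_ctx_depth:
  "hole_depth c i d \<Longrightarrow> emb_ctx X G D t s r c w \<Longrightarrow>
    (d = 0 \<longrightarrow> r i = w) \<and> (d \<ge> 1 \<longrightarrow> (\<exists>u. (u, r i) \<in> edges t))"
proof (induction arbitrary: w rule: hole_depth.induct)
  case (2 c C i d H Y \<Gamma> \<Delta>)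
  then obtain v where "(w, v) \<in> edges t" "emb_ctx X G D t s r c v" by auto
  with "2.IH" show ?case by (cases "d = 0") auto
qed auto

text \<open>\<open>u\<close> is the image of the hole: in any extension, whatever embeds at
  \<open>u\<close> can be plugged in. The freedom to change \<open>s\<close> outside
  \<open>V\<close> is for \<open>RAll\<close>, where the eigenvariable receives a new value.\<close>

definition fits1 where
  "fits1 X G D t s c V w u \<longleftrightarrow> (\<forall>X' G' D' t' s' U. le X G D t X' G' D' t' \<longrightarrow> (\<forall>v\<in>V. s v = s' v) \<longrightarrow>
    emb X' G' D' t' s' U u \<longrightarrow> emb X' G' D' t' s' (fill [U] c) w)"

lemma emb_fill1:
  assumes "is_ctx 1 c" "emb X G D t s (fill [U] c) w"
  obtains u where "emb X G D t s U u" "fits1 X G D t s c (fvs (fill [U] c)) w u"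
proof -
  have h: "holes c = {#0#}" using assms(1) by (simp add: is_ctx_1)
  then have "count (holes c) i \<le> 1" for i by simp
  from emb_fillE[OF this assms(2)] obtain r where
    r: "emb_ctx X G D t s r c w" "emb X G D t s U (r 0)" using h by auto
  have "fits1 X G D t s c (fvs (fill [U] c)) w (r 0)"
    unfolding fits1_def
  proof (intro allI impI)
    fix X' G' D' t' s' U'
    assume le: "le X G D t X' G' D' t'" and eq: "\<forall>v\<in>fvs (fill [U] c). s v = s' v"
      and U': "emb X' G' D' t' s' U' (r 0)"
    have "emb_ctx X' G' D' t' s' r c w"
      using emb_ctx_cong_vars[OF _ emb_ctx_le[OF le r(1)]] eq by blast
    then show "emb X' G' D' t' s' (fill [U'] c) w"
      by (rule emb_fillI) (use U' in \<open>simp add: h\<close>)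
  qed
  with r(2) show ?thesis by (rule that)
qed

lemma fits1D:
  assumes "fits1 X G D t s c V w u" "le X G D t X' G' D' t'" "emb X' G' D' t' s U u"
  shows "emb X' G' D' t' s (fill [U] c) w"
  using assms unfolding fits1_def by blast

lemma emb_hole:
  assumes "is_ctx 1 c" "emb X G D t s (fill [U] c) w"
  obtains u where "emb X G D t s U u" "fits1 X G D t s c UNIV w u"
  using assms by (rule emb_fill1) (rule that, auto simp: fits1_def)

definition fits2 where
  "fits2 X G D t s c w u v \<longleftrightarrow> (\<forall>X' G' D' t' U V. le X G D t X' G' D' t' \<longrightarrow>
    emb X' G' D' t' s U u \<longrightarrow> emb X' G' D' t' s V v \<longrightarrow> emb X' G' D' t' s (fill [U, V] c) w)"

lemma emb_fill2:
  assumes "is_ctx 2 c" "emb X G D t s (fill [U, V] c) w"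
  obtains u v where "emb X G D t s U u" "emb X G D t s V v" "fits2 X G D t s c w u v"
    "\<forall>d\<ge>1. hole_depth c 0 d \<longrightarrow> (\<exists>p. (p, u) \<in> edges t)"
    "\<forall>d\<ge>1. hole_depth c 1 d \<longrightarrow> (\<exists>p. (p, v) \<in> edges t)"
proof -
  have h: "holes c = {#0, 1#}" using assms(1) by (simp add: is_ctx_2)
  then have "count (holes c) i \<le> 1" for i by simp
  from emb_fillE[OF this assms(2)] obtain r where
    r: "emb_ctx X G D t s r c w" "emb X G D t s U (r 0)" "emb X G D t s V (r 1)" using h by auto
  have fits: "fits2 X G D t s c w (r 0) (r 1)"
    unfolding fits2_def
  proof (intro allI impI)
    fix X' G' D' t' U' V'
    assume le: "le X G D t X' G' D' t'"
      and UV: "emb X' G' D' t' s U' (r 0)" "emb X' G' D' t' s V' (r 1)"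
    show "emb X' G' D' t' s (fill [U', V'] c) w"
      by (rule emb_fillI[OF emb_ctx_le[OF le r(1)]]) (use UV in \<open>auto simp: h\<close>)
  qed
  show ?thesis
    by (rule that[OF r(2,3) fits]) (use emb_ctx_depth[OF _ r(1)] in blast)+
qed

lemma fits2D:
  assumes "fits2 X G D t s c w u v" "le X G D t X' G' D' t'"
    "emb X' G' D' t' s U u" "emb X' G' D' t' s V v"
  shows "emb X' G' D' t' s (fill [U, V] c) w"
  using assms unfolding fits2_def by blast

end


section \<open>Derivability is preserved along embeddings\<close>

lemma separate_edge: "separate t \<Longrightarrow> (w, v) \<in> edges t \<Longrightarrow> w \<noteq> v"
proof (induction t)
  case (Sh i ss)
  show ?case
  proof (cases "\<exists>s\<in>#ss. (w, v) \<in> edges s")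
    case True
    then obtain s ss' where "ss = add_mset s ss'" "(w, v) \<in> edges s"
      by (meson multi_member_split)
    then show ?thesis using Sh.IH[of s] separate_child(1)[of i s ss'] Sh.prems(1) by simp
  next
    case False
    then obtain s where s: "s \<in># ss" "w = i" "v = root s" using Sh.prems(2) by auto
    then obtain ss' where "ss = add_mset s ss'" by (meson multi_member_split)
    then have "i \<notin># labels s" using separate_child(3)[of i s ss'] Sh.prems(1) by simp
    then show ?thesis using s by auto
  qed
qed

lemma le_extend:
  assumes "\<And>w. set_mset (X w) \<subseteq> set_mset (X' w)" "\<And>w. set_mset (G w) \<subseteq> set_mset (G' w)"
    "\<And>w. set_mset (D w) \<subseteq> set_mset (D' w)"
    "edges t \<subseteq> edges t'" "set_mset (labels t) \<subseteq> set_mset (labels t')"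
  shows "le X G D t X' G' D' t'"
  using assms unfolding le_def by (blast intro: lacc_mem racc_mem)

lemma le_add:
  "le X G D t X (G(u := add_mset A (G u))) D t"
  "le X G D t (X(u := add_mset x (X u))) G D t"
  by (rule le_extend; auto)+

lemma le_replace:
  assumes "\<And>w. set_mset (X w) \<subseteq> set_mset (X' w)" "edges t \<subseteq> edges t'"
    "set_mset (labels t) \<subseteq> set_mset (labels t')"
    and left: "\<And>w A. A \<in># G w \<Longrightarrow> A \<notin># G' w \<Longrightarrow> lacc (edges t') X' G' D' w A"
    and right: "\<And>w A. A \<in># D w \<Longrightarrow> A \<notin># D' w \<Longrightarrow> racc (edges t') X' G' D' w A"
  shows "le X G D t X' G' D' t'"
  using assms unfolding le_def by (meson lacc_mem racc_mem)

lemma separate_grow: "separate t \<Longrightarrow> k \<notin># labels t \<Longrightarrow> separate (grow w k t)"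
  by (auto simp: separate_def labels_grow not_in_iff)

context canonical_names
begin

lemma ok_upd:
  assumes "ok X G D t" "w \<in># labels t" "set_mset x \<subseteq> E" "\<And>A. A \<in># g \<Longrightarrow> fm_ok A"
    "\<And>A. A \<in># d \<Longrightarrow> fm_ok A"
  shows "ok (X(w := x)) (G(w := g)) (D(w := d)) t"
  using assms unfolding ok_def by auto

lemma ok_addX:
  assumes "ok X G D t" "w \<in># labels t" "x \<in> E"
  shows "ok (X(w := add_mset x (X w))) G D t"
  using assms unfolding ok_def by auto

lemma ok_addG:
  assumes "ok X G D t" "w \<in># labels t" "fm_ok A"
  shows "ok X (G(w := add_mset A (G w))) D t"
  using assms unfolding ok_def by auto

lemma ok_in_lang:
  "ok X G D t \<Longrightarrow> canon b s A \<in># G w \<Longrightarrow> in_lang Pr A"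
  "ok X G D t \<Longrightarrow> canon b s A \<in># D w \<Longrightarrow> in_lang Pr A"
  unfolding ok_def fm_ok_def by (metis in_lang_canon)+

lemma ok_grow:
  assumes "ok X G D t" "w \<in># labels t" "k \<notin># labels t"
    "\<And>A. A \<in># d \<Longrightarrow> fm_ok A" "\<And>A. A \<in># d' \<Longrightarrow> fm_ok A"
  shows "ok X G (D(w := d, k := d')) (grow w k t)"
proof -
  have "set_mset (labels (grow w k t)) = insert k (set_mset (labels t))"
    using assms(2) by (auto simp: labels_grow simp flip: count_greater_zero_iff)
  then show ?thesis using assms separate_grow[of t k w] unfolding ok_def by auto
qed

lemma emb_cons:
  "emb X G D t s (Seq (add_mset x Y) \<Pi> \<Sigma> C) w \<longleftrightarrow> s x \<in># X w \<and> emb X G D t s (Seq Y \<Pi> \<Sigma> C) w"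
  "emb X G D t s (Seq Y (add_mset A \<Pi>) \<Sigma> C) w \<longleftrightarrow>
    lacc (edges t) X G D w (canon b s A) \<and> emb X G D t s (Seq Y \<Pi> \<Sigma> C) w"
  "emb X G D t s (Seq Y \<Pi> (add_mset A \<Sigma>) C) w \<longleftrightarrow>
    racc (edges t) X G D w (canon b s A) \<and> emb X G D t s (Seq Y \<Pi> \<Sigma> C) w"
  "emb X G D t s (Seq Y \<Pi> \<Sigma> (add_mset T C)) w \<longleftrightarrow>
    (\<exists>v. (w, v) \<in> edges t \<and> emb X G D t s T v) \<and> emb X G D t s (Seq Y \<Pi> \<Sigma> C) w"
  by auto

lemma emb_cong_vars:
  assumes "emb X G D t s T w" "\<And>v. v \<in> fvs T \<Longrightarrow> s v = s' v"
  shows "emb X G D t s' T w"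
proof -
  have "emb_ctx X G D t s r (konst T) w" for r using assms(1)
  proof (induction T arbitrary: w)
    case (Seq Y \<Pi> \<Sigma> C)
    then show ?case by fastforce
  qed
  moreover have "fvs (fill [] (konst T)) = fvs T" by (simp add: fill_konst)
  ultimately have "emb_ctx X G D t s' r (konst T) w" for r
    using emb_ctx_cong_vars[of "[]" "konst T" s s'] assms(2) by metis
  from emb_fillI[OF this, of "[]"] show ?thesis by (simp add: fill_konst holes_konst)
qed

text \<open>What the induction consumes: inferences and a height bound. Purity and distinct
  eigenvariables are secured afresh by \<open>prov\<close> for the derivation under
  construction.\<close>

primrec drv :: "nat \<Rightarrow> nseq \<Rightarrow> bool" where
  "drv 0 S \<longleftrightarrow> False"
| "drv (Suc n) S \<longleftrightarrow> (\<exists>e Ps. rule L e Ps S \<and> (\<forall>P\<in>set Ps. drv n P))"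

lemma fvs_fill: "holes c = {#0#} \<Longrightarrow> fvs U \<subseteq> fvs (fill [U] c)"
proof (induction c)
  case (Ctx H Y \<Pi> \<Sigma> C)
  show ?case
  proof (cases "0 \<in># H")
    case True
    then show ?thesis by (auto dest!: multi_member_split simp: fvs_plus)
  next
    case False
    moreover have "0 \<in># holes (Ctx H Y \<Pi> \<Sigma> C)" using Ctx.prems by simp
    ultimately obtain c where c: "c \<in># C" "0 \<in># holes c" by auto
    then obtain C' where C: "C = add_mset c C'" by (meson multi_member_split)
    then have "holes c = {#0#}" using Ctx.prems c(2) by (auto simp: union_is_single)
    then have "fvs U \<subseteq> fvs (fill [U] c)" using Ctx.IH c(1) by blast
    then show ?thesis using C by (auto simp: fvs_plus) (auto simp: fvs_def)
  qed
qed

lemma correct_drv: "correct L d \<Longrightarrow> height d \<le> n \<Longrightarrow> drv n (concl d)"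
proof (induction n arbitrary: d)
  case 0
  then show ?case by (cases d) simp
next
  case (Suc n)
  obtain S e ds where d: "d = Infer S e ds" by (cases d)
  have "height d' \<le> n" if "d' \<in> set ds" for d'
    using Suc.prems(2) that by (simp add: d)
  then have "drv n d'" if "d' \<in> set (map concl ds)" for d'
    using that Suc.IH Suc.prems(1) by (auto simp: d)
  moreover have "rule L e (map concl ds) S" using Suc.prems(1) by (simp add: d)
  ultimately show ?case by (auto simp only: d deriv.sel drv.simps)
qed

text \<open>The labelled target and \<open>s\<close> both vary in the induction: a premiss of
  \<open>T\<close> is embedded in a premiss of the target or in the target itself, and for
  \<open>RAll\<close> the eigenvariable gets a new value under \<open>s\<close>.\<close>

lemma absorb:
  assumes "drv n T" "range s \<subseteq> E" "ok X G D t" "emb X G D t s T w"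
  shows "prov n (den X G D t)"
  using assms
proof (induction n arbitrary: T s X G D t w)
  case (Suc n)
  from Suc.prems(1) obtain e Ps where rule: "rule L e Ps T" and Ps: "\<And>P. P \<in> set Ps \<Longrightarrow> drv n P"
    by auto
  \<comment> \<open>\<open>IH\<close> is for the cases in which an inference is applied to the
    target, \<open>IH'\<close> for those in which the premiss is already embedded in the target and
    the inference is dropped. Both speak of the first premiss; only \<open>LImp\<close> has a second
    one.\<close>
  have IH: "prov n (den X G D t)"
    if "Ps \<noteq> []" "range s \<subseteq> E" "ok X G D t" "emb X G D t s (hd Ps) w" for s X G D t w
    using Suc.IH[OF Ps that(2-4)] that(1) by simp
  have IH': "prov (Suc n) (den X G D t)"
    if "Ps \<noteq> []" "range s \<subseteq> E" "emb X G D t s (hd Ps) w" for s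
    using IH[OF that(1,2) Suc.prems(3) that(3)] prov_mono by simp
  note range = Suc.prems(2) and ok = Suc.prems(3) and emb = Suc.prems(4)
  have sE: "s x \<in> E" for x using range by auto
  have Gl: "canon b s A \<in># G u \<Longrightarrow> in_lang Pr A" "canon b s A \<in># D u \<Longrightarrow> in_lang Pr A" for A u
    using ok_in_lang ok by blast+
  have G_ok: "A \<in># G u \<Longrightarrow> fm_ok A" and D_ok: "A \<in># D u \<Longrightarrow> fm_ok A" and X_ok: "x \<in># X u \<Longrightarrow> x \<in> E"
    for A u x using ok unfolding ok_def by blast+
  note c_ok = fm_ok_canon[OF range]
  have le_refl: "le X G D t X G D t" by (rule le_extend) auto
  from rule show ?case
  proof cases
    case (Init c P Y \<Gamma> \<Delta>)
    from Init(4) emb[unfolded Init] obtain u where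
      "emb X G D t s (Seq Y (add_mset P \<Gamma>) (add_mset P \<Delta>) {#}) u" by (rule emb_hole)
    then have "canon b s P \<in># G u" "canon b s P \<in># D u"
      using Init(5) by (simp_all add: acc_atomic)
    then show ?thesis by (intro prov_Init[OF ok, of "canon b s P"]) (use Init(5) in auto)
  next
    case (LBot c Y \<Gamma> \<Delta>)
    from LBot(4) emb[unfolded LBot] obtain u where
      "emb X G D t s (Seq Y (add_mset Bot \<Gamma>) \<Delta> {#}) u" by (rule emb_hole)
    then show ?thesis by (intro prov_LBot[OF ok]) (auto simp: lacc_other)
  next
    case (LImp c Y \<Gamma> A \<Delta> B)
    from LImp(4) emb[unfolded LImp] obtain u where
      u: "emb X G D t s (Seq Y (add_mset (Imp A B) \<Gamma>) \<Delta> {#}) u" and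
      fits: "fits1 X G D t s c UNIV w u"
      by (rule emb_hole)
    note k = fits1D[OF fits]
    have ul: "u \<in># labels t" using emb_label[OF u] .
    have base: "emb X G D t s (Seq Y \<Gamma> \<Delta> {#}) u" using u by (simp only: emb_cons)
    have "lacc (edges t) X G D u (Imp (canon b s A) (canon b s B))" using u by simp
    then consider (mem) "Imp (canon b s A) (canon b s B) \<in># G u"
      | (A) "racc (edges t) X G D u (canon b s A)" | (B) "lacc (edges t) X G D u (canon b s B)"
      by (rule lacc_ImpE) auto
    then show ?thesis
    proof cases
      case mem
      then obtain \<Gamma>' where \<Gamma>': "G u = add_mset (Imp (canon b s A) (canon b s B)) \<Gamma>'"
        by (meson multi_member_split)
      have lang: "in_lang Pr A" "in_lang Pr B" using Gl(1)[of "Imp A B" u] mem by auto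
      have \<Gamma>'_ok: "fm_ok F" if "F \<in># \<Gamma>'" for F using G_ok[of F u] \<Gamma>' that by simp
      show ?thesis
      proof (rule prov_LImp[of _ _ _ _ u, OF ok \<Gamma>'])
        let ?G = "G(u := \<Gamma>')" and ?D = "D(u := add_mset (canon b s A) (D u))"
        \<comment> \<open>Other formulas of \<open>T\<close> may be mapped to the occurrence of the
          implication that is removed here. They remain accounted for through the new
          \<open>canon b s A\<close> on the right, which takes the place of an appeal to
          invertibility.\<close>
        have "lacc (edges t) X ?G ?D u (Imp (canon b s A) (canon b s B))"
          by (rule lacc_Imp1, rule racc_mem) simp
        then have le: "le X G D t X ?G ?D t"
          by (intro le_replace) (auto simp: \<Gamma>' split: if_splits)
        have ok': "ok X ?G ?D t"
          using ok_upd[OF ok ul, of "X u" \<Gamma>' "add_mset (canon b s A) (D u)"] X_ok D_ok \<Gamma>'_ok c_ok[OF lang(1)]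
          by fastforce
        show "prov n (den X ?G ?D t)"
        proof (rule Suc.IH[OF Ps range ok'])
          show "emb X ?G ?D t s (fill [Seq Y \<Gamma> (add_mset A \<Delta>) {#}] c) w"
            by (rule k[OF le]) (use emb_le[OF le base] in \<open>simp del: emb.simps add: emb_cons racc_mem\<close>)
        qed (simp add: LImp)
        let ?G = "G(u := add_mset (canon b s B) \<Gamma>')"
        have "lacc (edges t) X ?G D u (Imp (canon b s A) (canon b s B))"
          by (rule lacc_Imp2, rule lacc_mem) simp
        then have le: "le X G D t X ?G D t"
          by (intro le_replace) (auto simp: \<Gamma>' split: if_splits)
        have ok': "ok X ?G D t"
          using ok_upd[OF ok ul, of "X u" "add_mset (canon b s B) \<Gamma>'" "D u"] X_ok D_ok \<Gamma>'_ok c_ok[OF lang(2)]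
          by fastforce
        show "prov n (den X ?G D t)"
        proof (rule Suc.IH[OF Ps range ok'])
          show "emb X ?G D t s (fill [Seq Y (add_mset B \<Gamma>) \<Delta> {#}] c) w"
            by (rule k[OF le]) (use emb_le[OF le base] in \<open>simp del: emb.simps add: emb_cons lacc_mem\<close>)
        qed (simp add: LImp)
      qed
    next
      case A
      have "emb X G D t s (fill [Seq Y \<Gamma> (add_mset A \<Delta>) {#}] c) w"
        by (rule k[OF le_refl]) (use base A in \<open>simp del: emb.simps add: emb_cons\<close>)
      then show ?thesis by (intro IH'[OF _ range]) (simp_all add: LImp)
    next
      case B
      have "emb X G D t s (fill [Seq Y (add_mset B \<Gamma>) \<Delta> {#}] c) w"
        by (rule k[OF le_refl]) (use base B in \<open>simp del: emb.simps add: emb_cons\<close>)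
      then have "prov n (den X G D t)" by (intro Suc.IH[OF Ps range ok]) (auto simp: LImp)
      then show ?thesis by (rule prov_mono) simp
    qed
  next
    case (RImp c Y A \<Gamma> B \<Delta>)
    from RImp(4) emb[unfolded RImp] obtain u where
      u: "emb X G D t s (Seq Y \<Gamma> (add_mset (Imp A B) \<Delta>) {#}) u" and
      fits: "fits1 X G D t s c UNIV w u"
      by (rule emb_hole)
    note k = fits1D[OF fits]
    have ul: "u \<in># labels t" using emb_label[OF u] .
    have base: "emb X G D t s (Seq Y \<Gamma> \<Delta> {#}) u" using u by (simp only: emb_cons)
    have "racc (edges t) X G D u (Imp (canon b s A) (canon b s B))" using u by simp
    then consider (mem) "Imp (canon b s A) (canon b s B) \<in># D u"
      | (AB) "lacc (edges t) X G D u (canon b s A)" "racc (edges t) X G D u (canon b s B)"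
      by (rule racc_ImpE) auto
    then show ?thesis
    proof cases
      case mem
      then obtain \<Delta>' where \<Delta>': "D u = add_mset (Imp (canon b s A) (canon b s B)) \<Delta>'"
        by (meson multi_member_split)
      have lang: "in_lang Pr A" "in_lang Pr B" using Gl(2)[of "Imp A B" u] mem by auto
      have \<Delta>'_ok: "fm_ok F" if "F \<in># \<Delta>'" for F using D_ok[of F u] \<Delta>' that by simp
      show ?thesis
      proof (rule prov_RImp[of _ _ _ _ u, OF ok \<Delta>'])
        let ?G = "G(u := add_mset (canon b s A) (G u))" and ?D = "D(u := add_mset (canon b s B) \<Delta>')"
        have "racc (edges t) X ?G ?D u (Imp (canon b s A) (canon b s B))"
          by (rule racc_Imp; rule lacc_mem racc_mem) simp_all
        then have le: "le X G D t X ?G ?D t"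
          by (intro le_replace) (auto simp: \<Delta>' split: if_splits)
        have ok': "ok X ?G ?D t"
          using ok_upd[OF ok ul, of "X u" "add_mset (canon b s A) (G u)" "add_mset (canon b s B) \<Delta>'"]
            X_ok G_ok \<Delta>'_ok c_ok[OF lang(1)] c_ok[OF lang(2)]
          by fastforce
        show "prov n (den X ?G ?D t)"
        proof (rule Suc.IH[OF Ps range ok'])
          show "emb X ?G ?D t s (fill [Seq Y (add_mset A \<Gamma>) (add_mset B \<Delta>) {#}] c) w"
            by (rule k[OF le])
              (use emb_le[OF le base] in \<open>simp del: emb.simps add: emb_cons racc_mem lacc_mem\<close>)
        qed (simp add: RImp)
      qed
    next
      case AB
      have "emb X G D t s (fill [Seq Y (add_mset A \<Gamma>) (add_mset B \<Delta>) {#}] c) w"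
        by (rule k[OF le_refl]) (use base AB in \<open>simp del: emb.simps add: emb_cons\<close>)
      then show ?thesis by (intro IH'[OF _ range]) (simp_all add: RImp)
    qed
  next
    case (LAll c z Y A x \<Gamma> \<Delta>)
    from LAll(4) emb[unfolded LAll] obtain u where
      u: "emb X G D t s (Seq (add_mset z Y) (add_mset (Forall x A) \<Gamma>) \<Delta> {#}) u" and
      fits: "fits1 X G D t s c UNIV w u"
      by (rule emb_hole)
    note k = fits1D[OF fits]
    have ul: "u \<in># labels t" using emb_label[OF u] .
    have F: "canon b s (Forall x A) \<in># G u" and z: "s z \<in># X u" using u by (simp_all add: lacc_other)
    let ?A = "canon b (s(x := s z)) A"
    let ?G = "G(u := add_mset ?A (G u))"
    have lang: "in_lang Pr A" using Gl(1)[OF F] by simp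
    have A_ok: "fm_ok ?A" by (rule fm_ok_canon) (use range lang in auto)
    show ?thesis
    proof (rule prov_LAll[OF ok F[unfolded canon.simps] z], unfold canon_subst_bound[OF range sE])
      show "prov n (den X ?G D t)"
      proof (rule IH[OF _ range ok_addG[OF ok ul A_ok]])
        show "emb X ?G D t s (hd Ps) w" unfolding LAll list.sel
          by (rule k[OF le_add(1)])
            (use emb_le[OF le_add(1) u, of u ?A] in \<open>simp del: emb.simps add: emb_cons lacc_mem canon_subst\<close>)
      qed (simp add: LAll)
    qed
  next
    case (RAll c Y \<Gamma> x A \<Delta> y)
    have emb': "emb X G D t s (fill [Seq Y \<Gamma> (add_mset (Forall x A) \<Delta>) {#}] c) w"
      using emb RAll(4) by simp
    from RAll(3) emb' obtain u where
      u: "emb X G D t s (Seq Y \<Gamma> (add_mset (Forall x A) \<Delta>) {#}) u" and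
      fits: "fits1 X G D t s c (fvs T) w u"
      unfolding RAll(4) by (rule emb_fill1)
    have y: "y \<notin> fvs T" using RAll(5) by simp
    \<comment> \<open>\<open>y\<close> does not occur in \<open>T\<close>, so the context stays
      embedded whatever value \<open>y\<close> is given.\<close>
    have k: "emb X' G' D' t' (s(y := z)) (fill [U'] c) w"
      if "le X G D t X' G' D' t'" "emb X' G' D' t' (s(y := z)) U' u" for X' G' D' t' U' z
      using fits that y unfolding fits1_def by (metis fun_upd_other)
    have fvU: "fvs (Seq Y \<Gamma> (add_mset (Forall x A) \<Delta>) {#}) \<subseteq> fvs T"
      using RAll(3,4) fvs_fill[of c "Seq Y \<Gamma> (add_mset (Forall x A) \<Delta>) {#}"] by (simp add: is_ctx_1)
    have ul: "u \<in># labels t" using emb_label[OF u] .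
    have base: "emb X G D t (s(y := z)) (Seq Y \<Gamma> \<Delta> {#}) u" for z
    proof (rule emb_cong_vars)
      show "emb X G D t s (Seq Y \<Gamma> \<Delta> {#}) u" using u by (simp only: emb_cons)
    qed (use y fvU in \<open>auto simp: fvs_def\<close>)
    have Ay: "canon b (s(y := z)) (subst A y x) = canon b (s(x := z)) A" for z
      unfolding canon_subst by (rule canon_cong) (use y fvU in \<open>auto simp: fvs_def\<close>)
    have "racc (edges t) X G D u (Forall (b (qdepth A)) (canon b (s(x := b (qdepth A))) A))"
      using u by simp
    then consider (mem) "Forall (b (qdepth A)) (canon b (s(x := b (qdepth A))) A) \<in># D u"
      | (inst) z where "z \<in># X u"
        "racc (edges t) X G D u (subst (canon b (s(x := b (qdepth A))) A) z (b (qdepth A)))"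
      by (rule racc_ForallE) auto
    then show ?thesis
    proof cases
      case mem
      then obtain \<Delta>' where \<Delta>': "D u = add_mset (Forall (b (qdepth A)) (canon b (s(x := b (qdepth A))) A)) \<Delta>'"
        by (meson multi_member_split)
      have lang: "in_lang Pr A" using Gl(2)[of "Forall x A" u] mem by auto
      have \<Delta>'_ok: "fm_ok F" if "F \<in># \<Delta>'" for F using D_ok[of F u] \<Delta>' that by simp
      show ?thesis
      proof (rule prov_RAll[of _ _ _ _ u, OF ok \<Delta>'])
        fix z assume z: "z \<in> E"
        let ?A = "canon b (s(x := z)) A"
        let ?X = "X(u := add_mset z (X u))" and ?D = "D(u := add_mset ?A \<Delta>')"
        have "racc (edges t) ?X G ?D u (Forall (b (qdepth A)) (canon b (s(x := b (qdepth A))) A))"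
          by (rule racc_Forall[of z]) (auto simp: canon_subst_bound[OF range z] intro: racc_mem)
        then have le: "le X G D t ?X G ?D t"
          by (intro le_replace) (auto simp: \<Delta>' split: if_splits)
        have A_ok: "fm_ok ?A" by (rule fm_ok_canon) (use range lang z in auto)
        have ok': "ok ?X G ?D t"
          using ok_upd[OF ok ul, of "add_mset z (X u)" "G u" "add_mset ?A \<Delta>'"]
            X_ok G_ok \<Delta>'_ok z A_ok by fastforce
        have "prov n (den ?X G ?D t)"
        proof (rule IH[OF _ _ ok'])
          show "range (s(y := z)) \<subseteq> E" using range z by auto
          show "emb ?X G ?D t (s(y := z)) (hd Ps) w" unfolding RAll list.sel
            by (rule k[OF le])
              (use emb_le[OF le base[of z]] in \<open>simp del: emb.simps add: emb_cons Ay racc_mem\<close>)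
        qed (simp add: RAll)
        then show "prov n (den ?X G (D(u := add_mset (subst (canon b (s(x := b (qdepth A))) A) z
            (b (qdepth A))) \<Delta>')) t)"
          unfolding canon_subst_bound[OF range z] .
      qed
    next
      case (inst z)
      \<comment> \<open>The quantifier is already accounted for at \<open>u\<close> by its instance
        with \<open>z\<close>. Sending the eigenvariable to this \<open>z\<close> embeds the premiss
        in the target as it stands.\<close>
      have z: "z \<in> E" by (rule X_ok[OF inst(1)])
      note A = inst(2)[unfolded canon_subst_bound[OF range z]]
      show ?thesis
      proof (rule IH')
        show "range (s(y := z)) \<subseteq> E" using range z by auto
        show "emb X G D t (s(y := z)) (hd Ps) w" unfolding RAll list.sel
          by (rule k[OF le_refl]) (use base[of z] A inst(1) in \<open>simp del: emb.simps add: emb_cons Ay\<close>)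
      qed (simp add: RAll)
    qed
  next
    case (LBox c Y A \<Gamma> \<Delta> Z \<Pi> \<Sigma> C)
    from LBox(4) emb[unfolded LBox] obtain u where
      u: "emb X G D t s (Seq Y (add_mset (Box A) \<Gamma>) \<Delta> {#Seq Z \<Pi> \<Sigma> C#}) u" and
      fits: "fits1 X G D t s c UNIV w u"
      by (rule emb_hole)
    note k = fits1D[OF fits]
    from u obtain v where v: "(u, v) \<in> edges t" "emb X G D t s (Seq Z \<Pi> \<Sigma> C) v"
      unfolding emb_cons by blast
    have base: "emb X G D t s (Seq Y (add_mset (Box A) \<Gamma>) \<Delta> {#}) u" using u unfolding emb_cons by blast
    have F: "canon b s (Box A) \<in># G u" using u by (simp add: lacc_other)
    have A_ok: "fm_ok (canon b s A)" using c_ok Gl(1)[OF F] by simp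
    have "v \<in># labels t" using edges_labels[OF v(1)] by simp
    let ?G = "G(v := add_mset (canon b s A) (G v))"
    show ?thesis
    proof (rule prov_LBox[OF ok v(1) F[unfolded canon.simps]], rule IH[OF _ range ok_addG[OF ok _ A_ok]])
      have "emb X ?G D t s (Seq Z (add_mset A \<Pi>) \<Sigma> C) v"
        using emb_le[OF le_add(1) v(2), of v "canon b s A"]
        by (simp del: emb.simps add: emb_cons lacc_mem)
      then show "emb X ?G D t s (hd Ps) w" unfolding LBox list.sel
        by (intro k[OF le_add(1)])
          (use emb_le[OF le_add(1) base, of v "canon b s A"] v(1) in \<open>unfold emb_cons, blast\<close>)
    qed (use LBox \<open>v \<in># labels t\<close> in auto)
  next
    case (RBox c Y \<Gamma> \<Delta> A)
    from RBox(4) emb[unfolded RBox] obtain u where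
      u: "emb X G D t s (Seq Y \<Gamma> (add_mset (Box A) \<Delta>) {#}) u" and
      fits: "fits1 X G D t s c UNIV w u"
      by (rule emb_hole)
    note k = fits1D[OF fits]
    have ul: "u \<in># labels t" using emb_label[OF u] .
    have base: "emb X G D t s (Seq Y \<Gamma> \<Delta> {#}) u" using u by (simp only: emb_cons)
    have "racc (edges t) X G D u (Box (canon b s A))" using u by simp
    then consider (mem) "Box (canon b s A) \<in># D u"
      | (child) v where "(u, v) \<in> edges t" "racc (edges t) X G D v (canon b s A)"
      by (rule racc_BoxE) auto
    then show ?thesis
    proof cases
      case mem
      then obtain \<Delta>' where \<Delta>': "D u = add_mset (Box (canon b s A)) \<Delta>'"
        by (meson multi_member_split)
      obtain m where m: "m \<notin># labels t"
        using ex_new_if_finite[OF infinite_UNIV_nat finite_set_mset] by blast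
      then have um: "u \<noteq> m" and Dm: "D m = {#}" using ul ok by (auto simp: ok_def)
      have lang: "in_lang Pr A" using Gl(2)[of "Box A" u] mem by auto
      have \<Delta>'_ok: "fm_ok F" if "F \<in># \<Delta>'" for F using D_ok[of F u] \<Delta>' that by simp
      let ?D = "D(u := \<Delta>', m := {#canon b s A#})" and ?t = "grow u m t"
      have edge: "(u, m) \<in> edges ?t" using ul by (simp add: edges_grow)
      have "racc (edges ?t) X G ?D m (canon b s A)" by (simp add: racc_mem)
      with edge have "racc (edges ?t) X G ?D u (Box (canon b s A))" by (rule racc_Box)
      then have le: "le X G D t X G ?D ?t"
        by (intro le_replace) (auto simp: \<Delta>' Dm edges_grow labels_grow split: if_splits)
      have ok': "ok X G ?D ?t"
        by (rule ok_grow[OF ok ul m]) (use \<Delta>'_ok c_ok[OF lang] in auto)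
      show ?thesis
      proof (rule prov_RBox[of _ _ _ _ u, OF ok \<Delta>' m], rule IH[OF _ range ok'])
        have "emb X G ?D ?t s (Seq {#} {#} {#A#} {#}) m"
          using edges_labels[OF edge] by (simp add: racc_mem)
        then show "emb X G ?D ?t s (hd Ps) w" unfolding RBox list.sel
          by (intro k[OF le]) (use emb_le[OF le base] edge in \<open>unfold emb_cons, blast\<close>)
      qed (simp add: RBox)
    next
      case (child v)
      \<comment> \<open>The leaf created in the premiss is mapped to the existing child
        \<open>v\<close>; here nodes get merged.\<close>
      have "emb X G D t s (Seq {#} {#} {#A#} {#}) v"
        using edges_labels[OF child(1)] child(2) by simp
      then have "emb X G D t s (hd Ps) w" unfolding RBox list.sel
        by (intro k[OF le_refl]) (use base child(1) in \<open>unfold emb_cons, blast\<close>)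
      then show ?thesis by (intro IH'[OF _ range]) (simp_all add: RBox)
    qed
  next
    case (Ref c Y x \<Gamma> \<Delta>)
    from Ref(4) emb[unfolded Ref] obtain u where
      u: "emb X G D t s (Seq Y \<Gamma> \<Delta> {#}) u" and
      fits: "fits1 X G D t s c UNIV w u"
      by (rule emb_hole)
    note k = fits1D[OF fits]
    have ul: "u \<in># labels t" using emb_label[OF u] .
    have A_ok: "fm_ok (Eq (s x) (s x))" using c_ok[of "Eq x x"] by simp
    show ?thesis
    proof (rule prov_Ref[OF ok ul, of _ "s x"], rule IH[OF _ range])
      show "ok X (G(u := add_mset (Eq (s x) (s x)) (G u))) D t"
        using ok_addG[OF ok ul A_ok] by simp
      show "emb X (G(u := add_mset (Eq (s x) (s x)) (G u))) D t s (hd Ps) w"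
        unfolding Ref list.sel
        by (rule k[OF le_add(1)])
          (use emb_le[OF le_add(1) u] in \<open>simp del: emb.simps add: emb_cons lacc_mem\<close>)
    qed (simp add: Ref)
  next
    case (Repl c P Y y z x \<Gamma> \<Delta>)
    from Repl(4) emb[unfolded Repl] obtain u where
      u: "emb X G D t s (Seq Y (add_mset (Eq x y) (add_mset (subst P x z) \<Gamma>)) \<Delta> {#}) u" and
      fits: "fits1 X G D t s c UNIV w u"
      by (rule emb_hole)
    note k = fits1D[OF fits]
    have ul: "u \<in># labels t" using emb_label[OF u] .
    \<comment> \<open>\<open>b 0\<close> is not a value of \<open>s\<close>, so in \<open>P'\<close>
      it marks exactly the positions of \<open>z\<close>. The two instances in \<open>Repl\<close>
      thus become instances of a single atomic formula of the target.\<close>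
    define P' where "P' = canon b (s(z := b 0)) P"
    have subst: "subst P' v (b 0) = canon b (s(z := v)) P" for v
      using Repl(5) sE by (cases P) (auto simp: P'_def subst_def)
    have new: "canon b s (subst P v z) = subst P' (s v) (b 0)" for v
      by (simp add: subst canon_subst)
    have P': "atomic P'" using Repl(5) by (simp add: P'_def)
    have at: "atomic (subst P' v (b 0))" for v using Repl(5) by (simp add: subst)
    have Exy: "Eq (s x) (s y) \<in># G u" and Px: "subst P' (s x) (b 0) \<in># G u"
      using u by (simp_all add: lacc_other new acc_atomic at)
    have lang: "in_lang Pr P"
      using Gl(1)[of "subst P x z" u] Px by (simp add: new)
    have le_goal: "emb X' G' D' t s (hd Ps) w"
      if "le X G D t X' G' D' t" "subst P' (s y) (b 0) \<in># G' u" for X' G' D'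
      unfolding Repl list.sel
      by (rule k[OF that(1)])
        (use emb_le[OF that(1) u] that(2) in \<open>simp del: emb.simps add: emb_cons lacc_mem new\<close>)
    show ?thesis
    proof (cases "subst P' (s x) (b 0) = Eq (s x) (s y)")
      case False
      let ?A = "canon b s (subst P y z)"
      have A_ok: "fm_ok ?A" using c_ok lang by simp
      show ?thesis
      proof (rule prov_Repl[OF ok Exy Px False P'], unfold new[symmetric], rule IH[OF _ range ok_addG[OF ok ul A_ok]])
        show "emb X (G(u := add_mset ?A (G u))) D t s (hd Ps) w"
          by (rule le_goal[OF le_add(1)]) (simp add: new)
      qed (simp add: Repl)
    next
      case True
      \<comment> \<open>\<open>P'\<close> must be an equation. If its first argument is the mark
        \<open>b 0\<close>, replacement gives \<open>Eq (s y) (s y)\<close>; otherwise it gives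
        \<open>Eq (s x) (s y)\<close>, whether or not the second argument is marked.\<close>
      consider "subst P' (s y) (b 0) = Eq (s x) (s y)" | "subst P' (s y) (b 0) = Eq (s y) (s y)"
        using True Repl(5) by (cases P) (auto simp: subst split: if_splits)
      then show ?thesis
      proof cases
        case 1
        then show ?thesis
          by (intro IH'[OF _ range] le_goal[OF le_refl]) (use Exy Repl in simp_all)
      next
        case 2
        have A_ok: "fm_ok (Eq (s y) (s y))" using c_ok[of "Eq y y"] by simp
        show ?thesis
        proof (rule prov_Ref[OF ok ul, of _ "s y"], rule IH[OF _ range])
          show "ok X (G(u := add_mset (Eq (s y) (s y)) (G u))) D t"
            using ok_addG[OF ok ul A_ok] by simp
          show "emb X (G(u := add_mset (Eq (s y) (s y)) (G u))) D t s (hd Ps) w"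
            by (rule le_goal[OF le_add(1)]) (simp add: 2)
        qed (simp add: Repl)
      qed
    qed
  next
    case (ReplX c x y Y \<Gamma> \<Delta>)
    from ReplX(4) emb[unfolded ReplX] obtain u where
      u: "emb X G D t s (Seq (add_mset x Y) (add_mset (Eq x y) \<Gamma>) \<Delta> {#}) u" and
      fits: "fits1 X G D t s c UNIV w u"
      by (rule emb_hole)
    note k = fits1D[OF fits]
    have ul: "u \<in># labels t" using emb_label[OF u] .
    have Exy: "Eq (s x) (s y) \<in># G u" and x: "s x \<in># X u" using u by (simp_all add: lacc_other)
    show ?thesis
    proof (rule prov_ReplX[OF ok Exy x], rule IH[OF _ range ok_addX[OF ok ul sE]])
      show "emb (X(u := add_mset (s y) (X u))) G D t s (hd Ps) w" unfolding ReplX list.sel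
        by (rule k[OF le_add(2)])
          (use emb_le[OF le_add(2) u, of u "s y"] in \<open>simp del: emb.simps add: emb_cons\<close>)
    qed (simp add: ReplX)
  next
    case (Rig c Y x y \<Gamma> \<Delta> Z \<Pi> \<Sigma>)
    from Rig(4) emb[unfolded Rig] obtain u v where
      uv: "emb X G D t s (Seq Y (add_mset (Eq x y) \<Gamma>) \<Delta> {#}) u" "emb X G D t s (Seq Z \<Pi> \<Sigma> {#}) v" and
      fits: "fits2 X G D t s c w u v" and
      d: "\<forall>d\<ge>1. hole_depth c 0 d \<longrightarrow> (\<exists>p. (p, u) \<in> edges t)"
        "\<forall>d\<ge>1. hole_depth c 1 d \<longrightarrow> (\<exists>p. (p, v) \<in> edges t)"
      by (rule emb_fill2)
    note k = fits2D[OF fits]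
    have vl: "v \<in># labels t" using emb_label[OF uv(2)] .
    have Exy: "Eq (s x) (s y) \<in># G u" using uv(1) by (simp_all add: lacc_other)
    have A_ok: "fm_ok (Eq (s x) (s y))" using c_ok[of "Eq x y"] by simp
    show ?thesis
    proof (rule prov_Rig[OF ok Exy vl], rule IH[OF _ range ok_addG[OF ok vl A_ok]])
      let ?G = "G(v := add_mset (Eq (s x) (s y)) (G v))"
      show "emb X ?G D t s (hd Ps) w" unfolding Rig list.sel
        by (rule k[OF le_add(1) emb_le[OF le_add(1) uv(1)]])
          (use emb_le[OF le_add(1) uv(2), of v "Eq (s x) (s y)"] in
            \<open>simp del: emb.simps add: emb_cons lacc_mem\<close>)
    qed (simp add: Rig)
  next
    case (RD c Y \<Gamma> \<Delta>)
    from RD(5) emb[unfolded RD] obtain u where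
      u: "emb X G D t s (Seq Y \<Gamma> \<Delta> {#}) u" and
      fits: "fits1 X G D t s c UNIV w u"
      by (rule emb_hole)
    note k = fits1D[OF fits]
    have ul: "u \<in># labels t" using emb_label[OF u] .
    obtain m where m: "m \<notin># labels t"
      using ex_new_if_finite[OF infinite_UNIV_nat finite_set_mset] by blast
    then have Dm: "D m = {#}" using ok by (simp add: ok_def)
    let ?t = "grow u m t"
    have edge: "(u, m) \<in> edges ?t" using ul by (simp add: edges_grow)
    have le: "le X G D t X G D ?t" by (rule le_extend) (auto simp: edges_grow labels_grow)
    have "ok X G (D(u := D u, m := {#})) ?t" by (rule ok_grow[OF ok ul m]) (use D_ok in auto)
    moreover have "D(u := D u, m := {#}) = D" using Dm by auto
    ultimately have ok': "ok X G D ?t" by simp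
    show ?thesis
    proof (rule prov_RD[OF ok RD(4) ul m], rule IH[OF _ range ok'])
      have "emb X G D ?t s (Seq {#} {#} {#} {#}) m" using edges_labels[OF edge] by simp
      then show "emb X G D ?t s (hd Ps) w" unfolding RD list.sel
        by (intro k[OF le]) (use emb_le[OF le u] edge in \<open>unfold emb_cons, blast\<close>)
    qed (simp add: RD)
  next
    case (RT c Y A \<Gamma> \<Delta>)
    from RT(5) emb[unfolded RT] obtain u where
      u: "emb X G D t s (Seq Y (add_mset (Box A) \<Gamma>) \<Delta> {#}) u" and
      fits: "fits1 X G D t s c UNIV w u"
      by (rule emb_hole)
    note k = fits1D[OF fits]
    have ul: "u \<in># labels t" using emb_label[OF u] .
    have F: "canon b s (Box A) \<in># G u" using u by (simp add: lacc_other)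
    have A_ok: "fm_ok (canon b s A)" using c_ok Gl(1)[OF F] by simp
    show ?thesis
    proof (rule prov_RT[OF ok RT(4) F[unfolded canon.simps]], rule IH[OF _ range ok_addG[OF ok ul A_ok]])
      show "emb X (G(u := add_mset (canon b s A) (G u))) D t s (hd Ps) w" unfolding RT list.sel
        by (rule k[OF le_add(1)])
          (use emb_le[OF le_add(1) u, of u "canon b s A"] in \<open>simp del: emb.simps add: emb_cons lacc_mem\<close>)
    qed (simp add: RT)
  next
    case (RB c Y A \<Gamma> \<Delta> Z \<Pi> \<Sigma> C)
    from RB(5) emb[unfolded RB] obtain u where
      u: "emb X G D t s (Seq Y \<Gamma> \<Delta> {#Seq Z (add_mset (Box A) \<Pi>) \<Sigma> C#}) u" and
      fits: "fits1 X G D t s c UNIV w u"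
      by (rule emb_hole)
    note k = fits1D[OF fits]
    have ul: "u \<in># labels t" using emb_label[OF u] .
    from u obtain v where v: "(u, v) \<in> edges t" "emb X G D t s (Seq Z (add_mset (Box A) \<Pi>) \<Sigma> C) v"
      unfolding emb_cons by blast
    have "u \<noteq> v" using separate_edge[OF _ v(1)] ok by (simp add: ok_def)
    have F: "canon b s (Box A) \<in># G v" using v(2) by (simp add: lacc_other)
    have A_ok: "fm_ok (canon b s A)" using c_ok Gl(1)[OF F] by simp
    let ?G = "G(u := add_mset (canon b s A) (G u))"
    show ?thesis
    proof (rule prov_RB[OF ok RB(4) v(1) F[unfolded canon.simps] _ \<open>u \<noteq> v\<close>],
        rule IH[OF _ range ok_addG[OF ok ul A_ok]])
      have "lacc (edges t) X ?G D u (canon b s A)" by (simp add: lacc_mem)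
      then show "emb X ?G D t s (hd Ps) w" unfolding RB list.sel
        by (intro k[OF le_add(1)])
          (use emb_le[OF le_add(1) u, of u "canon b s A"] in \<open>unfold emb_cons, blast\<close>)
    qed (simp add: RB)
  next
    case (R4 c Y A \<Gamma> \<Delta> Z \<Pi> \<Sigma> C)
    from R4(5) emb[unfolded R4] obtain u where
      u: "emb X G D t s (Seq Y (add_mset (Box A) \<Gamma>) \<Delta> {#Seq Z \<Pi> \<Sigma> C#}) u" and
      fits: "fits1 X G D t s c UNIV w u"
      by (rule emb_hole)
    note k = fits1D[OF fits]
    from u obtain v where v: "(u, v) \<in> edges t" "emb X G D t s (Seq Z \<Pi> \<Sigma> C) v"
      unfolding emb_cons by blast
    have base: "emb X G D t s (Seq Y (add_mset (Box A) \<Gamma>) \<Delta> {#}) u" using u unfolding emb_cons by blast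
    have F: "canon b s (Box A) \<in># G u" using u by (simp add: lacc_other)
    have A_ok: "fm_ok (Box (canon b s A))" using G_ok[OF F] by simp
    have "v \<in># labels t" using edges_labels[OF v(1)] by simp
    let ?G = "G(v := add_mset (Box (canon b s A)) (G v))"
    show ?thesis
    proof (rule prov_R4[OF ok R4(4) v(1) F[unfolded canon.simps]], rule IH[OF _ range ok_addG[OF ok _ A_ok]])
      have "emb X ?G D t s (Seq Z (add_mset (Box A) \<Pi>) \<Sigma> C) v"
        using emb_le[OF le_add(1) v(2), of v "Box (canon b s A)"]
        by (simp del: emb.simps add: emb_cons lacc_mem)
      then show "emb X ?G D t s (hd Ps) w" unfolding R4 list.sel
        by (intro k[OF le_add(1)])
          (use emb_le[OF le_add(1) base, of v "Box (canon b s A)"] v(1) in \<open>unfold emb_cons, blast\<close>)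
    qed (use R4 \<open>v \<in># labels t\<close> in auto)
  next
    case (R5 c d Y A \<Gamma> \<Delta> Z \<Pi> \<Sigma>)
    from R5(5) emb[unfolded R5] obtain u v where
      uv: "emb X G D t s (Seq Y (add_mset (Box A) \<Gamma>) \<Delta> {#}) u" "emb X G D t s (Seq Z \<Pi> \<Sigma> {#}) v" and
      fits: "fits2 X G D t s c w u v" and
      d: "\<forall>d\<ge>1. hole_depth c 0 d \<longrightarrow> (\<exists>p. (p, u) \<in> edges t)"
        "\<forall>d\<ge>1. hole_depth c 1 d \<longrightarrow> (\<exists>p. (p, v) \<in> edges t)"
      by (rule emb_fill2)
    note k = fits2D[OF fits]
    from d(1) R5(6,7) obtain p where p: "(p, u) \<in> edges t" by blast
    have vl: "v \<in># labels t" using emb_label[OF uv(2)] .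
    have F: "canon b s (Box A) \<in># G u" using uv(1) by (simp_all add: lacc_other)
    have A_ok: "fm_ok (Box (canon b s A))" using G_ok[OF F] by simp
    show ?thesis
    proof (rule prov_R5[OF ok R5(4) F[unfolded canon.simps] p vl], rule IH[OF _ range ok_addG[OF ok vl A_ok]])
      let ?G = "G(v := add_mset (Box (canon b s A)) (G v))"
      show "emb X ?G D t s (hd Ps) w" unfolding R5 list.sel
        by (rule k[OF le_add(1) emb_le[OF le_add(1) uv(1)]])
          (use emb_le[OF le_add(1) uv(2), of v "Box (canon b s A)"] in
            \<open>simp del: emb.simps add: emb_cons lacc_mem\<close>)
    qed (simp add: R5)
  next
    case (RCBF c x Y \<Gamma> \<Delta> Z \<Pi> \<Sigma> C)
    from RCBF(5) emb[unfolded RCBF] obtain u where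
      u: "emb X G D t s (Seq (add_mset x Y) \<Gamma> \<Delta> {#Seq Z \<Pi> \<Sigma> C#}) u" and
      fits: "fits1 X G D t s c UNIV w u"
      by (rule emb_hole)
    note k = fits1D[OF fits]
    from u obtain v where v: "(u, v) \<in> edges t" "emb X G D t s (Seq Z \<Pi> \<Sigma> C) v"
      unfolding emb_cons by blast
    have base: "emb X G D t s (Seq (add_mset x Y) \<Gamma> \<Delta> {#}) u" using u unfolding emb_cons by blast
    have x: "s x \<in># X u" using u by simp
    have vl: "v \<in># labels t" using edges_labels[OF v(1)] by simp
    let ?X = "X(v := add_mset (s x) (X v))"
    show ?thesis
    proof (rule prov_RCBF[OF ok RCBF(4) v(1) x], rule IH[OF _ range ok_addX[OF ok vl sE]])
      have "emb ?X G D t s (Seq (add_mset x Z) \<Pi> \<Sigma> C) v"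
        using emb_le[OF le_add(2) v(2), of v "s x"] by (simp del: emb.simps add: emb_cons)
      then show "emb ?X G D t s (hd Ps) w" unfolding RCBF list.sel
        by (intro k[OF le_add(2)])
          (use emb_le[OF le_add(2) base, of v "s x"] v(1) in \<open>unfold emb_cons, blast\<close>)
    qed (simp add: RCBF)
  next
    case (RBF c x Y \<Gamma> \<Delta> Z \<Pi> \<Sigma> C)
    from RBF(5) emb[unfolded RBF] obtain u where
      u: "emb X G D t s (Seq Y \<Gamma> \<Delta> {#Seq (add_mset x Z) \<Pi> \<Sigma> C#}) u" and
      fits: "fits1 X G D t s c UNIV w u"
      by (rule emb_hole)
    note k = fits1D[OF fits]
    have ul: "u \<in># labels t" using emb_label[OF u] .
    from u obtain v where v: "(u, v) \<in> edges t" "emb X G D t s (Seq (add_mset x Z) \<Pi> \<Sigma> C) v"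
      unfolding emb_cons by blast
    have "u \<noteq> v" using separate_edge[OF _ v(1)] ok by (simp add: ok_def)
    have x: "s x \<in># X v" using v(2) by simp
    let ?X = "X(u := add_mset (s x) (X u))"
    show ?thesis
    proof (rule prov_RBF[OF ok RBF(4) v(1) x _ \<open>u \<noteq> v\<close>], rule IH[OF _ range ok_addX[OF ok ul sE]])
      have "s x \<in># ?X u" by simp
      then show "emb ?X G D t s (hd Ps) w" unfolding RBF list.sel
        by (intro k[OF le_add(2)])
          (use emb_le[OF le_add(2) u, of u "s x"] in \<open>unfold emb_cons, blast\<close>)
    qed (simp add: RBF)
  next
    case (RUI c x Y \<Gamma> \<Delta>)
    from RUI(5) emb[unfolded RUI] obtain u where
      u: "emb X G D t s (Seq Y \<Gamma> \<Delta> {#}) u" and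
      fits: "fits1 X G D t s c UNIV w u"
      by (rule emb_hole)
    note k = fits1D[OF fits]
    have ul: "u \<in># labels t" using emb_label[OF u] .
    show ?thesis
    proof (rule prov_RUI[OF ok RUI(4) ul], rule IH[OF _ range ok_addX[OF ok ul sE]])
      show "emb (X(u := add_mset (s x) (X u))) G D t s (hd Ps) w" unfolding RUI list.sel
        by (rule k[OF le_add(2)])
          (use emb_le[OF le_add(2) u, of u "s x"] in \<open>simp del: emb.simps add: emb_cons\<close>)
    qed (simp add: RUI)
  next
    case (R5dom c d e x Y \<Gamma> \<Delta> Z \<Pi> \<Sigma>)
    from R5dom(6) emb[unfolded R5dom] obtain u v where
      uv: "emb X G D t s (Seq (add_mset x Y) \<Gamma> \<Delta> {#}) u" "emb X G D t s (Seq Z \<Pi> \<Sigma> {#}) v" and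
      fits: "fits2 X G D t s c w u v" and
      d: "\<forall>d\<ge>1. hole_depth c 0 d \<longrightarrow> (\<exists>p. (p, u) \<in> edges t)"
        "\<forall>d\<ge>1. hole_depth c 1 d \<longrightarrow> (\<exists>p. (p, v) \<in> edges t)"
      by (rule emb_fill2)
    note k = fits2D[OF fits]
    from d R5dom(7-10) obtain p q where
      pq: "(p, u) \<in> edges t" "(q, v) \<in> edges t" by blast
    have vl: "v \<in># labels t" using emb_label[OF uv(2)] .
    have x: "s x \<in># X u" using uv(1) by simp
    show ?thesis
    proof (rule prov_R5dom[OF ok R5dom(4,5) x pq], rule IH[OF _ range ok_addX[OF ok vl sE]])
      let ?X = "X(v := add_mset (s x) (X v))"
      show "emb ?X G D t s (hd Ps) w" unfolding R5dom list.sel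
        by (rule k[OF le_add(2) emb_le[OF le_add(2) uv(1)]])
          (use emb_le[OF le_add(2) uv(2), of v "s x"] in \<open>simp del: emb.simps add: emb_cons\<close>)
    qed (simp add: R5dom)
  qed
qed simp

end


section \<open>Contraction\<close>

text \<open>Labels can be kept out of any finite set \<open>F\<close>; this allows sibling subtrees
  to be labelled apart, so that their contents combine into single functions.\<close>

lemma labelling:
  assumes "finite F"
  shows "\<exists>t X G D. separate t \<and> set_mset (labels t) \<inter> F = {} \<and> den X G D t = V"
  using assms
proof (induction V arbitrary: F)
  case (Seq Y \<Pi> \<Sigma> C)
  have "\<exists>ss X G D. (\<forall>j. count (\<Sum>\<^sub># (image_mset labels ss)) j \<le> 1) \<and>
      set_mset (\<Sum>\<^sub># (image_mset labels ss)) \<inter> F = {} \<and> image_mset (den X G D) ss = C"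
    if "finite F" for F
    using Seq.IH that
  proof (induction C)
    case empty
    show ?case by (rule exI[of _ "{#}"]) simp
  next
    case (add T C)
    then obtain ss X G D where ss: "\<And>j. count (\<Sum>\<^sub># (image_mset labels ss)) j \<le> 1"
      "set_mset (\<Sum>\<^sub># (image_mset labels ss)) \<inter> F = {}" "image_mset (den X G D) ss = C"
      by (metis insert_iff set_mset_add_mset_insert)
    let ?l = "\<Sum>\<^sub># (image_mset labels ss)"
    have "finite (F \<union> set_mset ?l)" using add.prems(2) by simp
    from add.prems(1)[OF _ this, of T] obtain t X' G' D' where t: "separate t"
      "set_mset (labels t) \<inter> (F \<union> set_mset ?l) = {}" "den X' G' D' t = T" by auto
    define X0 where "X0 i = (if i \<in># labels t then X' i else X i)" for i
    define G0 where "G0 i = (if i \<in># labels t then G' i else G i)" for i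
    define D0 where "D0 i = (if i \<in># labels t then D' i else D i)" for i
    have "image_mset (den X0 G0 D0) ss = image_mset (den X G D) ss"
      using t(2) by (intro image_mset_cong den_cong) (auto simp: X0_def G0_def D0_def)
    moreover have "den X0 G0 D0 t = den X' G' D' t"
      by (rule den_cong) (auto simp: X0_def G0_def D0_def)
    ultimately have "image_mset (den X0 G0 D0) (add_mset t ss) = add_mset T C"
      using t(3) ss(3) by simp
    moreover have "count (\<Sum>\<^sub># (image_mset labels (add_mset t ss))) j \<le> 1" for j
    proof (cases "j \<in># labels t")
      case True
      then have "j \<notin># ?l" using t(2) by blast
      then have "count ?l j = 0" by (simp only: not_in_iff)
      then show ?thesis using t(1) by (simp only: separate_def image_mset_add_mset
            sum_mset.add_mset count_union add_0_right)
    next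
      case False
      then show ?thesis using ss(1)[of j] by (simp add: not_in_iff)
    qed
    moreover have "set_mset (\<Sum>\<^sub># (image_mset labels (add_mset t ss))) \<inter> F = {}"
      using t(2) ss(2) by auto
    ultimately show ?case by blast
  qed
  moreover obtain i where i: "i \<notin> F"
    using ex_new_if_finite[OF infinite_UNIV_nat Seq.prems] by blast
  ultimately obtain ss X G D where ss: "\<And>j. count (\<Sum>\<^sub># (image_mset labels ss)) j \<le> 1"
    "set_mset (\<Sum>\<^sub># (image_mset labels ss)) \<inter> insert i F = {}" "image_mset (den X G D) ss = C"
    using Seq.prems by (metis finite_insert)
  have ni: "i \<notin># \<Sum>\<^sub># (image_mset labels ss)" using ss(2) by blast
  have "count (labels (Sh i ss)) j \<le> 1" for j
  proof (cases "j = i")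
    case True
    have "count (\<Sum>\<^sub># (image_mset labels ss)) i = 0" using ni by (simp only: not_in_iff)
    then show ?thesis unfolding True labels.simps count_add_mset by presburger
  next
    case False
    then show ?thesis using ss(1)[of j] by simp
  qed
  then have "separate (Sh i ss)" by (simp add: separate_def)
  moreover have "set_mset (labels (Sh i ss)) \<inter> F = {}" using i ss(2) by auto
  moreover have "image_mset (den (X(i := Y)) (G(i := \<Pi>)) (D(i := \<Sigma>))) ss = C"
    unfolding ss(3)[symmetric] using ni by (intro image_mset_cong den_cong) auto
  then have "den (X(i := Y)) (G(i := \<Pi>)) (D(i := \<Sigma>)) (Sh i ss) = Seq Y \<Pi> \<Sigma> C" by simp
  ultimately show ?case by blast
qed

lemma rel_mset_rightD: "rel_mset R M N \<Longrightarrow> y \<in># N \<Longrightarrow> \<exists>x\<in>#M. R x y"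
  by (metis insert_DiffM msed_rel_invR union_single_eq_member)

lemma fms_plus: "fms (S + T) = fms S \<union> fms T"
  by (cases S; cases T) auto

lemma fms_fill_mono:
  assumes "set_mset (holes c) \<subseteq> {0}" "fms U \<subseteq> fms V"
  shows "fms (fill [U] c) \<subseteq> fms (fill [V] c)"
  using assms(1)
proof (induction c)
  case (Ctx H Y \<Pi> \<Sigma> C)
  have "fms (fill [U] c) \<subseteq> fms (fill [V] c)" if "c \<in># C" for c
    using that Ctx.prems by (intro Ctx.IH) auto
  then have "fms (Seq Y \<Pi> \<Sigma> (image_mset (fill [U]) C)) \<subseteq> fms (Seq Y \<Pi> \<Sigma> (image_mset (fill [V]) C))"
    by auto
  moreover have "set_mset H \<subseteq> {0}" using Ctx.prems by auto
  then have "fms (\<Sum>i\<in>#H. [U] ! i) \<subseteq> fms (\<Sum>i\<in>#H. [V] ! i)"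
    using assms(2) by (induction H) (auto simp: fms_plus)
  ultimately show ?case unfolding fill.simps fms_plus by blast
qed

lemma fms_variant:
  assumes "variant S S'" "A \<in> fms S"
  obtains A' where "A' \<in> fms S'" "alpha A A'"
proof -
  from assms(1) obtain Z where Z: "fms Z \<subseteq> {(A, A'). alpha A A'}"
    "map_nested fst fst Z = S" "map_nested snd snd Z = S'"
    unfolding variant_def nested.in_rel by blast
  have "fms S = fst ` fms Z" "fms S' = snd ` fms Z"
    unfolding Z(2,3)[symmetric] by (simp_all only: nested.set_map)
  with assms(2) obtain p where "p \<in> fms Z" "A = fst p" "snd p \<in> fms S'" by auto
  with Z(1) that show ?thesis by (metis (mono_tags) case_prodE fst_conv mem_Collect_eq snd_conv subsetD)
qed

lemma den_components:
  assumes "j \<in># labels t"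
  shows "set_mset (X j) \<subseteq> sig_vars (den X G D t)"
    "set_mset (G j) \<subseteq> fms (den X G D t)" "set_mset (D j) \<subseteq> fms (den X G D t)"
  using assms by (induction t) fastforce+

section \<open>Passing to a canonical variant\<close>

context canonical_names
begin

definition e0 :: var where "e0 = (SOME v. v \<in> E)"

text \<open>The identity on \<open>E\<close>, which will contain the free variables of the
  contracted sequent. A given derivation may also use variables from \<open>range b\<close>; they
  need some value in \<open>E\<close>, because \<open>absorb\<close> asks for a map into
  \<open>E\<close>.\<close>

definition proj :: "var \<Rightarrow> var" where "proj v = (if v \<in> E then v else e0)"

lemma e0: "e0 \<in> E"
  unfolding e0_def by (rule someI_ex) (use infinite_free in \<open>metis finite.emptyI ex_in_conv\<close>)

lemma range_proj: "range proj \<subseteq> E"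
  using e0 by (auto simp: proj_def)

text \<open>The induction is on size, since for a quantifier the hypothesis is applied to an
  instance of the scope with a fresh \<open>z\<close>, and such an instance need not be a
  subformula.\<close>

lemma alpha_canon_proj: "fv A \<subseteq> E \<Longrightarrow> alpha A (canon b proj A)"
proof (induction "size A" arbitrary: A rule: less_induct)
  case less
  show ?case
  proof (cases A)
    case (Rel i xs)
    have "map proj xs = xs" by (rule map_idI) (use less.prems Rel in \<open>auto simp: proj_def\<close>)
    then show ?thesis using Rel by (auto intro: alpha.intros)
  next
    case (Eq x y)
    then show ?thesis using less.prems by (auto simp: proj_def intro: alpha.intros)
  next
    case Bot
    then show ?thesis by (auto intro: alpha.intros)
  next
    case (Imp B C)
    then show ?thesis using less by (auto intro: alpha.intros)
  next
    case (Box B)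
    then show ?thesis using less by (auto intro: alpha.intros)
  next
    case (Forall x B)
    let ?y = "b (qdepth B)" and ?B = "canon b (proj(x := b (qdepth B))) B"
    have "finite ({x, ?y} \<union> fv B \<union> bv B \<union> fv ?B \<union> bv ?B)" by (simp add: finite_fv finite_bv)
    then have "\<exists>z\<in>E. z \<notin> {x, ?y} \<union> fv B \<union> bv B \<union> fv ?B \<union> bv ?B"
      using infinite_free by (meson finite_subset subsetI)
    then obtain z where z: "z \<in> E" "z \<notin> {x, ?y} \<union> fv B \<union> bv B \<union> fv ?B \<union> bv ?B" by blast
    have "fv (subst B z x) \<subseteq> E"
      using less.prems z(1) Forall by (auto simp: subst_def fv_ren)
    then have "alpha (subst B z x) (canon b proj (subst B z x))"
      using less.hyps[of "subst B z x"] Forall by simp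
    also have "canon b proj (subst B z x) = canon b (proj(x := z)) B"
      using z(1) by (simp add: canon_subst proj_def)
    also have "\<dots> = subst ?B z ?y" using canon_subst_bound[OF range_proj z(1)] by simp
    finally show ?thesis using z(2) Forall by (auto intro: alpha.intros(5))
  qed
qed

lemma emb_den:
  assumes "den X G D t = map_nested s (canon b s) V"
  shows "emb X G D t s V (root t)"
proof -
  \<comment> \<open>The statement is generalised to subtrees \<open>t\<close> of a fixed tree
    \<open>t'\<close>, since accounts and edges are always taken in the whole tree.\<close>
  have "emb X G D t' s V (root t)"
    if "den X G D t = map_nested s (canon b s) V" "edges t \<subseteq> edges t'" "root t \<in># labels t'" for t t'
    using that
  proof (induction V arbitrary: t)
    case (Seq Y \<Pi> \<Sigma> C)
    obtain i ss where t: "t = Sh i ss" by (cases t)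
    have eq: "X i = image_mset s Y" "G i = image_mset (canon b s) \<Pi>" "D i = image_mset (canon b s) \<Sigma>"
      "image_mset (den X G D) ss = image_mset (map_nested s (canon b s)) C"
      using Seq.prems(1) by (simp_all add: t)
    have "\<exists>v. (i, v) \<in> edges t' \<and> emb X G D t' s T v" if T: "T \<in># C" for T
    proof -
      from T have "map_nested s (canon b s) T \<in># image_mset (den X G D) ss" by (simp add: eq(4))
      then obtain u where u: "u \<in># ss" "den X G D u = map_nested s (canon b s) T" by auto
      have sub: "edges u \<subseteq> edges t'" "(i, root u) \<in> edges t'"
        using Seq.prems(2) u(1) by (auto simp: t)
      have "emb X G D t' s T (root u)"
        by (rule Seq.IH[OF T u(2) sub(1)]) (use edges_labels[OF sub(2)] in simp)
      with sub(2) show ?thesis by blast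
    qed
    then show ?case using Seq.prems(3) by (auto simp: t eq intro!: lacc_mem racc_mem)
  qed
  from this[OF assms subset_refl] show ?thesis by simp
qed

text \<open>\<open>emb\<close> sees formulas only through \<open>canon\<close>, which identifies
  alphabetical variants.\<close>

lemma emb_variant: "variant S S' \<Longrightarrow> emb X G D t s S w \<Longrightarrow> emb X G D t s S' w"
proof (induction S arbitrary: S' w)
  case (Seq Y \<Pi> \<Sigma> C)
  obtain Y' \<Pi>' \<Sigma>' C' where S': "S' = Seq Y' \<Pi>' \<Sigma>' C'" by (cases S')
  have rel: "rel_mset (=) Y Y'" "rel_mset alpha \<Pi> \<Pi>'" "rel_mset alpha \<Sigma> \<Sigma>'"
    "rel_mset (rel_nested (=) alpha) C C'"
    using Seq.prems(1) by (simp_all add: S' variant_def)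
  have "\<exists>v. (w, v) \<in> edges t \<and> emb X G D t s T' v" if T': "T' \<in># C'" for T'
  proof -
    from rel_mset_rightD[OF rel(4) T'] obtain T where T: "T \<in># C" "variant T T'"
      by (auto simp: variant_def)
    from Seq.prems(2) T(1) obtain v where "(w, v) \<in> edges t" "emb X G D t s T v" by auto
    with Seq.IH[OF T] show ?thesis by blast
  qed
  moreover have "lacc (edges t) X G D w (canon b s A')" if A': "A' \<in># \<Pi>'" for A'
    using rel_mset_rightD[OF rel(2) A'] Seq.prems(2) alpha_canon by fastforce
  moreover have "racc (edges t) X G D w (canon b s A')" if A': "A' \<in># \<Sigma>'" for A'
    using rel_mset_rightD[OF rel(3) A'] Seq.prems(2) alpha_canon by fastforce
  moreover have "Y' = Y" using rel(1) by (simp add: multiset.rel_eq)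
  ultimately show ?case using Seq.prems(2) by (simp add: S')
qed

text \<open>\<open>S\<close> is embedded in its canonical variant; hence so is \<open>S0\<close>,
  and so is the variant \<open>S0'\<close> that actually has a derivation. Now \<open>absorb\<close>
  derives the canonical variant of \<open>S\<close>, which is what \<open>derivable_within\<close>
  asks for. The hypothesis on \<open>fms\<close> ensures that its formulas belong to the
  language.\<close>

lemma derivable_within_absorb:
  assumes der: "derivable_within Pr L n S0"
    and fms: "fms S \<subseteq> fms S0" and fvs: "fvs S \<subseteq> E"
    and emb: "\<And>X G D t s w. emb X G D t s S w \<Longrightarrow> emb X G D t s S0 w"
  shows "derivable_within Pr L n S"
proof -
  from der obtain S0' d where S0': "S0' = S0 \<or> variant S0 S0'" and d: "is_derivation Pr L d S0'"
    "height d \<le> n" by (auto simp: derivable_within_def)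
  have lang: "in_lang Pr A" if A: "A \<in> fms S" for A
  proof -
    have "in_lang Pr A" if "A \<in> fms S0'" for A
    proof -
      have "S0' \<in> sequents d" using d(1) by (cases d) (auto simp: is_derivation_def)
      with d(1) that show ?thesis by (auto simp: is_derivation_def)
    qed
    moreover obtain A' where "A' \<in> fms S0'" "A' = A \<or> alpha A A'"
      using S0' A fms fms_variant[of S0 S0' A] by blast
    ultimately show ?thesis using alpha_in_lang[of A A'] by blast
  qed
  let ?S = "map_nested proj (canon b proj) S"
  obtain t X0 G0 D0 where t: "separate t" "den X0 G0 D0 t = ?S"
    using labelling[of "{}" ?S] by blast
  \<comment> \<open>Contents off the tree are emptied, as \<open>ok\<close> demands.\<close>
  define X where "X i = (if i \<in># labels t then X0 i else {#})" for i
  define G where "G i = (if i \<in># labels t then G0 i else {#})" for i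
  define D where "D i = (if i \<in># labels t then D0 i else {#})" for i
  have "den X G D t = den X0 G0 D0 t" by (rule den_cong) (auto simp: X_def G_def D_def)
  then have den: "den X G D t = ?S" using t(2) by simp
  have sig: "set_mset (X j) \<subseteq> sig_vars ?S" if "j \<in># labels t" for j
    using den_components(1)[OF that, of X G D] den by simp
  have fm: "set_mset (G j) \<union> set_mset (D j) \<subseteq> fms ?S" if "j \<in># labels t" for j
    using den_components(2,3)[OF that, of _ X _] den by (metis Un_least)
  have "sig_vars ?S \<subseteq> range proj" by (auto simp: nested.set_map)
  then have "set_mset (X j) \<subseteq> E" for j
    using sig[of j] range_proj by (cases "j \<in># labels t") (simp_all add: X_def)
  moreover have "fm_ok A" if "A \<in># G j \<or> A \<in># D j" for A j
  proof -
    have "j \<in># labels t" using that by (auto simp: G_def D_def split: if_splits)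
    then have "A \<in> fms ?S" using fm[of j] that by auto
    then obtain B where "B \<in> fms S" "A = canon b proj B" by (auto simp: nested.set_map)
    then show ?thesis using fm_ok_canon[OF range_proj lang] by simp
  qed
  moreover have "X j = {#} \<and> G j = {#} \<and> D j = {#}" if "j \<notin># labels t" for j
    using that by (simp add: X_def G_def D_def)
  ultimately have ok: "ok X G D t" using t(1) unfolding ok_def by blast
  have "emb X G D t proj S0 (root t)" by (rule emb[OF emb_den[OF den]])
  then have "emb X G D t proj S0' (root t)" using S0' emb_variant by blast
  moreover have "drv n S0'" using correct_drv[of d n] d by (auto simp: is_derivation_def)
  ultimately have "prov n ?S" using absorb[OF _ range_proj ok] den by metis
  then obtain d' where d': "is_derivation Pr L d' ?S" "height d' \<le> n"
    unfolding prov_def by blast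
  have "variant S ?S"
    unfolding variant_def nested.rel_map(2)
  proof (rule nested.rel_refl_strong)
    fix x assume "x \<in> sig_vars S"
    then show "x = proj x" using fvs by (auto simp: fvs_def proj_def)
  next
    fix A assume "A \<in> fms S"
    then show "alpha A (canon b proj A)" using fvs by (intro alpha_canon_proj) (auto simp: fvs_def)
  qed
  with d' show ?thesis unfolding derivable_within_def by blast
qed

lemma derivable_within_fill:
  assumes "derivable_within Pr L n (fill [V] c)" "is_ctx 1 c"
    and "fms U \<subseteq> fms V" "fvs (fill [U] c) \<subseteq> E"
    and "\<And>X G D t s w. emb X G D t s U w \<Longrightarrow> emb X G D t s V w"
  shows "derivable_within Pr L n (fill [U] c)"
proof (rule derivable_within_absorb[OF assms(1) _ assms(4)])
  show "fms (fill [U] c) \<subseteq> fms (fill [V] c)"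
    using assms(2,3) by (intro fms_fill_mono) (simp_all add: is_ctx_1)
  fix X G D t s w
  assume "emb X G D t s (fill [U] c) w"
  with assms(2) obtain u where "emb X G D t s U u" "fits1 X G D t s c UNIV w u" by (rule emb_hole)
  then show "emb X G D t s (fill [V] c) w"
    using assms(5) le_extend[of X X G G D D t t] by (intro fits1D) auto
qed

end

text \<open>Above a bound \<open>m\<close> of \<open>V\<close>, the numbers at even distance become
  binder names, and those at odd distance stay free for eigenvariables.\<close>

lemma fresh_names:
  assumes "finite V"
  obtains b where "inj b" "infinite (- range b)" "V \<subseteq> - range (b :: nat \<Rightarrow> var)"
proof -
  obtain m where m: "\<And>v. v \<in> V \<Longrightarrow> v < m" using assms finite_nat_set_iff_bounded by auto
  define b where "b h = m + 2 * h" for h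
  have "inj b" by (auto simp: inj_def b_def)
  moreover have "range (\<lambda>h. m + 2 * h + 1) \<subseteq> - range b"
  proof
    fix v assume "v \<in> range (\<lambda>h. m + 2 * h + 1)"
    then obtain h where "v = m + 2 * h + 1" by blast
    moreover have "m + 2 * h + 1 \<noteq> m + 2 * h'" for h' by presburger
    ultimately show "v \<in> - range b" by (auto simp: b_def)
  qed
  moreover have "infinite (range (\<lambda>h. m + 2 * h + 1))"
    by (intro range_inj_infinite) (auto simp: inj_def)
  moreover have "V \<subseteq> - range b" using m by (force simp: b_def)
  ultimately show ?thesis using that by (meson finite_subset)
qed

lemma finite_fvs: "finite (fvs S)"
proof -
  have "finite (sig_vars S)" "finite (fms S)" by (induction S) auto
  then show ?thesis by (simp add: fvs_def finite_fv)
qed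

theorem lemma9:
  fixes Pr :: "nat \<Rightarrow> nat set" and L :: "ax set"
  assumes "properly_closed L"
  shows "hp_admissible Pr L CL \<and> hp_admissible Pr L CR"
proof
  show "hp_admissible Pr L CL"
    unfolding hp_admissible_def
  proof (intro allI impI)
    fix n Ps S assume "CL Ps S" "\<forall>P\<in>set Ps. derivable_within Pr L n P"
    then obtain c X A \<Gamma> \<Delta> where c: "is_ctx 1 c"
      and der: "derivable_within Pr L n (fill [Seq X (add_mset A (add_mset A \<Gamma>)) \<Delta> {#}] c)"
      and S: "S = fill [Seq X (add_mset A \<Gamma>) \<Delta> {#}] c"
      by (auto elim!: CL.cases)
    obtain b :: "nat \<Rightarrow> var" where b: "inj b" "infinite (- range b)" "fvs S \<subseteq> - range b"
      by (rule fresh_names[OF finite_fvs[of S]])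
    interpret canonical_names b Pr L using b(1,2) by unfold_locales
    \<comment> \<open>Contraction happens here: since \<open>emb\<close> ignores multiplicities,
      every embedding of the sequent with one \<open>A\<close> is also an embedding of the sequent
      with two.\<close>
    show "derivable_within Pr L n S"
      unfolding S by (rule derivable_within_fill[OF der c]) (use b(3) S in auto)
  qed
  show "hp_admissible Pr L CR"
    unfolding hp_admissible_def
  proof (intro allI impI)
    fix n Ps S assume "CR Ps S" "\<forall>P\<in>set Ps. derivable_within Pr L n P"
    then obtain c X A \<Gamma> \<Delta> where c: "is_ctx 1 c"
      and der: "derivable_within Pr L n (fill [Seq X \<Gamma> (add_mset A (add_mset A \<Delta>)) {#}] c)"
      and S: "S = fill [Seq X \<Gamma> (add_mset A \<Delta>) {#}] c"
      by (auto elim!: CR.cases)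
    obtain b :: "nat \<Rightarrow> var" where b: "inj b" "infinite (- range b)" "fvs S \<subseteq> - range b"
      by (rule fresh_names[OF finite_fvs[of S]])
    interpret canonical_names b Pr L using b(1,2) by unfold_locales
    show "derivable_within Pr L n S"
      unfolding S by (rule derivable_within_fill[OF der c]) (use b(3) S in auto)
  qed
qed

end
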